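(* The following hold (with $t$ an integer): \begin{itemize} \item $n_3(5,2;13t)=121t$ for $t\ge 1$; \item $n_3(5,2;13t-1)=121t-10$ for $t\ge 1$; \item $n_3(5,2;13t-2)=121t-20$ for $t\ge 1$; \item $n_3(5,2;13t-3)=121t-30$ for $t\ge 1$; \item $n_3(5,2;13t-4)=121t-40$ for $t\ge 1$; \item $n_3(5,2;13t-5)=121t-50$ for $t\ge 1$; \item $n_3(5,2;13t-6)=121t-60$ for $t\ge 1$; \item $n_3(5,2;13t-7)=121t-67$ for $t\ge 1$; \item $n_3(5,2;13t-8)=121t-77$ for $t\ge 1$; \item $n_3(5,2;13t-9)=121t-87$ for $t\ge 1$; \item $n_3(5,2;13t-10)=121t-94$ for $t\ge 1$; \item $n_3(5,2;13t-11)=121t-104$ for $t\ge 2$, and $n_3(5,2;2)=12$; \item $n_3(5,2;13t-12)=121t-114$ for $t\ge 2$, and $n_3(5,2;1)=1$. \end{itemize}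
   Context: All dimensions are vector-space dimensions; a hyperplane of $\mathbb{F}_q^r$ is an $(r-1)$-dimensional subspace. A projective $h-(n,r,s)_q$ system is a multiset of $n$ subspaces of $\mathbb{F}_q^r$, each of dimension at most $h$, such that each hyperplane contains at most $s$ of these subspaces (counted with multiplicity) and some hyperplane contains exactly $s$ of them. $n_q(r,h;s)$ denotes the maximum $n$ such that a projective $h-(n,r,s)_q$ system exists. *)

theory Defs
  imports "HOL-Analysis.Cartesian_Space" "HOL-Library.Multiset" "HOL-Library.Numeral_Type"
begin

text \<open>
  The space \<open>F\<^sub>q\<^sup>r\<close> is the type \<^typ>\<open>'q ^ 'r\<close>, where \<open>'q\<close> is a finite field with
  \<open>q = CARD('q)\<close> elements and \<open>r = CARD('r)\<close>; linear notions are those of the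
  locale interpretation \<open>vec\<close>.
\<close>

definition hyperplane :: "('q::{field,finite} ^ 'r) set \<Rightarrow> bool" where
  "hyperplane H \<longleftrightarrow> vec.subspace H \<and> vec.dim H = CARD('r) - 1"

definition num_contained :: "'v set multiset \<Rightarrow> 'v set \<Rightarrow> nat" where
  "num_contained \<S> H = size {# S \<in># \<S>. S \<subseteq> H #}"

definition projective_system ::
    "nat \<Rightarrow> nat \<Rightarrow> nat \<Rightarrow> ('q::{field,finite} ^ 'r) set multiset \<Rightarrow> bool" where
  "projective_system h n s \<S> \<longleftrightarrow>
     size \<S> = n \<and>
     (\<forall>S \<in># \<S>. vec.subspace S \<and> vec.dim S \<le> h) \<and>
     (\<forall>H. hyperplane H \<longrightarrow> num_contained \<S> H \<le> s) \<and>
     (\<exists>H. hyperplane H \<and> num_contained \<S> H = s)"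

text \<open>
  The following is \<open>n\<^sub>q(r,h;s)\<close>, with \<open>q\<close> and \<open>r\<close> given by the type argument. For \<open>h < r\<close> the
  maximum exists: every member of a system lies in some hyperplane, so \<open>n\<close> is at
  most \<open>s\<close> times the number of hyperplanes, and \<open>s\<close> copies of the zero subspace
  form a system. For \<open>h \<ge> r\<close> the set is infinite and the value carries no meaning.
\<close>

definition n_max :: "('q::{field,finite} ^ 'r) itself \<Rightarrow> nat \<Rightarrow> nat \<Rightarrow> nat" where
  "n_max _ h s = Max {n. \<exists>\<S> :: ('q ^ 'r) set multiset. projective_system h n s \<S>}"

end

theory Submission
  imports Defs
begin

text \<open>
  Upper bounds. All subspaces of a system may be enlarged to lines. Counting, for a subspace \<open>U\<close>, the
  points of \<open>U\<close> on the lines and averaging over the subspaces one dimension higher yields a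
  Griesmer bound, which with rounding is the exact value except for \<open>s = 1\<close> and \<open>s = 2\<close>.

  For \<open>s = 2\<close>, the annihilators of 13 lines are three-dimensional subspaces \<open>A\<^sub>0, \<dots>, A\<^sub>1\<^sub>2\<close> of \<open>F\<^sub>3\<^sup>5\<close>, any
  two of which meet in a one-dimensional space while no three share a nonzero vector. In each coset
  \<open>g + A\<^sub>0\<close>, the other twelve cut out twelve affine lines, in all directions of \<open>A\<^sub>0\<close> but one and with at
  most two lines through each point. The lines in the cosets of \<open>g\<close> and \<open>g'\<close> determine those in the
  cosets of \<open>g + g'\<close> and \<open>g - g'\<close>. In suitable coordinates only few possibilities for \<open>g\<close> remain, and
  a search through the extensions to \<open>g'\<close> excludes all of them.

  Lower bounds come from sums of a few explicit families of lines.
\<close>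

section \<open>Search for line configurations in three-dimensional affine space\<close>

text \<open>For \<open>s = 2\<close> the Griesmer bound only gives 17 lines and for
  \<open>s = 1\<close> only 7, so thirteen lines have to be excluded by structure. Thirteen is just
  enough for rigidity: \<open>A 0\<close> has 26 nonzero vectors, each of the twelve other
  annihilators takes at least two of them, and none is taken twice. Hence each takes exactly two,
  and one pair \<open>h5\<close>, \<open>- h5\<close> remains, the missing direction. To keep the
  search small, \<open>g\<close> is not arbitrary but taken in \<open>ker x - A 0\<close>, where
  \<open>x\<close> in \<open>l 0\<close> is chosen by averaging so that few vectors there lie on
  exactly one of the other annihilators. Parity then leaves 0 or 4 of them, that is 0 or 2 in the
  coset of \<open>g\<close>. This is the origin of the two kinds of cases, \<open>None\<close> and
  \<open>Some\<close>, of the bound 18 or 19 on the number of covered points, and of the parity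
  conditions on planes. The second coset lies outside \<open>ker x\<close>, where nothing of this
  kind is known, so only the loads are tested there.\<close>

datatype trit = T0 | T1 | T2

lemma UNIV_trit: "UNIV = {T0, T1, T2}"
  using trit.exhaust by auto

instance trit :: finite
  by standard (simp add: UNIV_trit)

fun tadd :: "trit \<Rightarrow> trit \<Rightarrow> trit" where
  "tadd T0 y = y"
| "tadd T1 T0 = T1" | "tadd T1 T1 = T2" | "tadd T1 T2 = T0"
| "tadd T2 T0 = T2" | "tadd T2 T1 = T0" | "tadd T2 T2 = T1"

fun tneg :: "trit \<Rightarrow> trit" where
  "tneg T0 = T0" | "tneg T1 = T2" | "tneg T2 = T1"

fun tmul :: "trit \<Rightarrow> trit \<Rightarrow> trit" where
  "tmul T0 y = T0" | "tmul T1 y = y" | "tmul T2 y = tneg y"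

type_synonym point = "trit \<times> trit \<times> trit"

text \<open>
  The directions of \<open>F\<^sub>3\<^sup>3\<close> other than \<open>(0, 0, 1)\<close>: \<open>DA m n\<close> is \<open>(1, m, n)\<close> and \<open>DB n\<close> is \<open>(0, 1, n)\<close>.
\<close>

datatype dir = DA trit trit | DB trit

lemma UNIV_dir: "UNIV = case_prod DA ` UNIV \<union> range DB"
proof -
  have "d \<in> case_prod DA ` UNIV \<union> range DB" for d
    by (cases d) auto
  then show ?thesis by blast
qed

instance dir :: finite
  by standard (simp add: UNIV_dir)

text \<open>The label \<open>(u, v)\<close> is the point of the line at parameter 0, that is at
  \<open>x = T0\<close> for \<open>DA\<close> and at \<open>y = T0\<close> for \<open>DB\<close>. In
  each direction these points form a subspace, so labels add when cosets are added; see
  \<open>shift\<close>.\<close>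

fun on_line :: "dir \<Rightarrow> trit \<times> trit \<Rightarrow> point \<Rightarrow> bool" where
  "on_line (DA m n) (u, v) (x, y, z) \<longleftrightarrow> y = tadd u (tmul m x) \<and> z = tadd v (tmul n x)"
| "on_line (DB n) (u, v) (x, y, z) \<longleftrightarrow> x = u \<and> z = tadd v (tmul n y)"

datatype 'a tri = Tri 'a 'a 'a

fun sel :: "trit \<Rightarrow> 'a tri \<Rightarrow> 'a" where
  "sel T0 (Tri a b c) = a" | "sel T1 (Tri a b c) = b" | "sel T2 (Tri a b c) = c"

text \<open>
  A grid records through how many of the lines chosen so far each point passes; operations on it
  fail when a point would get a third line.
\<close>

datatype load = L0 | L1 | L2

fun weight :: "load \<Rightarrow> nat" where
  "weight L0 = 0" | "weight L1 = 1" | "weight L2 = 2"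

type_synonym grid = "load tri tri tri"

fun load_at :: "grid \<Rightarrow> point \<Rightarrow> load" where
  "load_at G (x, y, z) = sel z (sel y (sel x G))"

fun bump1 :: "trit \<Rightarrow> load tri \<Rightarrow> load tri option" where
  "bump1 T0 (Tri L0 b c) = Some (Tri L1 b c)"
| "bump1 T0 (Tri L1 b c) = Some (Tri L2 b c)"
| "bump1 T0 (Tri L2 b c) = None"
| "bump1 T1 (Tri a L0 c) = Some (Tri a L1 c)"
| "bump1 T1 (Tri a L1 c) = Some (Tri a L2 c)"
| "bump1 T1 (Tri a L2 c) = None"
| "bump1 T2 (Tri a b L0) = Some (Tri a b L1)"
| "bump1 T2 (Tri a b L1) = Some (Tri a b L2)"
| "bump1 T2 (Tri a b L2) = None"

fun subst :: "trit \<Rightarrow> 'a option \<Rightarrow> 'a tri \<Rightarrow> 'a tri option" where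
  "subst i None t = None"
| "subst T0 (Some x) (Tri a b c) = Some (Tri x b c)"
| "subst T1 (Some x) (Tri a b c) = Some (Tri a x c)"
| "subst T2 (Some x) (Tri a b c) = Some (Tri a b x)"

fun bump2 :: "trit \<Rightarrow> trit \<Rightarrow> load tri tri \<Rightarrow> load tri tri option" where
  "bump2 T0 z (Tri a b c) = subst T0 (bump1 z a) (Tri a b c)"
| "bump2 T1 z (Tri a b c) = subst T1 (bump1 z b) (Tri a b c)"
| "bump2 T2 z (Tri a b c) = subst T2 (bump1 z c) (Tri a b c)"

text \<open>\<open>rows1\<close>, \<open>rows2\<close> and \<open>rows3\<close> chain three options
  by pattern matching: a row is bumped only once the earlier ones have succeeded, so evaluation
  stops at the first full point. The \<open>slabs\<close> functions do the same one dimension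
  higher.\<close>

fun rows3 :: "load tri \<Rightarrow> load tri \<Rightarrow> load tri option \<Rightarrow> load tri tri option" where
  "rows3 a b None = None"
| "rows3 a b (Some c) = Some (Tri a b c)"

fun rows2 :: "load tri \<Rightarrow> load tri option \<Rightarrow> trit \<Rightarrow> load tri \<Rightarrow> load tri tri option" where
  "rows2 a None z c = None"
| "rows2 a (Some b) z c = rows3 a b (bump1 z c)"

fun rows1 :: "load tri option \<Rightarrow> trit \<Rightarrow> load tri \<Rightarrow> trit \<Rightarrow> load tri \<Rightarrow> load tri tri option" where
  "rows1 None z b z' c = None"
| "rows1 (Some a) z b z' c = rows2 a (bump1 z b) z' c"

fun bump_rows :: "trit \<Rightarrow> trit \<Rightarrow> load tri tri \<Rightarrow> load tri tri option" where
  "bump_rows n v (Tri a b c) = rows1 (bump1 v a) (tadd v n) b (tadd v (tneg n)) c"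

fun slabs3 :: "load tri tri \<Rightarrow> load tri tri \<Rightarrow> load tri tri option \<Rightarrow> grid option" where
  "slabs3 a b None = None"
| "slabs3 a b (Some c) = Some (Tri a b c)"

fun slabs2 :: "load tri tri \<Rightarrow> load tri tri option \<Rightarrow> trit \<Rightarrow> trit \<Rightarrow> load tri tri \<Rightarrow> grid option" where
  "slabs2 a None y z c = None"
| "slabs2 a (Some b) y z c = slabs3 a b (bump2 y z c)"

fun slabs1 :: "load tri tri option \<Rightarrow> trit \<Rightarrow> trit \<Rightarrow> load tri tri \<Rightarrow> trit \<Rightarrow> trit \<Rightarrow> load tri tri \<Rightarrow> grid option" where
  "slabs1 None y z b y' z' c = None"
| "slabs1 (Some a) y z b y' z' c = slabs2 a (bump2 y z b) y' z' c"

fun add_line :: "dir \<Rightarrow> trit \<Rightarrow> trit \<Rightarrow> grid \<Rightarrow> grid option" where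
  "add_line (DA m n) u v (Tri a b c) =
     slabs1 (bump2 u v a) (tadd u m) (tadd v n) b (tadd u (tneg m)) (tadd v (tneg n)) c"
| "add_line (DB n) T0 v (Tri a b c) = subst T0 (bump_rows n v a) (Tri a b c)"
| "add_line (DB n) T1 v (Tri a b c) = subst T1 (bump_rows n v b) (Tri a b c)"
| "add_line (DB n) T2 v (Tri a b c) = subst T2 (bump_rows n v c) (Tri a b c)"

text \<open>
  The twelve lines have 36 incidences, so if every point is on at most two lines, then at most
  \<open>18 + \<sigma> div 2\<close> points are covered, where \<open>\<sigma>\<close> is the number of points on exactly one line. The
  search spends this budget on newly covered points; if \<open>\<sigma> = 2\<close>, the point \<open>(1, 0, 0)\<close> is prepaid
  by the initial grid.
\<close>

fun pay :: "load \<Rightarrow> nat \<Rightarrow> nat option" where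
  "pay L0 0 = None"
| "pay L0 (Suc k) = Some k"
| "pay L1 k = Some k"
| "pay L2 k = Some k"

fun pay_line :: "dir \<Rightarrow> trit \<Rightarrow> trit \<Rightarrow> grid \<Rightarrow> nat \<Rightarrow> nat option" where
  "pay_line (DA m n) u v (Tri a b c) k =
     (case pay (sel v (sel u a)) k of None \<Rightarrow> None | Some k \<Rightarrow>
     (case pay (sel (tadd v n) (sel (tadd u m) b)) k of None \<Rightarrow> None | Some k \<Rightarrow>
       pay (sel (tadd v (tneg n)) (sel (tadd u (tneg m)) c)) k))"
| "pay_line (DB n) u v G k = (case sel u G of Tri a b c \<Rightarrow>
     (case pay (sel v a) k of None \<Rightarrow> None | Some k \<Rightarrow>
     (case pay (sel (tadd v n) b) k of None \<Rightarrow> None | Some k \<Rightarrow>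
       pay (sel (tadd v (tneg n)) c) k)))"

type_synonym assignment = "(dir \<times> trit \<times> trit) list"

text \<open>The four planes through the missing direction \<open>(0, 0, 1)\<close> split the twelve
  directions into four groups of three: \<open>Some m\<close> is the plane \<open>y = m x\<close>
  and \<open>None\<close> the plane \<open>x = 0\<close>.\<close>

fun group :: "dir \<Rightarrow> trit option" where
  "group (DA m n) = Some m"
| "group (DB n) = None"

text \<open>Numbers the three parallels of the plane of a group. It is constant along every line of
  that group and equals the first entry of the label.\<close>

fun plane_class :: "trit option \<Rightarrow> trit \<times> trit \<Rightarrow> trit" where
  "plane_class (Some m) (x, y) = tadd y (tneg (tmul m x))"
| "plane_class None (x, y) = x"

text \<open>
  A plane parallel to \<open>(0, 0, 1)\<close> meets the nine lines of the other groups in one point and those of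
  its own group in no or three points. Hence the number of lines inside it is odd exactly if it has
  an even number of points on exactly one line. The optional argument gives the first two
  coordinates of the second such point, the first being \<open>(1, 0, 0)\<close>; \<open>None\<close> means that there are no
  such points.
\<close>

fun parities :: "(trit \<times> trit) option \<Rightarrow> trit option \<Rightarrow> bool tri" where
  "parities None g = Tri True True True"
| "parities (Some q) g = (let a = plane_class g (T1, T0); b = plane_class g q in
     Tri ((a = T0) = (b = T0)) ((a = T1) = (b = T1)) ((a = T2) = (b = T2)))"

fun toggle :: "trit \<Rightarrow> bool tri \<Rightarrow> bool tri" where
  "toggle T0 (Tri a b c) = Tri (\<not> a) b c"
| "toggle T1 (Tri a b c) = Tri a (\<not> b) c"
| "toggle T2 (Tri a b c) = Tri a b (\<not> c)"

fun any3 :: "bool tri \<Rightarrow> bool" where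
  "any3 (Tri a b c) \<longleftrightarrow> a \<or> b \<or> c"

fun all3 :: "bool tri \<Rightarrow> bool" where
  "all3 (Tri a b c) \<longleftrightarrow> a \<and> b \<and> c"

text \<open>\<open>R\<close> marks the planes that still need an odd number of lines of the group;
  it starts with an odd number of marks. The third line has to clear everything. After the second
  line one or three marks remain, and three cannot be cleared by one line. The first line is always
  harmless.\<close>

fun fits :: "trit list \<Rightarrow> bool tri \<Rightarrow> trit \<Rightarrow> bool" where
  "fits [a, b] R u \<longleftrightarrow> \<not> any3 (toggle u R)"
| "fits [a] R u \<longleftrightarrow> \<not> all3 (toggle u R)"
| "fits us R u \<longleftrightarrow> True"

fun mates :: "trit option \<Rightarrow> assignment \<Rightarrow> trit list" where
  "mates g [] = []"
| "mates g ((d, u, v) # s) = (if group d = g then u # mates g s else mates g s)"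

fun try_a :: "trit list \<Rightarrow> bool tri \<Rightarrow> dir \<Rightarrow> trit \<Rightarrow> trit \<Rightarrow> nat \<Rightarrow> grid \<Rightarrow> (nat \<times> grid) option" where
  "try_a us R d u v k G = (if fits us R u then
     (case add_line d u v G of None \<Rightarrow> None | Some G' \<Rightarrow>
     (case pay_line d u v G k of None \<Rightarrow> None | Some k' \<Rightarrow> Some (k', G'))) else None)"

text \<open>
  The first search finds all choices of one line per direction for a single coset. The second one,
  \<open>dead\<close>, refutes each of them by choosing lines for a second coset such that the induced choices
  for the two combinations of the cosets are admissible as well.
\<close>

primrec leaves :: "(trit \<times> trit) option \<Rightarrow> dir list \<Rightarrow> assignment \<Rightarrow> nat \<times> grid \<Rightarrow> assignment list" where
  "leaves q [] s kG = [s]"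
| "leaves q (d # ds) s kG = (let k = fst kG; G = snd kG; us = mates (group d) s; R = fold toggle us (parities q (group d)) in
    (case try_a us R d T0 T0 k G of None \<Rightarrow> [] | Some kG' \<Rightarrow> leaves q ds ((d, T0, T0) # s) kG') @
    (case try_a us R d T0 T1 k G of None \<Rightarrow> [] | Some kG' \<Rightarrow> leaves q ds ((d, T0, T1) # s) kG') @
    (case try_a us R d T0 T2 k G of None \<Rightarrow> [] | Some kG' \<Rightarrow> leaves q ds ((d, T0, T2) # s) kG') @
    (case try_a us R d T1 T0 k G of None \<Rightarrow> [] | Some kG' \<Rightarrow> leaves q ds ((d, T1, T0) # s) kG') @
    (case try_a us R d T1 T1 k G of None \<Rightarrow> [] | Some kG' \<Rightarrow> leaves q ds ((d, T1, T1) # s) kG') @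
    (case try_a us R d T1 T2 k G of None \<Rightarrow> [] | Some kG' \<Rightarrow> leaves q ds ((d, T1, T2) # s) kG') @
    (case try_a us R d T2 T0 k G of None \<Rightarrow> [] | Some kG' \<Rightarrow> leaves q ds ((d, T2, T0) # s) kG') @
    (case try_a us R d T2 T1 k G of None \<Rightarrow> [] | Some kG' \<Rightarrow> leaves q ds ((d, T2, T1) # s) kG') @
    (case try_a us R d T2 T2 k G of None \<Rightarrow> [] | Some kG' \<Rightarrow> leaves q ds ((d, T2, T2) # s) kG'))"

text \<open>\<open>(a, a')\<close> is the label for the first coset \<open>g\<close> and
  \<open>(u, v)\<close> the choice for the second coset \<open>g'\<close>; the three grids belong to
  \<open>g'\<close>, \<open>g' + g\<close> and \<open>g' - g\<close>.\<close>

fun try_b :: "dir \<Rightarrow> trit \<Rightarrow> trit \<Rightarrow> trit \<Rightarrow> trit \<Rightarrow> grid \<times> grid \<times> grid \<Rightarrow> (grid \<times> grid \<times> grid) option" where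
  "try_b d a a' u v (G, H, K) =
     (case add_line d u v G of None \<Rightarrow> None | Some G' \<Rightarrow>
     (case add_line d (tadd u a) (tadd v a') H of None \<Rightarrow> None | Some H' \<Rightarrow>
     (case add_line d (tadd u (tneg a)) (tadd v (tneg a')) K of None \<Rightarrow> None | Some K' \<Rightarrow>
       Some (G', H', K'))))"

primrec dead :: "assignment \<Rightarrow> grid \<times> grid \<times> grid \<Rightarrow> bool" where
  "dead [] S = False"
| "dead (x # s) S \<longleftrightarrow> (let d = fst x; a = fst (snd x); a' = snd (snd x) in
    (case try_b d a a' T0 T0 S of None \<Rightarrow> True | Some S' \<Rightarrow> dead s S') \<and>
    (case try_b d a a' T0 T1 S of None \<Rightarrow> True | Some S' \<Rightarrow> dead s S') \<and>
    (case try_b d a a' T0 T2 S of None \<Rightarrow> True | Some S' \<Rightarrow> dead s S') \<and>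
    (case try_b d a a' T1 T0 S of None \<Rightarrow> True | Some S' \<Rightarrow> dead s S') \<and>
    (case try_b d a a' T1 T1 S of None \<Rightarrow> True | Some S' \<Rightarrow> dead s S') \<and>
    (case try_b d a a' T1 T2 S of None \<Rightarrow> True | Some S' \<Rightarrow> dead s S') \<and>
    (case try_b d a a' T2 T0 S of None \<Rightarrow> True | Some S' \<Rightarrow> dead s S') \<and>
    (case try_b d a a' T2 T1 S of None \<Rightarrow> True | Some S' \<Rightarrow> dead s S') \<and>
    (case try_b d a a' T2 T2 S of None \<Rightarrow> True | Some S' \<Rightarrow> dead s S'))"

definition empty_grid :: grid where
  "empty_grid = (let r = Tri L0 L0 L0; s = Tri r r r in Tri s s s)"

text \<open>The load 1 does more than prepay the point: as \<open>(1, 0, 0)\<close> is to lie on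
  exactly one line, it also makes a second line through it fail.\<close>

definition marked_grid :: grid where
  "marked_grid = (let r = Tri L0 L0 L0; s = Tri r r r in Tri s (Tri (Tri L1 L0 L0) r r) s)"

text \<open>With no mates \<open>fits\<close> is vacuous, so the first three lines are tested for
  load and budget only.\<close>

fun force :: "dir \<Rightarrow> trit \<Rightarrow> trit \<Rightarrow> (nat \<times> grid) option \<Rightarrow> (nat \<times> grid) option" where
  "force d u v None = None"
| "force d u v (Some (k, G)) = try_a [] (Tri True True True) d u v k G"

text \<open>Two singles allow 19 covered points, but one of these is prepaid in
  \<open>marked_grid\<close>; so the budget is 18 in both cases.\<close>

fun start :: "(trit \<times> trit) option \<Rightarrow> nat \<times> grid" where
  "start None = (18, empty_grid)"
| "start (Some q) = (18, marked_grid)"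

definition root_leaves :: "(trit \<times> trit) option \<Rightarrow> trit \<Rightarrow> trit \<Rightarrow> dir list \<Rightarrow> assignment list" where
  "root_leaves q u v ds =
    (case force (DA T1 T0) u v (force (DB T0) T0 T0 (force (DA T0 T0) T0 T0 (Some (start q)))) of
       None \<Rightarrow> []
     | Some kG \<Rightarrow> leaves q ds [(DA T1 T0, u, v), (DB T0, T0, T0), (DA T0 T0, T0, T0)] kG)"

text \<open>The labels \<open>(0, 0)\<close>, \<open>(0, 1)\<close>, \<open>(w, 0)\<close> of the
  second coset are the normal form produced by \<open>choose_h2\<close>; only \<open>w\<close> is
  left to try.\<close>

fun dead_from :: "trit \<Rightarrow> trit \<Rightarrow> trit \<Rightarrow> assignment \<Rightarrow> bool" where
  "dead_from u v w s = (let E = empty_grid in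
     (case try_b (DA T0 T0) T0 T0 T0 T0 (E, E, E) of None \<Rightarrow> True | Some S \<Rightarrow>
     (case try_b (DB T0) T0 T0 T0 T1 S of None \<Rightarrow> True | Some S \<Rightarrow>
     (case try_b (DA T1 T0) u v w T0 S of None \<Rightarrow> True | Some S \<Rightarrow> dead s S))))"

fun arrange :: "assignment \<Rightarrow> dir list \<Rightarrow> assignment" where
  "arrange s [] = []"
| "arrange s (d # ds) = (case map_of s d of None \<Rightarrow> arrange s ds | Some a \<Rightarrow> (d, a) # arrange s ds)"

text \<open>The stored order is mere advice. Soundness asks that no direction be treated twice; a
  refutation by some of the directions is as good as one by all.\<close>

fun check_leaf :: "trit \<Rightarrow> trit \<Rightarrow> dir list \<Rightarrow> assignment \<Rightarrow> bool" where
  "check_leaf u v ds s \<longleftrightarrow> distinct (DA T0 T0 # DB T0 # DA T1 T0 # ds) \<and>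
     (let s' = arrange s ds in dead_from u v T0 s' \<and> dead_from u v T1 s' \<and> dead_from u v T2 s')"

definition check_root :: "(trit \<times> trit) option \<Rightarrow> trit \<Rightarrow> trit \<Rightarrow> dir list \<Rightarrow> dir list list \<Rightarrow> bool" where
  "check_root q u v ds dss \<longleftrightarrow> list_all2 (check_leaf u v) dss (root_leaves q u v ds)"

definition search_order :: "dir list" where
  "search_order = [DA T0 T2, DA T0 T1, DA T1 T2, DA T1 T1, DA T2 T2, DA T2 T1, DA T2 T0, DB T2, DB T1]"

text \<open>
  For each case, the orders in which \<open>dead\<close> treats the directions, one for each result of \<open>leaves\<close>.
  They were found by computer, so as to keep the search trees small.
\<close>

definition orders :: "((trit \<times> trit) option \<times> trit \<times> trit) \<Rightarrow> dir list list" where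
  "orders r = (case map_of
    [((None, T0, T1),
     [[DA T1 T1, DA T1 T2, DA T0 T1, DA T0 T2, DA T2 T2, DA T2 T1, DA T2 T0, DB T1, DB T2],
     [DA T1 T1, DA T1 T2, DA T0 T2, DA T0 T1, DA T2 T0, DA T2 T2, DA T2 T1, DB T2, DB T1],
     [DA T0 T1, DA T1 T2, DA T0 T2, DA T1 T1, DA T2 T1, DB T2, DB T1, DA T2 T2, DA T2 T0],
     [DB T1, DB T2, DA T1 T1, DA T1 T2, DA T0 T1, DA T2 T1, DA T0 T2, DA T2 T0, DA T2 T2],
     [DA T0 T2, DA T1 T1, DA T0 T1, DA T1 T2, DA T2 T1, DA T2 T0, DB T1, DB T2, DA T2 T2],
     [DB T2, DB T1, DA T1 T2, DA T1 T1, DA T0 T2, DA T2 T2, DA T0 T1, DA T2 T1, DA T2 T0],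
     [DA T0 T2, DA T0 T1, DA T1 T2, DA T1 T1, DA T2 T0, DB T1, DB T2, DA T2 T1, DA T2 T2],
     [DB T1, DB T2, DA T1 T1, DA T1 T2, DA T0 T2, DA T0 T1, DA T2 T1, DA T2 T0, DA T2 T2],
     [DB T1, DB T2, DA T1 T1, DA T1 T2, DA T2 T0, DA T0 T2, DA T0 T1, DA T2 T2, DA T2 T1],
     [DA T1 T1, DA T1 T2, DB T1, DB T2, DA T2 T1, DA T2 T2, DA T2 T0, DA T0 T1, DA T0 T2],
     [DB T2, DB T1, DA T1 T1, DA T1 T2, DA T2 T0, DA T0 T1, DA T0 T2, DA T2 T1, DA T2 T2],
     [DB T2, DB T1, DA T1 T1, DA T1 T2, DA T0 T1, DA T0 T2, DA T2 T0, DA T2 T2, DA T2 T1],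
     [DB T1, DB T2, DA T1 T1, DA T1 T2, DA T0 T2, DA T2 T1, DA T0 T1, DA T2 T0, DA T2 T2],
     [DA T1 T1, DB T2, DA T1 T2, DB T1, DA T2 T1, DA T0 T1, DA T0 T2, DA T2 T0, DA T2 T2],
     [DB T1, DB T2, DA T1 T2, DA T1 T1, DA T0 T1, DA T2 T0, DA T2 T1, DA T2 T2, DA T0 T2],
     [DA T0 T1, DA T0 T2, DA T1 T1, DA T1 T2, DB T1, DA T2 T1, DB T2, DA T2 T2, DA T2 T0],
     [DA T0 T2, DA T0 T1, DA T1 T1, DA T1 T2, DB T2, DA T2 T2, DB T1, DA T2 T0, DA T2 T1],
     [DA T1 T1, DA T1 T2, DB T2, DB T1, DA T2 T0, DA T2 T2, DA T2 T1, DA T0 T1, DA T0 T2],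
     [DA T0 T1, DA T0 T2, DA T1 T2, DA T1 T1, DA T2 T0, DB T1, DB T2, DA T2 T2, DA T2 T1],
     [DA T0 T1, DA T0 T2, DA T1 T2, DA T1 T1, DB T2, DA T2 T1, DB T1, DA T2 T2, DA T2 T0],
     [DA T1 T2, DB T1, DB T2, DA T1 T1, DA T2 T2, DA T0 T2, DA T0 T1, DA T2 T0, DA T2 T1],
     [DA T0 T2, DA T0 T1, DA T1 T1, DA T1 T2, DB T1, DA T2 T2, DB T2, DA T2 T1, DA T2 T0],
     [DA T0 T2, DA T0 T1, DA T1 T1, DA T1 T2, DB T1, DB T2, DA T2 T2, DA T2 T1, DA T2 T0],
     [DA T0 T2, DA T0 T1, DA T1 T2, DA T1 T1, DB T1, DB T2, DA T2 T1, DA T2 T0, DA T2 T2]]),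
     ((None, T1, T1),
     [[DB T1, DA T1 T2, DA T1 T1, DB T2, DA T0 T2, DA T2 T2, DA T2 T0, DA T0 T1, DA T2 T1],
     [DB T2, DA T1 T1, DB T1, DA T1 T2, DA T0 T2, DA T0 T1, DA T2 T1, DA T2 T0, DA T2 T2],
     [DA T0 T1, DA T1 T2, DA T0 T2, DA T1 T1, DA T2 T1, DB T1, DB T2, DA T2 T2, DA T2 T0],
     [DA T1 T2, DA T0 T1, DA T0 T2, DA T1 T1, DB T1, DB T2, DA T2 T0, DA T2 T2, DA T2 T1],
     [DA T1 T2, DA T0 T1, DA T0 T2, DA T1 T1, DB T2, DB T1, DA T2 T2, DA T2 T0, DA T2 T1],
     [DA T0 T1, DA T1 T2, DA T0 T2, DA T1 T1, DB T2, DB T1, DA T2 T0, DA T2 T2, DA T2 T1],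
     [DA T1 T2, DA T1 T1, DB T1, DB T2, DA T2 T2, DA T2 T1, DA T2 T0, DA T0 T1, DA T0 T2],
     [DA T1 T1, DB T2, DB T1, DA T1 T2, DA T0 T1, DA T2 T0, DA T0 T2, DA T2 T2, DA T2 T1],
     [DA T1 T1, DB T2, DB T1, DA T1 T2, DA T2 T1, DA T0 T1, DA T0 T2, DA T2 T2, DA T2 T0],
     [DB T1, DA T1 T2, DB T2, DA T1 T1, DA T0 T1, DA T2 T1, DA T2 T2, DA T0 T2, DA T2 T0],
     [DA T1 T2, DA T1 T1, DA T0 T2, DA T0 T1, DB T2, DA T2 T2, DA T2 T0, DA T2 T1, DB T1],
     [DA T1 T2, DA T1 T1, DA T0 T2, DA T0 T1, DA T2 T2, DA T2 T1, DA T2 T0, DB T1, DB T2],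
     [DA T0 T2, DA T1 T1, DA T0 T1, DA T1 T2, DB T1, DA T2 T1, DB T2, DA T2 T2, DA T2 T0],
     [DA T1 T1, DA T0 T2, DA T0 T1, DA T1 T2, DB T2, DA T2 T1, DA T2 T2, DB T1, DA T2 T0],
     [DA T0 T2, DA T1 T1, DA T0 T1, DA T1 T2, DB T2, DA T2 T1, DB T1, DA T2 T0, DA T2 T2],
     [DB T2, DA T1 T1, DB T1, DA T1 T2, DA T0 T1, DA T0 T2, DA T2 T0, DA T2 T1, DA T2 T2],
     [DA T1 T2, DB T1, DB T2, DA T1 T1, DA T0 T1, DA T2 T1, DA T0 T2, DA T2 T2, DA T2 T0],
     [DA T1 T1, DA T1 T2, DB T1, DB T2, DA T0 T1, DA T2 T2, DA T2 T0, DA T2 T1, DA T0 T2]]),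
     ((None, T2, T1),
     [[DB T1, DA T1 T2, DB T2, DA T1 T1, DA T0 T1, DA T0 T2, DA T2 T1, DA T2 T0, DA T2 T2],
     [DA T1 T1, DB T2, DB T1, DA T1 T2, DA T0 T1, DA T2 T1, DA T2 T0, DA T0 T2, DA T2 T2],
     [DA T1 T2, DB T1, DB T2, DA T1 T1, DA T0 T2, DA T2 T0, DA T0 T1, DA T2 T2, DA T2 T1],
     [DA T1 T2, DA T1 T1, DB T2, DB T1, DA T2 T1, DA T2 T0, DA T2 T2, DA T0 T1, DA T0 T2],
     [DA T1 T1, DA T0 T2, DA T0 T1, DA T1 T2, DA T2 T2, DB T1, DB T2, DA T2 T1, DA T2 T0],
     [DA T1 T2, DB T1, DB T2, DA T1 T1, DA T2 T2, DA T0 T2, DA T0 T1, DA T2 T1, DA T2 T0],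
     [DA T0 T2, DA T1 T1, DA T0 T1, DA T1 T2, DB T1, DB T2, DA T2 T2, DA T2 T0, DA T2 T1],
     [DA T0 T2, DA T1 T1, DA T0 T1, DA T1 T2, DB T1, DB T2, DA T2 T1, DA T2 T0, DA T2 T2],
     [DA T0 T2, DA T1 T1, DA T0 T1, DA T1 T2, DB T1, DA T2 T0, DB T2, DA T2 T1, DA T2 T2],
     [DB T2, DA T1 T1, DB T1, DA T1 T2, DA T0 T2, DA T2 T2, DA T2 T1, DA T0 T1, DA T2 T0],
     [DA T1 T1, DA T1 T2, DA T0 T1, DA T0 T2, DA T2 T1, DA T2 T0, DA T2 T2, DB T1, DB T2],
     [DA T1 T1, DA T1 T2, DA T0 T1, DA T0 T2, DB T1, DA T2 T1, DA T2 T0, DA T2 T2, DB T2],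
     [DA T1 T2, DA T0 T1, DA T0 T2, DA T1 T1, DB T1, DA T2 T0, DB T2, DA T2 T2, DA T2 T1],
     [DA T1 T2, DA T0 T1, DA T0 T2, DA T1 T1, DB T2, DA T2 T2, DB T1, DA T2 T0, DA T2 T1],
     [DB T1, DA T1 T2, DB T2, DA T1 T1, DA T0 T2, DA T0 T1, DA T2 T1, DA T2 T0, DA T2 T2],
     [DA T0 T1, DA T1 T2, DA T0 T2, DA T1 T1, DB T1, DA T2 T2, DB T2, DA T2 T0, DA T2 T1],
     [DA T1 T2, DA T1 T1, DB T1, DB T2, DA T0 T2, DA T2 T1, DA T2 T0, DA T2 T2, DA T0 T1],
     [DB T2, DA T1 T1, DB T1, DA T1 T2, DA T0 T2, DA T2 T2, DA T0 T1, DA T2 T1, DA T2 T0]]),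
     ((Some (T0, T1), T0, T1),
     [[DA T0 T1, DA T1 T1, DA T0 T2, DB T1, DB T2, DA T2 T1, DA T1 T2, DA T2 T0, DA T2 T2],
     [DB T1, DA T1 T1, DB T2, DA T0 T1, DA T0 T2, DA T2 T2, DA T1 T2, DA T2 T1, DA T2 T0]]),
     ((Some (T0, T1), T1, T1),
     [[DA T0 T1, DB T2, DB T1, DA T0 T2, DA T1 T1, DA T2 T1, DA T1 T2, DA T2 T0, DA T2 T2]]),
     ((Some (T0, T1), T2, T1),
     [[DB T1, DA T0 T2, DA T0 T1, DB T2, DA T1 T1, DA T2 T2, DA T1 T2, DA T2 T0, DA T2 T1]]),
     ((Some (T1, T1), T0, T1),
     [[DB T2, DB T1, DA T2 T1, DA T0 T2, DA T1 T1, DA T2 T0, DA T1 T2, DA T2 T2, DA T0 T1]]),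
     ((Some (T1, T1), T2, T1),
     [[DB T2, DA T2 T2, DA T2 T1, DB T1, DA T1 T1, DA T1 T2, DA T0 T1, DA T0 T2, DA T2 T0]]),
     ((Some (T2, T1), T0, T1),
     [[DA T0 T1, DA T2 T1, DA T1 T1, DB T1, DA T1 T2, DA T2 T0, DA T2 T2, DA T0 T2, DB T2],
     [DB T2, DA T1 T1, DA T2 T1, DA T1 T2, DA T0 T2, DB T1, DA T2 T0, DA T2 T2, DA T0 T1]]),
     ((Some (T0, T2), T0, T1),
     [[DA T2 T2, DA T1 T2, DA T2 T1, DA T1 T1, DA T0 T1, DA T2 T0, DB T2, DB T1, DA T0 T2],
     [DA T2 T2, DA T2 T1, DA T1 T1, DA T1 T2, DB T2, DB T1, DA T0 T1, DA T2 T0, DA T0 T2]]),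
     ((Some (T0, T2), T1, T1),
     [[DA T1 T1, DA T1 T2, DA T2 T2, DB T1, DB T2, DA T2 T0, DA T0 T1, DA T0 T2, DA T2 T1],
     [DA T1 T2, DA T1 T1, DA T2 T2, DA T0 T2, DA T0 T1, DA T2 T0, DB T2, DB T1, DA T2 T1]]),
     ((Some (T1, T2), T0, T1),
     [[DA T2 T2, DA T1 T1, DB T2, DA T2 T1, DA T2 T0, DB T1, DA T0 T2, DA T1 T2, DA T0 T1]]),
     ((Some (T1, T2), T1, T1),
     [[DB T2, DA T2 T0, DA T1 T1, DB T1, DA T1 T2, DA T2 T1, DA T2 T2, DA T0 T2, DA T0 T1]]),
     ((Some (T2, T2), T1, T1),
     [[DA T1 T1, DB T2, DA T2 T1, DA T0 T1, DA T2 T2, DA T2 T0, DA T1 T2, DA T0 T2, DB T1],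
     [DB T2, DA T1 T2, DA T2 T2, DA T0 T2, DA T0 T1, DA T2 T1, DA T1 T1, DA T2 T0, DB T1]])] r of None \<Rightarrow> [] | Some dss \<Rightarrow> dss)"

text \<open>
  A case is given by the points on exactly one line, as for \<open>parities\<close>, and by the line \<open>(u, v)\<close> in
  direction \<open>(1, 1, 0)\<close>. The lines in directions \<open>(1, 0, 0)\<close> and \<open>(0, 1, 0)\<close> pass through the origin.
\<close>

definition check :: "(trit \<times> trit) option \<Rightarrow> trit \<Rightarrow> trit \<Rightarrow> bool" where
  "check q u v = check_root q u v search_order (orders (q, u, v))"

text \<open>As \<open>orders\<close> stores nothing for \<open>v = T0\<close>, the cases with
  \<open>v = T0\<close> assert that the first search has no results at all.\<close>

lemma check_none_00: "check None T0 T0"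
  by code_simp

lemma check_none_01: "check None T0 T1"
  by code_simp

lemma check_none_10: "check None T1 T0"
  by code_simp

lemma check_none_11: "check None T1 T1"
  by code_simp

lemma check_none_20: "check None T2 T0"
  by code_simp

lemma check_none_21: "check None T2 T1"
  by code_simp

lemma check_some_00:
  "check (Some (T0, T0)) T0 T0" "check (Some (T0, T0)) T0 T1"
  "check (Some (T0, T0)) T1 T0" "check (Some (T0, T0)) T1 T1"
  "check (Some (T0, T0)) T2 T0" "check (Some (T0, T0)) T2 T1"
  by code_simp+

lemma check_some_01:
  "check (Some (T0, T1)) T0 T0" "check (Some (T0, T1)) T0 T1"
  "check (Some (T0, T1)) T1 T0" "check (Some (T0, T1)) T1 T1"
  "check (Some (T0, T1)) T2 T0" "check (Some (T0, T1)) T2 T1"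
  by code_simp+

lemma check_some_02:
  "check (Some (T0, T2)) T0 T0" "check (Some (T0, T2)) T0 T1"
  "check (Some (T0, T2)) T1 T0" "check (Some (T0, T2)) T1 T1"
  "check (Some (T0, T2)) T2 T0" "check (Some (T0, T2)) T2 T1"
  by code_simp+

lemma check_some_10:
  "check (Some (T1, T0)) T0 T0" "check (Some (T1, T0)) T0 T1"
  "check (Some (T1, T0)) T1 T0" "check (Some (T1, T0)) T1 T1"
  "check (Some (T1, T0)) T2 T0" "check (Some (T1, T0)) T2 T1"
  by code_simp+

lemma check_some_11:
  "check (Some (T1, T1)) T0 T0" "check (Some (T1, T1)) T0 T1"
  "check (Some (T1, T1)) T1 T0" "check (Some (T1, T1)) T1 T1"
  "check (Some (T1, T1)) T2 T0" "check (Some (T1, T1)) T2 T1"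
  by code_simp+

lemma check_some_12:
  "check (Some (T1, T2)) T0 T0" "check (Some (T1, T2)) T0 T1"
  "check (Some (T1, T2)) T1 T0" "check (Some (T1, T2)) T1 T1"
  "check (Some (T1, T2)) T2 T0" "check (Some (T1, T2)) T2 T1"
  by code_simp+

lemma check_some_20:
  "check (Some (T2, T0)) T0 T0" "check (Some (T2, T0)) T0 T1"
  "check (Some (T2, T0)) T1 T0" "check (Some (T2, T0)) T1 T1"
  "check (Some (T2, T0)) T2 T0" "check (Some (T2, T0)) T2 T1"
  by code_simp+

lemma check_some_21:
  "check (Some (T2, T1)) T0 T0" "check (Some (T2, T1)) T0 T1"
  "check (Some (T2, T1)) T1 T0" "check (Some (T2, T1)) T1 T1"
  "check (Some (T2, T1)) T2 T0" "check (Some (T2, T1)) T2 T1"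
  by code_simp+

lemma check_some_22:
  "check (Some (T2, T2)) T0 T0" "check (Some (T2, T2)) T0 T1"
  "check (Some (T2, T2)) T1 T0" "check (Some (T2, T2)) T1 T1"
  "check (Some (T2, T2)) T2 T0" "check (Some (T2, T2)) T2 T1"
  by code_simp+

text \<open>\<open>v = T2\<close> is not evaluated, since replacing \<open>h5\<close> by
  \<open>- h5\<close> turns it into \<open>v = T1\<close>; see \<open>impossible\<close>.\<close>

lemma checks: "check q u v \<or> v = T2"
proof -
  note instances = check_none_00 check_none_01 check_none_10 check_none_11 check_none_20 check_none_21
    check_some_00 check_some_01 check_some_02 check_some_10 check_some_11 check_some_12
    check_some_20 check_some_21 check_some_22
  show ?thesis
  proof (cases q)
    case None
    then show ?thesis by (cases u; cases v) (simp_all only: instances simp_thms)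
  next
    case (Some p)
    obtain x y where "p = (x, y)" by (cases p)
    then show ?thesis unfolding Some
      by (cases x; cases y; cases u; cases v) (simp_all only: instances simp_thms)
  qed
qed

section \<open>Correctness of the search\<close>

lemma tmul_right [simp]: "tmul m T0 = T0" "tmul m T1 = m" "tmul m T2 = tneg m"
  by (cases m; simp)+

lemma tadd_T0_right [simp]: "tadd u T0 = u"
  by (cases u) simp_all

lemma bump1_Some: "bump1 z r = Some r' \<Longrightarrow> weight (sel q r') = weight (sel q r) + of_bool (q = z)"
  by (cases "(z, r)" rule: bump1.cases; cases q) auto

lemma bump1_None: "bump1 z r = None \<Longrightarrow> sel z r = L2"
  by (cases "(z, r)" rule: bump1.cases) auto

lemma subst_eq_Some: "subst i x t = Some t' \<longleftrightarrow> (\<exists>a. x = Some a \<and> (\<forall>j. sel j t' = (if j = i then a else sel j t)))"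
  (is "_ \<longleftrightarrow> ?R")
proof -
  obtain a b c a' b' c' where t: "t = Tri a b c" "t' = Tri a' b' c'"
    by (metis tri.exhaust)
  have all: "(\<forall>j. Q j) \<longleftrightarrow> Q T0 \<and> Q T1 \<and> Q T2" for Q
    by (metis trit.exhaust)
  show ?thesis
    unfolding t all by (cases i; cases x) auto
qed

lemma subst_eq_None: "subst i x t = None \<longleftrightarrow> x = None"
  by (cases t; cases i; cases x) auto

lemma bump2_eq: "bump2 y z t = subst y (bump1 z (sel y t)) t"
  by (cases t; cases y) auto

lemma bump2_Some:
  "bump2 y z t = Some t' \<Longrightarrow> weight (sel z' (sel y' t')) = weight (sel z' (sel y' t)) + of_bool (y' = y \<and> z' = z)"
  using bump1_Some[of z "sel y t" _ z'] by (auto simp: bump2_eq subst_eq_Some)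

lemma bump2_None: "bump2 y z t = None \<Longrightarrow> sel z (sel y t) = L2"
  by (simp add: bump2_eq subst_eq_None bump1_None)

lemma bump_rows_Some:
  assumes "bump_rows n v t = Some t'"
  shows "weight (sel z (sel y t')) = weight (sel z (sel y t)) + of_bool (z = tadd v (tmul n y))"
proof -
  obtain a b c where t: "t = Tri a b c" by (cases t)
  obtain a' b' c' where "bump1 v a = Some a'" "bump1 (tadd v n) b = Some b'"
    "bump1 (tadd v (tneg n)) c = Some c'" "t' = Tri a' b' c'"
    using assms unfolding t
    by (cases "bump1 v a"; cases "bump1 (tadd v n) b"; cases "bump1 (tadd v (tneg n)) c") auto
  note b = this
  show ?thesis
    using bump1_Some[OF b(1), of z] bump1_Some[OF b(2), of z] bump1_Some[OF b(3), of z]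
    unfolding t b(4) by (cases y) auto
qed

lemma bump_rows_None:
  assumes "bump_rows n v t = None"
  shows "\<exists>y. sel (tadd v (tmul n y)) (sel y t) = L2"
proof -
  obtain a b c where t: "t = Tri a b c" by (cases t)
  have "bump1 v a = None \<or> bump1 (tadd v n) b = None \<or> bump1 (tadd v (tneg n)) c = None"
    using assms unfolding t
    by (cases "bump1 v a"; cases "bump1 (tadd v n) b"; cases "bump1 (tadd v (tneg n)) c") auto
  then have "sel v a = L2 \<or> sel (tadd v n) b = L2 \<or> sel (tadd v (tneg n)) c = L2"
    by (auto dest: bump1_None)
  then show ?thesis
    unfolding t by (metis sel.simps tmul_right tadd_T0_right)
qed

lemma add_line_DB: "add_line (DB n) u v G = subst u (bump_rows n v (sel u G)) G"
  by (cases G; cases u) auto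

lemma add_line_Some:
  assumes "add_line d u v G = Some G'"
  shows "weight (load_at G' p) = weight (load_at G p) + of_bool (on_line d (u, v) p)"
proof -
  obtain x y z where p: "p = (x, y, z)" by (cases p)
  show ?thesis
  proof (cases d)
    case (DB n)
    then show ?thesis
      using assms bump_rows_Some[of n v "sel u G" _ z y] unfolding p
      by (auto simp: add_line_DB subst_eq_Some)
  next
    case (DA m n)
    obtain a b c where G: "G = Tri a b c" by (cases G)
    obtain a' b' c' where "bump2 u v a = Some a'" "bump2 (tadd u m) (tadd v n) b = Some b'"
      "bump2 (tadd u (tneg m)) (tadd v (tneg n)) c = Some c'" "G' = Tri a' b' c'"
      using assms unfolding G DA
      by (cases "bump2 u v a"; cases "bump2 (tadd u m) (tadd v n) b";
          cases "bump2 (tadd u (tneg m)) (tadd v (tneg n)) c") auto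
    note b = this
    show ?thesis
      using bump2_Some[OF b(1), of z y] bump2_Some[OF b(2), of z y] bump2_Some[OF b(3), of z y]
      unfolding G b(4) DA p by (cases x) auto
  qed
qed

lemma add_line_None:
  assumes "add_line d u v G = None"
  shows "\<exists>p. on_line d (u, v) p \<and> load_at G p = L2"
proof (cases d)
  case (DB n)
  then have "bump_rows n v (sel u G) = None"
    using assms by (simp add: add_line_DB subst_eq_None)
  then obtain y where "sel (tadd v (tmul n y)) (sel y (sel u G)) = L2"
    using bump_rows_None by blast
  then have "on_line d (u, v) (u, y, tadd v (tmul n y)) \<and> load_at G (u, y, tadd v (tmul n y)) = L2"
    by (simp add: DB)
  then show ?thesis by blast
next
  case (DA m n)
  obtain a b c where G: "G = Tri a b c" by (cases G)
  have "bump2 u v a = None \<or> bump2 (tadd u m) (tadd v n) b = None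
      \<or> bump2 (tadd u (tneg m)) (tadd v (tneg n)) c = None"
    using assms unfolding G DA
    by (cases "bump2 u v a"; cases "bump2 (tadd u m) (tadd v n) b";
        cases "bump2 (tadd u (tneg m)) (tadd v (tneg n)) c") auto
  then have "load_at G (T0, u, v) = L2 \<or> load_at G (T1, tadd u m, tadd v n) = L2
      \<or> load_at G (T2, tadd u (tneg m), tadd v (tneg n)) = L2"
    by (auto simp: G dest: bump2_None)
  moreover have "on_line d (u, v) (T0, u, v)" "on_line d (u, v) (T1, tadd u m, tadd v n)"
    "on_line d (u, v) (T2, tadd u (tneg m), tadd v (tneg n))"
    by (simp_all add: DA)
  ultimately show ?thesis by blast
qed

text \<open>The points are listed in the order in which \<open>pay_line\<close> visits them.\<close>

fun line_points :: "dir \<Rightarrow> trit \<times> trit \<Rightarrow> point list" where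
  "line_points (DA m n) (u, v) = [(T0, u, v), (T1, tadd u m, tadd v n), (T2, tadd u (tneg m), tadd v (tneg n))]"
| "line_points (DB n) (u, v) = [(u, T0, v), (u, T1, tadd v n), (u, T2, tadd v (tneg n))]"

lemma set_line_points: "set (line_points d l) = {p. on_line d l p}"
proof -
  obtain u v where l: "l = (u, v)" by (cases l)
  have "p \<in> set (line_points d l) \<longleftrightarrow> on_line d l p" for p
  proof (cases p)
    case (fields x y z)
    then show ?thesis
      by (cases d; cases x; cases y) (auto simp: l)
  qed
  then show ?thesis by blast
qed

lemma distinct_line_points: "distinct (line_points d l)"
  by (cases "(d, l)" rule: line_points.cases) auto

lemma card_line: "card {p. on_line d l p} = 3"
proof -
  have "length (line_points d l) = 3"
    by (cases "(d, l)" rule: line_points.cases) auto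
  then show ?thesis
    by (metis set_line_points distinct_line_points distinct_card)
qed

fun pay_points :: "grid \<Rightarrow> point list \<Rightarrow> nat \<Rightarrow> nat option" where
  "pay_points G [] k = Some k"
| "pay_points G (p # ps) k = (case pay (load_at G p) k of None \<Rightarrow> None | Some k \<Rightarrow> pay_points G ps k)"

lemma pay_line_eq: "pay_line d u v G k = pay_points G (line_points d (u, v)) k"
proof (cases d)
  case (DA m n)
  obtain a b c where "G = Tri a b c" by (cases G)
  then show ?thesis by (auto simp: DA split: option.splits)
next
  case (DB n)
  obtain a b c where "sel u G = Tri a b c" by (cases "sel u G")
  then show ?thesis by (auto simp: DB split: option.splits)
qed

lemma pay_points:
  assumes "distinct ps"
  shows "case pay_points G ps k of None \<Rightarrow> k < card {p \<in> set ps. load_at G p = L0}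
    | Some k' \<Rightarrow> k = k' + card {p \<in> set ps. load_at G p = L0}"
  using assms
proof (induction ps arbitrary: k)
  case (Cons p ps)
  have "{q \<in> set (p # ps). load_at G q = L0} =
      (if load_at G p = L0 then insert p {q \<in> set ps. load_at G q = L0} else {q \<in> set ps. load_at G q = L0})"
    by auto
  then have "card {q \<in> set (p # ps). load_at G q = L0} =
      of_bool (load_at G p = L0) + card {q \<in> set ps. load_at G q = L0}"
    using Cons.prems by auto
  then show ?case
    using Cons.IH[of k] Cons.IH[of "k - 1"] Cons.prems
    by (cases "load_at G p"; cases k) (auto split: option.splits)
qed simp

lemma pay_line:
  "case pay_line d u v G k of None \<Rightarrow> k < card {p. on_line d (u, v) p \<and> load_at G p = L0}
    | Some k' \<Rightarrow> k = k' + card {p. on_line d (u, v) p \<and> load_at G p = L0}"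
  using pay_points[OF distinct_line_points[of d "(u, v)"], where G = G and k = k]
  by (simp only: pay_line_eq set_line_points mem_Collect_eq)

section \<open>A genuine configuration passes every test of the first search\<close>

definition cover :: "(dir \<Rightarrow> trit \<times> trit) \<Rightarrow> dir set \<Rightarrow> point \<Rightarrow> nat" where
  "cover f S p = card {d \<in> S. on_line d (f d) p}"

text \<open>\<open>e\<close> counts the prepaid marks: \<open>mark q\<close> in the first search,
  zero in the second.\<close>

definition represents :: "(point \<Rightarrow> nat) \<Rightarrow> (dir \<Rightarrow> trit \<times> trit) \<Rightarrow> dir set \<Rightarrow> grid \<Rightarrow> bool" where
  "represents e f S G \<longleftrightarrow> (\<forall>p. weight (load_at G p) = e p + cover f S p)"

lemma cover_insert: "d \<notin> S \<Longrightarrow> cover f (insert d S) p = cover f S p + of_bool (on_line d (f d) p)"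
proof -
  assume "d \<notin> S"
  moreover have "{d' \<in> insert d S. on_line d' (f d') p} =
      (if on_line d (f d) p then insert d {d' \<in> S. on_line d' (f d') p} else {d' \<in> S. on_line d' (f d') p})"
    by auto
  ultimately show ?thesis by (simp add: cover_def)
qed

lemma cover_mono: "S \<subseteq> T \<Longrightarrow> cover f S p \<le> cover f T p"
  unfolding cover_def by (intro card_mono) auto

lemma weight_eq_0: "weight l = 0 \<longleftrightarrow> l = L0"
  by (cases l) auto

text \<open>A failure exhibits a point of load 2 on the new line. Its total would be 3 already for
  the lines in \<open>insert d S\<close>, although all lines together give at most 2.\<close>

lemma add_line_valid:
  assumes valid: "\<And>p. e p + cover f UNIV p \<le> 2" and rep: "represents e f S G" and d: "d \<notin> S"
  obtains G' where "add_line d (fst (f d)) (snd (f d)) G = Some G'" "represents e f (insert d S) G'"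
proof (cases "add_line d (fst (f d)) (snd (f d)) G")
  case None
  then obtain p where p: "on_line d (f d) p" "load_at G p = L2"
    using add_line_None by (metis prod.collapse)
  have "weight (load_at G p) = e p + cover f S p"
    using rep unfolding represents_def by blast
  then have "e p + cover f (insert d S) p = 3"
    using p d by (simp add: cover_insert)
  moreover have "cover f (insert d S) p \<le> cover f UNIV p"
    by (rule cover_mono) simp
  ultimately show thesis using valid[of p] by simp
next
  case (Some G')
  have "represents e f (insert d S) G'"
    using rep add_line_Some[OF Some] d by (simp add: represents_def cover_insert)
  then show thesis using that Some by blast
qed

lemma represents_load: "represents e f S G \<Longrightarrow> load_at G p = L0 \<longleftrightarrow> e p + cover f S p = 0"
  by (metis represents_def weight_eq_0)

text \<open>The invariant says that the remaining budget suffices for all points still to be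
  covered. A line newly covers exactly its points of load \<open>L0\<close>, and for these
  \<open>pay_line\<close> charges one each.\<close>

lemma pay_valid:
  assumes rep: "represents e f S G" and d: "d \<notin> S"
    and budget: "card {p. e p + cover f UNIV p \<noteq> 0} \<le> k + card {p. e p + cover f S p \<noteq> 0}"
  obtains k' where "pay_line d (fst (f d)) (snd (f d)) G k = Some k'"
    "card {p. e p + cover f UNIV p \<noteq> 0} \<le> k' + card {p. e p + cover f (insert d S) p \<noteq> 0}"
proof -
  let ?N = "{p. on_line d (f d) p \<and> load_at G p = L0}"
  have fin: "finite (A :: point set)" for A
    by (rule finite)
  have eq: "{p. e p + cover f (insert d S) p \<noteq> 0} = {p. e p + cover f S p \<noteq> 0} \<union> ?N"
  proof (rule set_eqI)
    fix p
    show "p \<in> {p. e p + cover f (insert d S) p \<noteq> 0} \<longleftrightarrow> p \<in> {p. e p + cover f S p \<noteq> 0} \<union> ?N"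
      using d by (auto simp: cover_insert represents_load[OF rep])
  qed
  have "p \<in> ?N \<Longrightarrow> p \<notin> {p. e p + cover f S p \<noteq> 0}" for p
    by (simp add: represents_load[OF rep])
  then have "{p. e p + cover f S p \<noteq> 0} \<inter> ?N = {}"
    by (meson disjoint_iff)
  then have card: "card {p. e p + cover f (insert d S) p \<noteq> 0} = card {p. e p + cover f S p \<noteq> 0} + card ?N"
    unfolding eq by (intro card_Un_disjoint fin)
  have "{p. e p + cover f (insert d S) p \<noteq> 0} \<subseteq> {p. e p + cover f UNIV p \<noteq> 0}"
  proof (rule subsetI)
    fix p
    assume "p \<in> {p. e p + cover f (insert d S) p \<noteq> 0}"
    then show "p \<in> {p. e p + cover f UNIV p \<noteq> 0}"
      using cover_mono[OF subset_UNIV, of f "insert d S" p] unfolding mem_Collect_eq by linarith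
  qed
  then have le: "card {p. e p + cover f (insert d S) p \<noteq> 0} \<le> card {p. e p + cover f UNIV p \<noteq> 0}"
    by (intro card_mono fin)
  show thesis
  proof (cases "pay_line d (fst (f d)) (snd (f d)) G k")
    case None
    have "k < card ?N"
      using pay_line[where d = d and u = "fst (f d)" and v = "snd (f d)" and G = G and k = k] by (simp only: None option.case prod.collapse)
    then show thesis using le card budget by linarith
  next
    case (Some k')
    have "k = k' + card ?N"
      using pay_line[where d = d and u = "fst (f d)" and v = "snd (f d)" and G = G and k = k] by (simp only: Some option.case prod.collapse)
    then show thesis using card budget by (intro that[OF Some]) linarith
  qed
qed

lemma sel_toggle: "sel v (toggle u R) = (sel v R \<noteq> (v = u))"
  by (cases R; cases u; cases v) auto

lemma sel_fold_toggle: "sel v (fold toggle us R) = (sel v R \<noteq> odd (count_list us v))"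
  by (induction us arbitrary: R) (auto simp: sel_toggle)

lemma any3_iff: "any3 R \<longleftrightarrow> (\<exists>u. sel u R)"
proof
  show "any3 R \<Longrightarrow> \<exists>u. sel u R"
    by (cases R) (metis any3.simps sel.simps)
  show "\<exists>u. sel u R \<Longrightarrow> any3 R"
    by (cases R) (metis any3.simps sel.simps trit.exhaust)
qed

lemma all3_iff: "all3 R \<longleftrightarrow> (\<forall>u. sel u R)"
proof
  show "all3 R \<Longrightarrow> \<forall>u. sel u R"
    by (cases R) (metis all3.simps sel.simps trit.exhaust)
  show "\<forall>u. sel u R \<Longrightarrow> all3 R"
    by (cases R) (metis all3.simps sel.simps)
qed

lemma card_group: "card {d. group d = g} = 3"
proof -
  have "d \<in> {d. group d = g} \<longleftrightarrow> d \<in> (case g of None \<Rightarrow> DB | Some m \<Rightarrow> DA m) ` UNIV" for d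
    by (cases d; cases g) auto
  then have "{d. group d = g} = (case g of None \<Rightarrow> DB | Some m \<Rightarrow> DA m) ` UNIV"
    by blast
  moreover have "inj (case g of None \<Rightarrow> DB | Some m \<Rightarrow> DA m)"
    by (cases g) (auto simp: inj_def)
  ultimately show ?thesis
    by (simp add: card_image UNIV_trit)
qed

lemma count_list_map_distinct:
  "distinct xs \<Longrightarrow> count_list (map h xs) u = card {x \<in> set xs. h x = u}"
proof (induction xs)
  case (Cons x xs)
  have "{y \<in> set (x # xs). h y = u} =
      (if h x = u then insert x {y \<in> set xs. h y = u} else {y \<in> set xs. h y = u})"
    by auto
  then show ?case using Cons by auto
qed simp

text \<open>Once all three lines of the group have been toggled, every entry is false. If one of
  them is still to come, it will change a single entry, so some other entry must be false
  already.\<close>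

lemma fits_valid:
  assumes par: "\<And>u. sel u R \<longleftrightarrow> odd (card {d. group d = g \<and> fst (f d) = u})"
    and L: "distinct (d # L)" "\<And>x. x \<in> set (d # L) \<Longrightarrow> group x = g"
    and us: "us = map (\<lambda>d. fst (f d)) L"
  shows "fits us (fold toggle us R) (fst (f d))"
proof -
  have full: "\<not> sel u (fold toggle (map (\<lambda>d. fst (f d)) M) R)"
    if "set M = {d. group d = g}" "distinct M" for M u
    using that by (simp add: sel_fold_toggle par count_list_map_distinct)
  have sub: "set (d # L) \<subseteq> {d. group d = g}"
    using L by blast
  have len: "card (set (d # L)) = Suc (length L)"
    using L(1) by (metis distinct_card length_Cons)
  show ?thesis
  proof (cases "(us, R, fst (f d))" rule: fits.cases)
    case (1 a b)
    then have "length L = 2" using us by (metis length_map length_Cons list.size(3) numeral_2_eq_2 Pair_inject)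
    then have "set (d # L) = {d. group d = g}"
      using sub len card_group[of g] by (intro card_subset_eq) auto
    then have "\<not> sel u (fold toggle (us @ [fst (f d)]) R)" for u
      using full[of "L @ [d]" u] L(1) us by auto
    then show ?thesis using 1 by (simp add: any3_iff)
  next
    case (2 a)
    then have "length L = 1" using us by (metis length_map length_Cons list.size(3) One_nat_def Pair_inject)
    then have "card (set (d # L)) = 2" using len by simp
    then have "set (d # L) \<noteq> {d. group d = g}" using card_group[of g] by auto
    then obtain x where x: "group x = g" "x \<notin> set (d # L)"
      using sub by blast
    have "card (insert x (set (d # L))) = 3"
      using x \<open>card (set (d # L)) = 2\<close> by simp
    then have "insert x (set (d # L)) = {d. group d = g}"
      using sub x card_group[of g] by (intro card_subset_eq) auto
    then have "\<not> sel u (fold toggle (us @ [fst (f d), fst (f x)]) R)" for u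
      using full[of "L @ [d, x]" u] L(1) us x by auto
    then have "\<not> sel u (toggle (fst (f x)) (toggle (fst (f d)) (fold toggle us R)))" for u
      by simp
    then have "\<exists>u. \<not> sel u (toggle (fst (f d)) (fold toggle us R))"
      unfolding sel_toggle[of _ "fst (f x)"] by (metis trit.distinct(1))
    then show ?thesis using 2 by (simp add: all3_iff)
  qed auto
qed

lemma mates_eq:
  "(\<And>d l. (d, l) \<in> set s \<Longrightarrow> l = f d) \<Longrightarrow>
   mates g s = map (\<lambda>d. fst (f d)) (filter (\<lambda>d. group d = g) (map fst s))"
  by (induction g s rule: mates.induct) (auto, metis fst_conv)

definition pairs :: "(trit \<times> trit) list" where
  "pairs = [(T0, T0), (T0, T1), (T0, T2), (T1, T0), (T1, T1), (T1, T2), (T2, T0), (T2, T1), (T2, T2)]"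

text \<open>The uniform form of the nine written-out branches, from which the induction can pick the
  branch of \<open>f d\<close>.\<close>

lemma leaves_branch:
  "leaves q (d # ds) s (k, G) = concat (map (\<lambda>(u, v).
     case try_a (mates (group d) s) (fold toggle (mates (group d) s) (parities q (group d))) d u v k G of
       None \<Rightarrow> [] | Some kG' \<Rightarrow> leaves q ds ((d, u, v) # s) kG')
     pairs)"
  by (simp add: pairs_def Let_def del: try_a.simps)

lemma all_pairs: "uv \<in> set pairs"
  by (cases uv; cases "fst uv"; cases "snd uv") (auto simp: pairs_def)

text \<open>At each node the branch taken by \<open>f\<close> itself survives: its loads are at most
  2, its budget suffices and its parities are the prescribed ones.\<close>

lemma leaves_complete:
  assumes valid: "\<And>p. e p + cover f UNIV p \<le> 2"
    and par: "\<And>g u. sel u (parities q g) \<longleftrightarrow> odd (card {d. group d = g \<and> fst (f d) = u})"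
    and "represents e f (fst ` set s) G"
    and "\<And>d l. (d, l) \<in> set s \<Longrightarrow> l = f d"
    and "distinct (map fst s @ ds)"
    and "card {p. e p + cover f UNIV p \<noteq> 0} \<le> k + card {p. e p + cover f (fst ` set s) p \<noteq> 0}"
  shows "rev (map (\<lambda>d. (d, f d)) ds) @ s \<in> set (leaves q ds s (k, G))"
  using assms(3-)
proof (induction ds arbitrary: s k G)
  case Nil
  then show ?case by simp
next
  case (Cons d ds)
  let ?S = "fst ` set s"
  have d: "d \<notin> ?S" using Cons.prems(3) by auto
  obtain G' where G': "add_line d (fst (f d)) (snd (f d)) G = Some G'" "represents e f (insert d ?S) G'"
    using add_line_valid[OF valid Cons.prems(1) d] by blast
  obtain k' where k': "pay_line d (fst (f d)) (snd (f d)) G k = Some k'"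
    "card {p. e p + cover f UNIV p \<noteq> 0} \<le> k' + card {p. e p + cover f (insert d ?S) p \<noteq> 0}"
    using pay_valid[OF Cons.prems(1) d Cons.prems(4)] by blast
  have "mates (group d) s = map (\<lambda>d. fst (f d)) (filter (\<lambda>x. group x = group d) (map fst s))"
    using Cons.prems(2) by (rule mates_eq)
  then have "fits (mates (group d) s) (fold toggle (mates (group d) s) (parities q (group d))) (fst (f d))"
    by (intro fits_valid[where g = "group d" and L = "filter (\<lambda>x. group x = group d) (map fst s)"])
      (use Cons.prems(3) par in auto)
  then have "try_a (mates (group d) s) (fold toggle (mates (group d) s) (parities q (group d)))
      d (fst (f d)) (snd (f d)) k G = Some (k', G')"
    using G' k' by simp
  moreover have "rev (map (\<lambda>d. (d, f d)) ds) @ (d, f d) # s \<in> set (leaves q ds ((d, f d) # s) (k', G'))"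
    using Cons.prems G'(2) k'(2) by (intro Cons.IH) auto
  moreover define F where "F = (\<lambda>(u, v).
     case try_a (mates (group d) s) (fold toggle (mates (group d) s) (parities q (group d))) d u v k G of
       None \<Rightarrow> [] | Some kG' \<Rightarrow> leaves q ds ((d, u, v) # s) kG')"
  ultimately have "rev (map (\<lambda>d. (d, f d)) (d # ds)) @ s \<in> set (F (f d))"
    by (cases "f d") (simp del: try_a.simps)
  then show ?case
    using all_pairs[of "f d"] unfolding leaves_branch F_def[symmetric] by auto
qed

section \<open>Soundness of the refutation by a second coset\<close>

lemma dead_branch:
  "dead ((d, a, a') # s) S \<longleftrightarrow> (\<forall>(u, v) \<in> set
     pairs.
     case try_b d a a' u v S of None \<Rightarrow> True | Some S' \<Rightarrow> dead s S')"
  by (simp add: pairs_def Let_def del: try_b.simps)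

text \<open>The labels for \<open>g' + g\<close> and \<open>g' - g\<close>, with \<open>h\<close>
  the identity or \<open>tneg\<close>: if \<open>g + p\<close> and \<open>g' + p'\<close> lie in a
  subspace, then so do their sum and difference.\<close>

definition shift :: "(trit \<Rightarrow> trit) \<Rightarrow> (dir \<Rightarrow> trit \<times> trit) \<Rightarrow> (dir \<Rightarrow> trit \<times> trit) \<Rightarrow> dir \<Rightarrow> trit \<times> trit" where
  "shift h a b d = (tadd (fst (b d)) (h (fst (a d))), tadd (snd (b d)) (h (snd (a d))))"

fun represents3 :: "(dir \<Rightarrow> trit \<times> trit) \<Rightarrow> (dir \<Rightarrow> trit \<times> trit) \<Rightarrow> dir set \<Rightarrow> grid \<times> grid \<times> grid \<Rightarrow> bool" where
  "represents3 a b S (G, H, K) \<longleftrightarrow> represents (\<lambda>_. 0) b S G \<and>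
     represents (\<lambda>_. 0) (shift (\<lambda>x. x) a b) S H \<and> represents (\<lambda>_. 0) (shift tneg a b) S K"

context
  fixes a b :: "dir \<Rightarrow> trit \<times> trit"
  assumes b: "\<And>p. cover b UNIV p \<le> 2"
    and sum: "\<And>p. cover (shift (\<lambda>x. x) a b) UNIV p \<le> 2"
    and diff: "\<And>p. cover (shift tneg a b) UNIV p \<le> 2"
begin

lemma try_b_valid:
  assumes "represents3 a b S GHK" "d \<notin> S"
  obtains GHK' where "try_b d (fst (a d)) (snd (a d)) (fst (b d)) (snd (b d)) GHK = Some GHK'"
    "represents3 a b (insert d S) GHK'"
proof -
  obtain G H K where GHK: "GHK = (G, H, K)" by (cases GHK)
  have r: "represents (\<lambda>_. 0) b S G" "represents (\<lambda>_. 0) (shift (\<lambda>x. x) a b) S H"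
    "represents (\<lambda>_. 0) (shift tneg a b) S K"
    using assms(1) by (auto simp: GHK)
  obtain G' where G': "add_line d (fst (b d)) (snd (b d)) G = Some G'" "represents (\<lambda>_. 0) b (insert d S) G'"
    using add_line_valid[OF _ r(1) assms(2)] b by auto
  obtain H' where H': "add_line d (fst (shift (\<lambda>x. x) a b d)) (snd (shift (\<lambda>x. x) a b d)) H = Some H'"
    "represents (\<lambda>_. 0) (shift (\<lambda>x. x) a b) (insert d S) H'"
    using add_line_valid[OF _ r(2) assms(2)] sum by auto
  obtain K' where K': "add_line d (fst (shift tneg a b d)) (snd (shift tneg a b d)) K = Some K'"
    "represents (\<lambda>_. 0) (shift tneg a b) (insert d S) K'"
    using add_line_valid[OF _ r(3) assms(2)] diff by auto
  show thesis
    using that[of "(G', H', K')"] G' H' K' by (simp add: GHK shift_def)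
qed

text \<open>The labels \<open>b\<close> of the second coset themselves describe a branch that never
  fails.\<close>

lemma not_dead:
  assumes "represents3 a b S GHK" "distinct (map fst s)" "fst ` set s \<inter> S = {}"
    "\<And>d l. (d, l) \<in> set s \<Longrightarrow> l = a d"
  shows "\<not> dead s GHK"
  using assms
proof (induction s arbitrary: S GHK)
  case Nil
  then show ?case by simp
next
  case (Cons x s)
  obtain d where x: "x = (d, fst (a d), snd (a d))"
    using Cons.prems(4) by (metis list.set_intros(1) prod.collapse)
  then have d: "d \<notin> S" using Cons.prems(3) by auto
  then obtain GHK' where *: "try_b d (fst (a d)) (snd (a d)) (fst (b d)) (snd (b d)) GHK = Some GHK'"
    "represents3 a b (insert d S) GHK'"
    using try_b_valid[OF Cons.prems(1) d] by blast
  have "\<not> dead s GHK'"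
  proof (rule Cons.IH[OF *(2)])
    show "distinct (map fst s)" "fst ` set s \<inter> insert d S = {}"
      using Cons.prems(2,3) x by auto
    show "l = a d'" if "(d', l) \<in> set s" for d' l
      using that Cons.prems(4) by (metis list.set_intros(2))
  qed
  moreover have "dead s GHK'" if "dead (x # s) GHK"
  proof -
    have "case b d of (u, v) \<Rightarrow>
        case try_b d (fst (a d)) (snd (a d)) u v GHK of None \<Rightarrow> True | Some S' \<Rightarrow> dead s S'"
      using that all_pairs[of "b d"] unfolding x dead_branch by (rule bspec)
    then show ?thesis
      unfolding case_prod_beta *(1) by simp
  qed
  ultimately show ?case by blast
qed

lemma represents3_empty: "represents3 a b {} (empty_grid, empty_grid, empty_grid)"
proof -
  have "weight (load_at empty_grid p) = 0" for p
    by (cases p; cases "fst p"; cases "fst (snd p)"; cases "snd (snd p)") (auto simp: empty_grid_def Let_def)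
  then show ?thesis by (simp add: represents_def cover_def)
qed

lemma not_dead_from:
  assumes a0: "a (DA T0 T0) = (T0, T0)" "a (DB T0) = (T0, T0)" "a (DA T1 T0) = (u, v)"
    and b0: "b (DA T0 T0) = (T0, T0)" "b (DB T0) = (T0, T1)" "b (DA T1 T0) = (w, T0)"
    and s: "distinct (DA T0 T0 # DB T0 # DA T1 T0 # map fst s)" "\<And>d l. (d, l) \<in> set s \<Longrightarrow> l = a d"
  shows "\<not> dead_from u v w s"
proof -
  obtain S1 where S1: "try_b (DA T0 T0) T0 T0 T0 T0 (empty_grid, empty_grid, empty_grid) = Some S1"
    "represents3 a b {DA T0 T0} S1"
    using try_b_valid[OF represents3_empty, of "DA T0 T0"] a0 b0 by auto
  obtain S2 where S2: "try_b (DB T0) T0 T0 T0 T1 S1 = Some S2" "represents3 a b {DB T0, DA T0 T0} S2"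
    using try_b_valid[OF S1(2), of "DB T0"] a0 b0 by auto
  obtain S3 where S3: "try_b (DA T1 T0) u v w T0 S2 = Some S3" "represents3 a b {DA T1 T0, DB T0, DA T0 T0} S3"
    using try_b_valid[OF S2(2), of "DA T1 T0"] a0 b0 by auto
  have "\<not> dead s S3"
    using s by (intro not_dead[OF S3(2)]) (auto simp del: dead.simps)
  then show ?thesis
    using S1(1) S2(1) S3(1) by (simp add: Let_def del: try_b.simps dead.simps)
qed

end

lemma arrange_sound: "(d, l) \<in> set (arrange s ds) \<Longrightarrow> (d, l) \<in> set s"
  by (induction ds) (auto split: option.splits dest: map_of_SomeD)

lemma fst_arrange: "map fst (arrange s ds) = filter (\<lambda>d. map_of s d \<noteq> None) ds"
  by (induction ds) (auto split: option.splits)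

section \<open>Incidence counts, parities of planes, and the initial state of the search\<close>

definition plane :: "trit option \<Rightarrow> trit \<Rightarrow> point set" where
  "plane g c = {(x, y, z). plane_class g (x, y) = c}"

text \<open>A line parallel to the plane is contained in it or disjoint from it; any other line
  meets it once. The quantifiers range over explicit lists so that \<open>code_simp\<close> can run
  through all cases.\<close>

lemma plane_meets_line_code:
  "\<forall>d \<in> set (map DB [T0, T1, T2] @ [DA m n. m \<leftarrow> [T0, T1, T2], n \<leftarrow> [T0, T1, T2]]).
   \<forall>g \<in> set [None, Some T0, Some T1, Some T2]. \<forall>c \<in> set [T0, T1, T2].
   \<forall>u \<in> set [T0, T1, T2]. \<forall>v \<in> set [T0, T1, T2].
     length (filter (\<lambda>(x, y, z). plane_class g (x, y) = c) (line_points d (u, v))) =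
       (if group d = g then if u = c then 3 else 0 else 1)"
  by code_simp

lemma card_plane_line:
  "card {p \<in> plane g c. on_line d l p} = (if group d = g then if fst l = c then 3 else 0 else 1)"
proof -
  obtain u v where l: "l = (u, v)" by (cases l)
  have tr: "x \<in> set [T0, T1, T2]" for x
    by (cases x) auto
  have g: "g \<in> set [None, Some T0, Some T1, Some T2]"
  proof (cases g)
    case (Some m)
    then show ?thesis by (cases m) auto
  qed simp
  have d: "d \<in> set (map DB [T0, T1, T2] @ [DA m n. m \<leftarrow> [T0, T1, T2], n \<leftarrow> [T0, T1, T2]])"
  proof (cases d)
    case (DA m n)
    then show ?thesis by (cases m; cases n) auto
  next
    case (DB n)
    then show ?thesis by (cases n) auto
  qed
  let ?Q = "\<lambda>(x, y, z). plane_class g (x, y) = c"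
  have "{p \<in> plane g c. on_line d l p} = set (filter ?Q (line_points d (u, v)))"
    unfolding set_filter set_line_points plane_def l by auto
  then have "card {p \<in> plane g c. on_line d l p} = length (filter ?Q (line_points d (u, v)))"
    by (simp only: distinct_card distinct_filter distinct_line_points)
  also have "\<dots> = (if group d = g then if u = c then 3 else 0 else 1)"
    using plane_meets_line_code g d tr[of c] tr[of u] tr[of v] by blast
  finally show ?thesis by (simp add: l)
qed

lemma sum_cover: "(\<Sum>p\<in>P. cover f UNIV p) = (\<Sum>d\<in>UNIV. card {p \<in> P. on_line d (f d) p})"
proof -
  have c: "cover f UNIV p = (\<Sum>d\<in>UNIV. of_bool (on_line d (f d) p))" for p
    by (simp only: cover_def sum_of_bool_eq finite of_nat_id) (simp add: Collect_conj_eq)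
  have "(\<Sum>d\<in>UNIV. card {p \<in> P. on_line d (f d) p}) = (\<Sum>d\<in>UNIV. \<Sum>p\<in>P. of_bool (on_line d (f d) p))"
    by (simp only: sum_of_bool_eq finite of_nat_id) (simp add: Collect_conj_eq)
  then show ?thesis
    unfolding c by (simp only: sum.swap[of _ UNIV P])
qed

lemma card_UNIV_dir: "card (UNIV :: dir set) = 12"
proof -
  have "card (case_prod DA ` (UNIV :: (trit \<times> trit) set)) = 9"
    by (subst card_image)
      (auto simp: inj_on_def UNIV_Times_UNIV[symmetric] card_cartesian_product UNIV_trit simp del: UNIV_Times_UNIV)
  moreover have "card (range DB) = 3"
    by (subst card_image) (auto simp: inj_on_def UNIV_trit)
  moreover have "case_prod DA ` UNIV \<inter> range DB = {}"
    by auto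
  ultimately show ?thesis
    unfolding UNIV_dir by (subst card_Un_disjoint) auto
qed

lemma sum_cover_plane:
  "(\<Sum>p\<in>plane g c. cover f UNIV p) = 3 * card {d. group d = g \<and> fst (f d) = c} + 9"
proof -
  have "(\<Sum>p\<in>plane g c. cover f UNIV p) =
      (\<Sum>d\<in>UNIV. 3 * of_bool (group d = g \<and> fst (f d) = c) + of_bool (group d \<noteq> g))"
    unfolding sum_cover card_plane_line by (intro sum.cong) auto
  also have "\<dots> = 3 * card {d. group d = g \<and> fst (f d) = c} + card {d. group d \<noteq> g}"
    by (simp add: sum.distrib sum_distrib_left[symmetric])
  also have "card {d. group d \<noteq> g} = 9"
  proof -
    have "card {d. group d \<noteq> g} = card (UNIV - {d. group d = g})"
      by (intro arg_cong[where f = card]) auto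
    then show ?thesis by (simp add: card_Diff_subset card_UNIV_dir card_group)
  qed
  finally show ?thesis .
qed

lemma sum_cover_UNIV: "(\<Sum>p\<in>UNIV. cover f UNIV p) = 36"
  unfolding sum_cover by (simp add: card_line card_UNIV_dir)

lemma sum_le_2:
  fixes h :: "'a \<Rightarrow> nat"
  assumes "finite P" "\<And>p. p \<in> P \<Longrightarrow> h p \<le> 2"
  shows "sum h P = 2 * card {p \<in> P. h p = 2} + card {p \<in> P. h p = 1}"
proof -
  have "sum h P = (\<Sum>p\<in>P. 2 * of_bool (h p = 2) + of_bool (h p = 1))"
  proof (rule sum.cong)
    fix p assume "p \<in> P"
    then have "h p = 0 \<or> h p = 1 \<or> h p = 2" using assms(2)[of p] by linarith
    then show "h p = 2 * of_bool (h p = 2) + of_bool (h p = 1)" by auto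
  qed simp
  also have "\<dots> = 2 * card {p \<in> P. h p = 2} + card {p \<in> P. h p = 1}"
    by (simp only: sum.distrib sum_distrib_left[symmetric] sum_of_bool_eq assms(1) of_nat_id Int_def mem_Collect_eq)
  finally show ?thesis .
qed

text \<open>Counting the incidences in the plane by lines and by points gives
  \<open>3 x + 9 = 2 y + z\<close>, with \<open>x\<close> lines of the group inside and
  \<open>y\<close>, \<open>z\<close> points on two and on one line. Now reduce modulo 2.\<close>

lemma odd_group_class:
  assumes "\<And>p. cover f UNIV p \<le> 2"
  shows "odd (card {d. group d = g \<and> fst (f d) = c}) \<longleftrightarrow> even (card {p \<in> plane g c. cover f UNIV p = 1})"
proof -
  have "3 * card {d. group d = g \<and> fst (f d) = c} + 9 =
      2 * card {p \<in> plane g c. cover f UNIV p = 2} + card {p \<in> plane g c. cover f UNIV p = 1}"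
    using sum_le_2[of "plane g c" "cover f UNIV"] assms by (simp add: sum_cover_plane)
  moreover have "odd x \<longleftrightarrow> even z" if "3 * x + 9 = 2 * y + z" for x y z :: nat
    using that by presburger
  ultimately show ?thesis by blast
qed

definition singles :: "(dir \<Rightarrow> trit \<times> trit) \<Rightarrow> point set" where
  "singles f = {p. cover f UNIV p = 1}"

definition mark :: "(trit \<times> trit) option \<Rightarrow> point \<Rightarrow> nat" where
  "mark q p = of_bool (q \<noteq> None \<and> p = (T1, T0, T0))"

text \<open>Only the first two coordinates of the second single are recorded, since planes parallel
  to \<open>(0, 0, 1)\<close> do not see the third. It may lie straight above
  \<open>(1, 0, 0)\<close>.\<close>

definition singles_type :: "(trit \<times> trit) option \<Rightarrow> (dir \<Rightarrow> trit \<times> trit) \<Rightarrow> bool" where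
  "singles_type q f \<longleftrightarrow> (case q of None \<Rightarrow> singles f = {}
     | Some (x, y) \<Rightarrow> (\<exists>z. (x, y, z) \<noteq> (T1, T0, T0) \<and> singles f = {(T1, T0, T0), (x, y, z)}))"

lemma parities_singles:
  assumes le: "\<And>p. cover f UNIV p \<le> 2" and q: "singles_type q f"
  shows "sel c (parities q g) \<longleftrightarrow> odd (card {d. group d = g \<and> fst (f d) = c})"
proof -
  have eq: "odd (card {d. group d = g \<and> fst (f d) = c}) \<longleftrightarrow> even (card (plane g c \<inter> singles f))"
    unfolding odd_group_class[of f g c, OF le] singles_def by (simp only: Int_def mem_Collect_eq)
  show ?thesis
  proof (cases q)
    case None
    then show ?thesis using q unfolding eq by (cases c) (simp_all add: singles_type_def)
  next
    case (Some xy)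
    obtain x y where xy: "xy = (x, y)" by (cases xy)
    obtain z where z: "(x, y, z) \<noteq> (T1, T0, T0)" "singles f = {(T1, T0, T0), (x, y, z)}"
      using q by (auto simp: singles_type_def Some xy)
    have mem: "(x, y, z) \<in> plane g c \<longleftrightarrow> plane_class g (x, y) = c" for x y z
      by (simp add: plane_def)
    have "card (plane g c \<inter> singles f) =
        of_bool (plane_class g (T1, T0) = c) + of_bool (plane_class g (x, y) = c)"
    proof -
      have if_card: "card (if A then insert p (if B then {p'} else {}) else if B then {p'} else {}) =
          of_bool A + of_bool B" if "p \<noteq> p'" for A B and p p' :: point
        using that by simp
      show ?thesis
        unfolding z(2) Int_insert_right mem Int_empty_right using z(1)[symmetric] by (rule if_card)
    qed
    then have "odd (card {d. group d = g \<and> fst (f d) = c}) \<longleftrightarrow>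
        (plane_class g (T1, T0) = c) = (plane_class g (x, y) = c)"
      unfolding eq by simp
    then show ?thesis unfolding Some xy by (cases c) (simp_all add: Let_def)
  qed
qed

text \<open>If \<open>d\<close> points are on two lines and \<open>s\<close> on one, then
  \<open>36 = 2 d + s\<close>, so \<open>d + s = 18 + s / 2\<close> with \<open>s\<close> equal to 0
  or 2. The mark sits on a single, so it covers no new point and keeps the total at most 2.\<close>

lemma card_covered:
  assumes le: "\<And>p. cover f UNIV p \<le> 2" and q: "singles_type q f"
  shows "card {p. mark q p + cover f UNIV p \<noteq> 0} = (if q = None then 18 else 19)"
    and "mark q p + cover f UNIV p \<le> 2"
proof -
  have s: "cover f UNIV p = 1" if "mark q p \<noteq> 0" for p
  proof -
    have "(T1, T0, T0) \<in> singles f" if "q \<noteq> None"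
      using q that by (auto simp: singles_type_def)
    then show ?thesis using that by (auto simp: mark_def singles_def split: if_splits)
  qed
  then show "mark q p + cover f UNIV p \<le> 2"
    using le[of p] by (cases "mark q p = 0") (auto simp: mark_def)
  have "p \<in> {p. mark q p + cover f UNIV p \<noteq> 0} \<longleftrightarrow> p \<in> {p. cover f UNIV p = 2} \<union> {p. cover f UNIV p = 1}" for p
    using s[of p] le[of p] by (cases "mark q p = 0") auto
  then have "{p. mark q p + cover f UNIV p \<noteq> 0} = {p. cover f UNIV p = 2} \<union> {p. cover f UNIV p = 1}"
    by (rule set_eqI)
  moreover have "{p. cover f UNIV p = 2} \<inter> {p. cover f UNIV p = 1} = {}"
    by auto
  ultimately have "card {p. mark q p + cover f UNIV p \<noteq> 0} = card {p. cover f UNIV p = 2} + card (singles f)"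
    by (simp only: singles_def card_Un_disjoint finite)
  moreover have "36 = 2 * card {p. cover f UNIV p = 2} + card (singles f)"
    using sum_le_2[of UNIV "cover f UNIV"] le by (simp only: sum_cover_UNIV singles_def finite UNIV_I simp_thms)
  moreover have "card (singles f) = (if q = None then 0 else 2)"
    using q by (auto simp: singles_type_def split: option.splits)
  ultimately show "card {p. mark q p + cover f UNIV p \<noteq> 0} = (if q = None then 18 else 19)"
    by (auto split: if_splits)
qed

lemma represents_start: "represents (mark q) f {} (snd (start q))"
proof -
  have "weight (load_at (snd (start q)) p) = mark q p" for p
  proof -
    obtain x y z where p: "p = (x, y, z)" by (cases p)
    show ?thesis unfolding p
      by (cases q; cases x; cases y; cases z) (simp_all add: mark_def empty_grid_def marked_grid_def Let_def)
  qed
  then show ?thesis by (simp only: represents_def cover_def) simp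
qed

lemma force_valid:
  assumes valid: "\<And>p. e p + cover f UNIV p \<le> 2"
    and rep: "represents e f S G" and d: "d \<notin> S"
    and budget: "card {p. e p + cover f UNIV p \<noteq> 0} \<le> k + card {p. e p + cover f S p \<noteq> 0}"
  obtains k' G' where "force d (fst (f d)) (snd (f d)) (Some (k, G)) = Some (k', G')"
    "represents e f (insert d S) G'"
    "card {p. e p + cover f UNIV p \<noteq> 0} \<le> k' + card {p. e p + cover f (insert d S) p \<noteq> 0}"
proof -
  obtain G' where G': "add_line d (fst (f d)) (snd (f d)) G = Some G'" "represents e f (insert d S) G'"
    using add_line_valid[OF valid rep d] by blast
  obtain k' where k': "pay_line d (fst (f d)) (snd (f d)) G k = Some k'"
    "card {p. e p + cover f UNIV p \<noteq> 0} \<le> k' + card {p. e p + cover f (insert d S) p \<noteq> 0}"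
    using pay_valid[OF rep d budget] by blast
  have "force d (fst (f d)) (snd (f d)) (Some (k, G)) = Some (k', G')"
    using G'(1) k'(1) by simp
  then show thesis using that G'(2) k'(2) by blast
qed

lemma root_leaves_complete:
  assumes le: "\<And>p. cover f UNIV p \<le> 2" and q: "singles_type q f"
    and f: "f (DA T0 T0) = (T0, T0)" "f (DB T0) = (T0, T0)" "f (DA T1 T0) = (u, v)"
    and ds: "distinct ([DA T1 T0, DB T0, DA T0 T0] @ ds)"
  shows "rev (map (\<lambda>d. (d, f d)) ds) @ [(DA T1 T0, u, v), (DB T0, T0, T0), (DA T0 T0, T0, T0)]
    \<in> set (root_leaves q u v ds)"
proof -
  note valid = card_covered(2)[OF le q]
  obtain k0 G0 where start: "start q = (k0, G0)" by (cases "start q")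
  have "card {p. mark q p + cover f {} p \<noteq> 0} = (if q = None then 0 else 1)"
    by (simp add: mark_def cover_def)
  then have b0: "card {p. mark q p + cover f UNIV p \<noteq> 0} \<le> k0 + card {p. mark q p + cover f {} p \<noteq> 0}"
    using start card_covered(1)[OF le q] by (cases q) auto
  have r0: "represents (mark q) f {} G0"
    using represents_start[of q f] by (simp add: start)
  have n1: "DA T0 T0 \<notin> {}" by simp
  obtain k1 G1 where 1: "force (DA T0 T0) (fst (f (DA T0 T0))) (snd (f (DA T0 T0))) (Some (k0, G0)) = Some (k1, G1)"
    "represents (mark q) f (insert (DA T0 T0) {}) G1"
    "card {p. mark q p + cover f UNIV p \<noteq> 0} \<le> k1 + card {p. mark q p + cover f (insert (DA T0 T0) {}) p \<noteq> 0}"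
    by (rule force_valid[OF valid r0 n1 b0])
  have n2: "DB T0 \<notin> {DA T0 T0}" by simp
  obtain k2 G2 where 2: "force (DB T0) (fst (f (DB T0))) (snd (f (DB T0))) (Some (k1, G1)) = Some (k2, G2)"
    "represents (mark q) f (insert (DB T0) {DA T0 T0}) G2"
    "card {p. mark q p + cover f UNIV p \<noteq> 0} \<le> k2 + card {p. mark q p + cover f (insert (DB T0) {DA T0 T0}) p \<noteq> 0}"
    by (rule force_valid[OF valid 1(2) n2 1(3)])
  have n3: "DA T1 T0 \<notin> {DB T0, DA T0 T0}" by simp
  obtain k3 G3 where 3: "force (DA T1 T0) (fst (f (DA T1 T0))) (snd (f (DA T1 T0))) (Some (k2, G2)) = Some (k3, G3)"
    "represents (mark q) f (insert (DA T1 T0) {DB T0, DA T0 T0}) G3"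
    "card {p. mark q p + cover f UNIV p \<noteq> 0} \<le> k3 + card {p. mark q p + cover f (insert (DA T1 T0) {DB T0, DA T0 T0}) p \<noteq> 0}"
    by (rule force_valid[OF valid 2(2) n3 2(3)])
  note f123 = 1(1)[unfolded f fst_conv snd_conv start[symmetric]] 2(1)[unfolded f fst_conv snd_conv]
    3(1)[unfolded f fst_conv snd_conv]
  let ?s = "[(DA T1 T0, u, v), (DB T0, T0, T0), (DA T0 T0, T0, T0)]"
  have "rev (map (\<lambda>d. (d, f d)) ds) @ ?s \<in> set (leaves q ds ?s (k3, G3))"
  proof (rule leaves_complete[OF valid parities_singles[OF le q]])
    show "represents (mark q) f (fst ` set ?s) G3"
      using 3(2) by simp
    show "l = f d" if "(d, l) \<in> set ?s" for d l
      using that f by auto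
    show "distinct (map fst ?s @ ds)"
      using ds by simp
    show "card {p. mark q p + cover f UNIV p \<noteq> 0} \<le> k3 + card {p. mark q p + cover f (fst ` set ?s) p \<noteq> 0}"
      using 3(3) by simp
  qed
  then show ?thesis
    by (simp only: root_leaves_def f123 option.case)
qed

lemma list_all2_right: "list_all2 R xs ys \<Longrightarrow> y \<in> set ys \<Longrightarrow> \<exists>x \<in> set xs. R x y"
  by (induction rule: list_all2_induct) auto

theorem no_configuration:
  assumes a: "\<And>p. cover a UNIV p \<le> 2" and b: "\<And>p. cover b UNIV p \<le> 2"
    and sum: "\<And>p. cover (shift (\<lambda>x. x) a b) UNIV p \<le> 2"
    and diff: "\<And>p. cover (shift tneg a b) UNIV p \<le> 2"
    and a0: "a (DA T0 T0) = (T0, T0)" "a (DB T0) = (T0, T0)" "a (DA T1 T0) = (u, v)" "v \<noteq> T2"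
    and b0: "b (DA T0 T0) = (T0, T0)" "b (DB T0) = (T0, T1)" "b (DA T1 T0) = (w, w')" "v = T0 \<or> w' = T0"
    and q: "singles_type q a"
  shows False
proof -
  have "distinct ([DA T1 T0, DB T0, DA T0 T0] @ search_order)"
    by (simp add: search_order_def)
  from root_leaves_complete[OF a q a0(1-3) this]
  obtain s where s: "s \<in> set (root_leaves q u v search_order)"
    "s = rev (map (\<lambda>d. (d, a d)) search_order) @ [(DA T1 T0, u, v), (DB T0, T0, T0), (DA T0 T0, T0, T0)]"
    by blast
  have sa: "l = a d" if "(d, l) \<in> set s" for d l
    using that a0 unfolding s(2) by auto
  have "check q u v" using checks a0(4) by blast
  then have "list_all2 (check_leaf u v) (orders (q, u, v)) (root_leaves q u v search_order)"
    unfolding check_def check_root_def .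
  then obtain ds where ds: "ds \<in> set (orders (q, u, v))" "check_leaf u v ds s"
    using list_all2_right s(1) by metis
  \<comment> \<open>Thus \<open>v = T0\<close> would leave no list from which \<open>ds\<close>
    could come, and the last hypothesis on \<open>b\<close> yields \<open>w' = T0\<close>.\<close>
  have "orders (q, u, T0) = []"
    by (simp add: orders_def)
  then have "w' = T0" using ds(1) b0(4) by auto
  have "distinct (DA T0 T0 # DB T0 # DA T1 T0 # map fst (arrange s ds))"
    using ds(2) by (simp add: fst_arrange Let_def)
  then have "\<not> dead_from u v w (arrange s ds)"
    using a0 b0 \<open>w' = T0\<close> sa arrange_sound by (intro not_dead_from[OF b sum diff]) auto
  moreover have "dead_from u v w (arrange s ds)"
    using ds(2) by (cases w) (simp_all add: Let_def del: dead_from.simps)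
  ultimately show False by blast
qed

section \<open>Linear algebra over the field with three elements\<close>

lemma dim_span_le: "finite B \<Longrightarrow> vec.dim (vec.span B) \<le> card B" for B :: "('q::field ^ 'n) set"
  by (simp add: vec.dim_le_card')

definition dot :: "'q::comm_ring_1 ^ 'n \<Rightarrow> 'q ^ 'n \<Rightarrow> 'q" where
  "dot h x = (\<Sum>i\<in>UNIV. h $ i * x $ i)"

definition ker :: "'q::comm_ring_1 ^ 'n \<Rightarrow> ('q ^ 'n) set" where
  "ker h = {x. dot h x = 0}"

lemma mem_ker: "x \<in> ker h \<longleftrightarrow> dot h x = 0"
  by (simp add: ker_def)

lemma dot_commute: "dot h x = dot x h"
  by (simp add: dot_def mult.commute)

lemma dot_add [simp]: "dot h (x + y) = dot h x + dot h y" "dot (x + y) h = dot x h + dot y h"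
  by (simp_all add: dot_def sum.distrib algebra_simps)

lemma dot_scale [simp]: "dot h (k *s x) = k * dot h x" "dot (k *s x) h = k * dot x h"
  by (simp_all add: dot_def sum_distrib_left algebra_simps)

lemma dot_zero [simp]: "dot h 0 = 0" "dot 0 h = 0"
  by (simp_all add: dot_def)

lemma dot_diff [simp]: "dot h (x - y) = dot h x - dot h y" "dot (x - y) h = dot x h - dot y h"
  by (simp_all add: dot_def sum_subtractf algebra_simps)

lemma dot_axis: "dot h (axis i 1) = h $ i"
  by (simp add: dot_def axis_def if_distrib cong: if_cong)

lemma subspace_ker: "vec.subspace (ker h)" for h :: "'q::field ^ 'n"
  by (simp add: vec.subspace_def ker_def)

locale ternary =
  fixes ty :: "'q::{field,finite} itself"
  assumes card_q: "CARD('q) = 3"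
begin

text \<open>In characteristic 2 the third element \<open>x\<close> would have \<open>x + 1\<close>
  outside \<open>{0, 1, x}\<close>.\<close>

lemma one_neq_minus_one: "(1::'q) \<noteq> -1"
proof
  assume eq: "(1::'q) = -1"
  have "({0, 1} :: 'q set) \<noteq> UNIV"
  proof
    assume "({0, 1} :: 'q set) = UNIV"
    then have "card ({0, 1} :: 'q set) = 3" using card_q by simp
    then show False by simp
  qed
  then obtain x :: 'q where x: "x \<noteq> 0" "x \<noteq> 1" by blast
  have "card {0, 1, x} = 3" using x by auto
  then have U: "{0, 1, x} = UNIV" using card_q by (intro card_subset_eq) auto
  have "x + 1 \<in> {0, 1, x}" unfolding U by simp
  moreover have "x + 1 \<noteq> 0"
  proof
    assume "x + 1 = 0"
    then have "x = - 1" by (simp add: eq_neg_iff_add_eq_0)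
    then show False using x eq by simp
  qed
  ultimately show False using x by auto
qed

lemma UNIV_q: "(UNIV :: 'q set) = {0, 1, -1}"
proof -
  have "card {0, 1, -1 :: 'q} = 3" using one_neq_minus_one by auto
  then show ?thesis using card_q by (intro card_subset_eq[symmetric]) auto
qed

lemma cases_q: "k = 0 \<or> k = 1 \<or> k = -1" for k :: 'q
  using UNIV_q by auto

lemma two_eq: "(2 :: 'q) = -1"
proof -
  have "(2 :: 'q) \<noteq> 1"
    by (metis add_cancel_left_right one_add_one zero_neq_one)
  moreover have "(2 :: 'q) \<noteq> 0"
    using one_neq_minus_one by (metis eq_neg_iff_add_eq_0 one_add_one)
  ultimately show ?thesis using cases_q[of 2] by blast
qed

lemma three_eq: "(3 :: 'q) = 0"
proof -
  have "(3 :: 'q) = 2 + 1" by simp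
  then show ?thesis by (simp only: two_eq add.left_inverse)
qed

lemma triple_zero: "x + x + x = 0" for x :: "'q ^ 'n"
proof -
  have "x $ i + x $ i + x $ i = 3 * x $ i" for i by simp
  then show ?thesis by (simp add: vec_eq_iff three_eq)
qed

lemma neq_uminus: "x \<noteq> 0 \<Longrightarrow> x \<noteq> - x" for x :: "'q ^ 'n"
  using triple_zero[of x] by (metis add.commute add.right_neutral add_diff_cancel diff_minus_eq_add add.inverse_unique)

lemma card_span_insert:
  fixes U :: "('q ^ 'n) set"
  assumes U: "vec.subspace U" and v: "v \<notin> U"
  shows "card (vec.span (insert v U)) = 3 * card U"
proof -
  let ?f = "\<lambda>(k, u). k *s v + u"
  have "vec.span (insert v U) = ?f ` (UNIV \<times> U)"
  proof -
    have sp: "vec.span U = U" using U by (simp only: vec.span_eq_iff)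
    have "x \<in> vec.span (insert v U) \<longleftrightarrow> (\<exists>k. x - k *s v \<in> U)" for x
      by (simp only: vec.span_insert sp mem_Collect_eq)
    moreover have "(\<exists>k. x - k *s v \<in> U) \<longleftrightarrow> x \<in> ?f ` (UNIV \<times> U)" for x
    proof
      assume "\<exists>k. x - k *s v \<in> U"
      then obtain k where "x - k *s v \<in> U" by blast
      then have "x = ?f (k, x - k *s v)" "(k, x - k *s v) \<in> UNIV \<times> U" by simp_all
      then show "x \<in> ?f ` (UNIV \<times> U)" by (rule image_eqI)
    next
      assume "x \<in> ?f ` (UNIV \<times> U)"
      then obtain k u where "x = k *s v + u" "u \<in> U" by auto
      then have "x - k *s v \<in> U" by simp
      then show "\<exists>k. x - k *s v \<in> U" by blast
    qed
    ultimately show ?thesis by blast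
  qed
  moreover have "inj_on ?f (UNIV \<times> U)"
  proof (rule inj_onI, clarify)
    fix k u k' u'
    assume u: "u \<in> U" "u' \<in> U" and eq: "k *s v + u = k' *s v + u'"
    have "(k - k') *s v = u' - u"
      using eq by (simp add: vec.scale_left_diff_distrib algebra_simps)
    then have m: "(k - k') *s v \<in> U" using u U by (simp add: vec.subspace_diff)
    have "k = k'"
    proof (rule ccontr)
      assume "k \<noteq> k'"
      then have "v = inverse (k - k') *s ((k - k') *s v)"
        by (simp add: vec.scale_scale)
      then show False using m v U vec.subspace_scale by metis
    qed
    then show "k = k' \<and> u = u'" using eq by simp
  qed
  ultimately show ?thesis
    by (simp add: card_image card_cartesian_product card_q)
qed

text \<open>From here on dimensions are mostly expressed by cardinalities, dimension
  \<open>d\<close> being \<open>3 ^ d\<close> elements; this turns dimension formulas into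
  counting.\<close>

lemma card_subspace:
  fixes S :: "('q ^ 'n) set"
  assumes "vec.subspace S"
  shows "card S = 3 ^ vec.dim S"
proof -
  have *: "card (vec.span B) = 3 ^ card B" if "vec.independent B" for B :: "('q ^ 'n) set"
    using vec.finiteI_independent[OF that] that
  proof (induction B rule: finite_induct)
    case empty
    then show ?case by simp
  next
    case (insert b B)
    have ind: "vec.independent B" "b \<notin> vec.span B"
      using insert.prems insert.hyps by (simp_all add: vec.independent_insert)
    have "vec.span (insert b B) = vec.span (insert b (vec.span B))"
      by (simp only: vec.span_insert vec.span_span)
    then show ?case
      using card_span_insert[OF vec.subspace_span ind(2)] insert ind by simp
  qed
  obtain B where B: "B \<subseteq> S" "vec.independent B" "S \<subseteq> vec.span B" "card B = vec.dim S"
    using vec.basis_exists by metis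
  then have "S = vec.span B" using assms vec.span_subspace by metis
  then show ?thesis using *[OF B(2)] B(4) by simp
qed

lemma subspace_uminus: "vec.subspace S \<Longrightarrow> - x \<in> S \<longleftrightarrow> x \<in> S" for S :: "('q ^ 'n) set"
  using vec.subspace_neg[of S x] vec.subspace_neg[of S "- x"] by auto

lemma card_inter_ker:
  fixes S :: "('q ^ 'n) set"
  assumes S: "vec.subspace S" and n: "\<not> S \<subseteq> ker h"
  shows "card S = 3 * card (S \<inter> ker h)"
proof -
  obtain v where v: "v \<in> S" "dot h v \<noteq> 0" using n by (auto simp: ker_def)
  have sub: "vec.subspace (S \<inter> ker h)" using S subspace_ker vec.subspace_inter by blast
  have "S = vec.span (insert v (S \<inter> ker h))"
  proof
    show "S \<subseteq> vec.span (insert v (S \<inter> ker h))"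
    proof
      fix x assume x: "x \<in> S"
      let ?k = "dot h x / dot h v"
      have "x - ?k *s v \<in> S \<inter> ker h"
        using x v S by (simp add: mem_ker vec.subspace_diff vec.subspace_scale)
      then show "x \<in> vec.span (insert v (S \<inter> ker h))"
        by (intro vec.span_breakdown_eq[THEN iffD2] exI[of _ ?k] vec.span_base)
    qed
    show "vec.span (insert v (S \<inter> ker h)) \<subseteq> S"
      using v S by (intro vec.span_minimal) auto
  qed
  moreover have "v \<notin> S \<inter> ker h" using v by (simp add: mem_ker)
  ultimately show ?thesis using card_span_insert[OF sub] by metis
qed

lemma card_ker: "h \<noteq> 0 \<Longrightarrow> 3 * card (ker h) = 3 ^ CARD('n)" for h :: "'q ^ 'n"
proof -
  assume "h \<noteq> 0"
  then obtain i where "h $ i \<noteq> 0" by (auto simp: vec_eq_iff)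
  then have "axis i 1 \<notin> ker h" by (simp add: mem_ker dot_axis)
  then have "\<not> UNIV \<subseteq> ker h" by auto
  then show ?thesis using card_inter_ker[of UNIV h] by (simp add: card_q)
qed

text \<open>The inner products with the vectors in \<open>B\<close> take at most
  \<open>3 ^ card B\<close> values, fewer than there are vectors. The difference of two vectors with
  equal products is orthogonal to \<open>B\<close>.\<close>

lemma orthogonal_exists:
  fixes B :: "('q ^ 'n) set"
  assumes "card B < CARD('n)"
  obtains h where "h \<noteq> 0" "B \<subseteq> ker h"
proof -
  have fin: "finite B" by simp
  let ?f = "\<lambda>h. \<lambda>b\<in>B. dot h b"
  have "?f ` UNIV \<subseteq> B \<rightarrow>\<^sub>E (UNIV :: 'q set)" by auto
  then have "card (?f ` (UNIV :: ('q ^ 'n) set)) \<le> 3 ^ card B"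
    using card_mono[of "B \<rightarrow>\<^sub>E (UNIV :: 'q set)"] by (simp add: card_PiE finite_PiE card_q)
  also have "\<dots> < card (UNIV :: ('q ^ 'n) set)"
    using assms by (simp add: card_q)
  finally have "\<not> inj ?f" using card_image[of ?f UNIV] by (metis less_irrefl)
  then obtain x y where xy: "x \<noteq> y" "?f x = ?f y" unfolding inj_def by blast
  have "dot x b = dot y b" if "b \<in> B" for b
    using fun_cong[OF xy(2), of b] that by simp
  then have "B \<subseteq> ker (x - y)" by (auto simp: mem_ker)
  then show thesis using xy(1) that[of "x - y"] by simp
qed

lemma subspace_in_ker:
  fixes S :: "('q ^ 'n) set"
  assumes "vec.dim S < CARD('n)"
  obtains h where "h \<noteq> 0" "S \<subseteq> ker h"
proof -
  obtain B where B: "B \<subseteq> S" "vec.independent B" "S \<subseteq> vec.span B" "card B = vec.dim S"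
    using vec.basis_exists by metis
  obtain h where h: "h \<noteq> 0" "B \<subseteq> ker h"
    using orthogonal_exists[of B] B(4) assms by metis
  then have "vec.span B \<subseteq> ker h" using subspace_ker by (intro vec.span_minimal)
  then show thesis using that h(1) B(3) by blast
qed

lemma hyperplane_iff: "hyperplane H \<longleftrightarrow> (\<exists>h. h \<noteq> 0 \<and> H = ker h)" for H :: "('q ^ 'n) set"
proof
  assume H: "hyperplane H"
  then have s: "vec.subspace H" and d: "vec.dim H = CARD('n) - 1"
    by (auto simp: hyperplane_def)
  have n: "CARD('n) > 0" by simp
  obtain h where h: "h \<noteq> 0" "H \<subseteq> ker h"
    using subspace_in_ker[of H] d n by (metis diff_less zero_less_one)
  have "(3::nat) ^ CARD('n) = 3 * 3 ^ (CARD('n) - 1)"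
    using n by (metis Suc_pred' power_Suc)
  then have "card H = card (ker h)"
    using card_subspace[OF s] d card_ker[OF h(1)] by simp
  then have "H = ker h" using h(2) by (intro card_subset_eq) auto
  then show "\<exists>h. h \<noteq> 0 \<and> H = ker h" using h(1) by blast
next
  assume "\<exists>h. h \<noteq> 0 \<and> H = ker h"
  then obtain h where h: "h \<noteq> 0" "H = ker h" by blast
  have "3 * (3::nat) ^ vec.dim (ker h) = 3 ^ CARD('n)"
    using card_ker[OF h(1)] card_subspace[OF subspace_ker[of h]] by simp
  then have "(3::nat) ^ Suc (vec.dim (ker h)) = 3 ^ CARD('n)" by simp
  then have "Suc (vec.dim (ker h)) = CARD('n)" by (subst (asm) power_inject_exp) auto
  then have "vec.dim (ker h) = CARD('n) - 1" by linarith
  then show "hyperplane H" using h(2) subspace_ker[of h] by (simp add: hyperplane_def)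
qed

text \<open>Steinitz exchange, used to count the \<open>v\<close> for which
  \<open>vec.span (insert v U)\<close> captures a given \<open>x\<close>.\<close>

lemma span_exchange:
  fixes U :: "('q ^ 'n) set"
  assumes U: "vec.subspace U" and x: "x \<notin> U"
  shows "{v. v \<notin> U \<and> x \<in> vec.span (insert v U)} = vec.span (insert x U) - U"
proof -
  have sp: "vec.span U = U" using U by (simp add: vec.span_eq_iff)
  have "x \<in> vec.span (insert v U) \<longleftrightarrow> v \<in> vec.span (insert x U)" if "v \<notin> U" for v
    using vec.in_span_insert[of x v U] vec.in_span_insert[of v x U] x that sp by auto
  then show ?thesis by auto
qed

end

section \<open>The Griesmer bound\<close>

context ternary
begin

lemma ker_of_card:
  fixes W :: "('q ^ 5) set"
  assumes "vec.subspace W" "card W = 81"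
  obtains h where "h \<noteq> 0" "W = ker h"
proof -
  have "(3::nat) ^ vec.dim W = 3 ^ 4" using assms card_subspace[OF assms(1)] by simp
  then have "vec.dim W = 4" by (subst (asm) power_inject_exp) auto
  then have "hyperplane W" using assms by (simp add: hyperplane_def)
  then show thesis using that hyperplane_iff by blast
qed

lemma subspace_extend:
  fixes S :: "('q ^ 'n) set"
  assumes "vec.subspace S" "card S < 3 ^ CARD('n)"
  obtains T where "S \<subseteq> T" "vec.subspace T" "card T = 3 * card S"
proof -
  have "S \<noteq> UNIV" using assms by (auto simp: card_q)
  then obtain v where "v \<notin> S" by blast
  then show thesis
    using that[of "vec.span (insert v S)"] card_span_insert[OF assms(1)] vec.span_superset[of "insert v S"]
    by (simp add: vec.subspace_span)
qed

lemma extend_to_line: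
  fixes S :: "('q ^ 5) set"
  assumes "vec.subspace S" "vec.dim S \<le> 2"
  obtains T where "S \<subseteq> T" "vec.subspace T" "card T = 9"
proof -
  have up: "\<exists>T. S \<subseteq> T \<and> vec.subspace T \<and> card T = 3 * card S"
    if "vec.subspace S" "card S < 243" for S :: "('q ^ 5) set"
  proof -
    have "card S < 3 ^ CARD(5)" using that(2) by simp
    then show ?thesis using subspace_extend[OF that(1)] by metis
  qed
  have "vec.dim S = 0 \<or> vec.dim S = 1 \<or> vec.dim S = 2" using assms(2) by linarith
  then have "card S = 1 \<or> card S = 3 \<or> card S = 9" using card_subspace[OF assms(1)] by auto
  then consider "card S = 9" | "card S = 3" | "card S = 1" by blast
  then show thesis
  proof cases
    case 1
    then show ?thesis using that assms by blast
  next
    case 2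
    then show ?thesis using that up[of S] assms by auto
  next
    case 3
    then obtain T where T: "S \<subseteq> T" "vec.subspace T" "card T = 3" using up[of S] assms by auto
    then show ?thesis using that up[of T] by auto
  qed
qed

text \<open>An indexed family, since members of the multiset may coincide; \<open>s\<close> is only
  an upper bound here.\<close>

definition line_family :: "nat \<Rightarrow> nat \<Rightarrow> (nat \<Rightarrow> ('q ^ 5) set) \<Rightarrow> bool" where
  "line_family n s l \<longleftrightarrow> (\<forall>i<n. vec.subspace (l i) \<and> card (l i) = 9) \<and>
     (\<forall>h. h \<noteq> 0 \<longrightarrow> card {i. i < n \<and> l i \<subseteq> ker h} \<le> s)"

text \<open>A subspace enlarged to a line lies in no further hyperplane, so the bound
  \<open>s\<close> survives.\<close>

lemma line_family_of_system:
  fixes S :: "('q ^ 5) set multiset"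
  assumes "size S = n" "\<And>X. X \<in># S \<Longrightarrow> vec.subspace X \<and> vec.dim X \<le> 2"
    and "\<And>H. hyperplane H \<Longrightarrow> num_contained S H \<le> s"
  obtains l where "line_family n s l"
proof -
  obtain xs where xs: "S = mset xs" by (metis ex_mset)
  have len: "length xs = n" using assms(1) xs by simp
  have "\<exists>T. xs ! i \<subseteq> T \<and> vec.subspace T \<and> card T = 9" if "i < n" for i
  proof -
    have "xs ! i \<in># S" using that xs len by simp
    then show ?thesis using assms(2) extend_to_line[of "xs ! i"] by metis
  qed
  then obtain l where l: "\<And>i. i < n \<Longrightarrow> xs ! i \<subseteq> l i \<and> vec.subspace (l i) \<and> card (l i) = 9"
    by metis
  have "card {i. i < n \<and> l i \<subseteq> ker h} \<le> s" if "h \<noteq> 0" for h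
  proof -
    have "hyperplane (ker h)" using that hyperplane_iff by blast
    have "card {i. i < n \<and> l i \<subseteq> ker h} \<le> card {i. i < n \<and> xs ! i \<subseteq> ker h}"
      using l by (intro card_mono) auto
    also have "\<dots> = length (filter (\<lambda>X. X \<subseteq> ker h) xs)"
      unfolding length_filter_conv_card len ..
    also have "\<dots> = num_contained S (ker h)"
      unfolding num_contained_def xs by (simp only: mset_filter[symmetric] size_mset)
    also have "\<dots> \<le> s" using assms(3) \<open>hyperplane (ker h)\<close> by blast
    finally show ?thesis .
  qed
  then have "line_family n s l" unfolding line_family_def using l by blast
  then show thesis by (rule that)
qed

text \<open>For a subspace \<open>S\<close> of dimension 2 this is the number of points of the projective line \<open>S\<close> on \<open>U\<close>.\<close>

definition points :: "('q ^ 5) set \<Rightarrow> ('q ^ 5) set \<Rightarrow> nat" where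
  "points S U = (card (S \<inter> U) - 1) div 2"

lemma card_points:
  assumes "vec.subspace S" "vec.subspace U"
  shows "card (S \<inter> U) = 2 * points S U + 1"
proof -
  have "card (S \<inter> U) = 3 ^ vec.dim (S \<inter> U)"
    using assms by (intro card_subspace vec.subspace_inter)
  then have "odd (card (S \<inter> U))" by simp
  then show ?thesis by (auto simp: points_def elim: oddE)
qed

lemma card_compl: "card (- U) = 243 - card U" for U :: "('q ^ 5) set"
  by (simp add: Compl_eq_Diff_UNIV card_Diff_subset card_q)

text \<open>Double counting: each \<open>x\<close> in \<open>S - U\<close> lies in
  \<open>vec.span (insert v U)\<close> for exactly \<open>2 * card U\<close> vectors
  \<open>v\<close> outside \<open>U\<close>. The constant 4 is the number of points of a line, 243
  that of all vectors; the negative term stands on the left to avoid subtraction.\<close>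

lemma sum_points_span:
  assumes S: "vec.subspace S" "card S = 9" and U: "vec.subspace U"
  shows "(\<Sum>v\<in>-U. points S (vec.span (insert v U))) + 2 * card U * points S U =
    (243 - card U) * points S U + 2 * card U * 4"
proof -
  let ?W = "\<lambda>v. vec.span (insert v U)"
  have sub: "U \<subseteq> ?W v" for v
    by (meson order_trans subset_insertI vec.span_superset)
  have "card (S \<inter> ?W v) = card (S \<inter> U) + card {x \<in> S - U. x \<in> ?W v}" for v
  proof -
    have "S \<inter> ?W v = (S \<inter> U) \<union> {x \<in> S - U. x \<in> ?W v}" using sub[of v] by blast
    moreover have "(S \<inter> U) \<inter> {x \<in> S - U. x \<in> ?W v} = {}" by blast
    ultimately show ?thesis by (simp add: card_Un_disjoint)
  qed
  then have "(\<Sum>v\<in>-U. card (S \<inter> ?W v)) = card (-U) * card (S \<inter> U) + (\<Sum>v\<in>-U. card {x \<in> S - U. x \<in> ?W v})"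
    by (simp add: sum.distrib)
  also have "(\<Sum>v\<in>-U. card {x \<in> S - U. x \<in> ?W v}) = (\<Sum>x\<in>S - U. card {v \<in> - U. x \<in> ?W v})"
    by (rule sum_multicount_gen) auto
  also have "\<dots> = (\<Sum>x\<in>S - U. 2 * card U)"
  proof (rule sum.cong)
    fix x assume x: "x \<in> S - U"
    have "{v \<in> - U. x \<in> ?W v} = ?W x - U" using span_exchange[OF U, of x] x by auto
    moreover have "card (?W x - U) = 2 * card U"
      using card_span_insert[OF U, of x] x sub[of x] by (simp add: card_Diff_subset)
    ultimately show "card {v \<in> - U. x \<in> ?W v} = 2 * card U" by simp
  qed simp
  also have "\<dots> = 2 * card U * card (S - U)" by simp
  also have "card (S - U) = 9 - card (S \<inter> U)" using S by (simp add: card_Diff_subset_Int)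
  finally have "(\<Sum>v\<in>-U. card (S \<inter> ?W v)) =
      (243 - card U) * card (S \<inter> U) + 2 * card U * (9 - card (S \<inter> U))"
    by (simp add: card_compl)
  moreover have "card (S \<inter> ?W v) = 2 * points S (?W v) + 1" for v
    using S by (intro card_points vec.subspace_span)
  ultimately have eq: "(\<Sum>v\<in>-U. 2 * points S (?W v) + 1) =
      (243 - card U) * (2 * points S U + 1) + 2 * card U * (8 - 2 * points S U)"
    using card_points[OF S(1) U] by simp
  have "card (S \<inter> U) \<le> card S" by (intro card_mono) auto
  then have "points S U \<le> 4" using S(2) by (simp add: points_def)
  then obtain q where q: "4 = points S U + q" using le_Suc_ex by blast
  have "(\<Sum>v\<in>-U. 2 * points S (?W v) + 1) = 2 * (\<Sum>v\<in>-U. points S (?W v)) + (243 - card U)"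
    by (simp only: sum.distrib sum_distrib_left[symmetric] sum_constant card_compl) simp
  moreover have "8 - 2 * points S U = 2 * q" using q by linarith
  moreover have "X = D * a + 2 * u * q"
    if "2 * X + D = D * (2 * a + 1) + 2 * u * (2 * q)" for X D a u :: nat
    using that by (simp add: add_mult_distrib2 mult.assoc)
  ultimately have "(\<Sum>v\<in>-U. points S (?W v)) = (243 - card U) * points S U + 2 * card U * q"
    using eq by metis
  then show ?thesis unfolding q by (simp only: add_mult_distrib2 add.assoc add.commute[of "2 * card U * q"])
qed

lemma points_ker:
  assumes "vec.subspace S" "card S = 9"
  shows "points S (ker h) = 1 + 3 * of_bool (S \<subseteq> ker h)"
proof (cases "S \<subseteq> ker h")
  case True
  then show ?thesis using assms by (simp add: points_def Int_absorb2)
next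
  case False
  then have "card (S \<inter> ker h) = 3" using card_inter_ker[OF assms(1), of h] assms(2) by simp
  then show ?thesis using False by (simp add: points_def)
qed

context
  fixes n s :: nat and l :: "nat \<Rightarrow> ('q ^ 5) set"
  assumes l: "line_family n s l"
begin

definition total :: "('q ^ 5) set \<Rightarrow> nat" where
  "total U = (\<Sum>i<n. points (l i) U)"

text \<open>Sum the bound \<open>m\<close> over the subspaces \<open>vec.span (insert v U)\<close>
  for \<open>v\<close> outside \<open>U\<close>, and evaluate the left side line by line with
  \<open>sum_points_span\<close>.\<close>

lemma total_step:
  assumes U: "vec.subspace U"
    and W: "\<And>W. vec.subspace W \<Longrightarrow> card W = 3 * card U \<Longrightarrow> total W \<le> m"
  shows "(243 - card U) * total U + 8 * card U * n \<le> (243 - card U) * m + 2 * card U * total U"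
proof -
  have "(\<Sum>v\<in>-U. total (vec.span (insert v U))) \<le> (\<Sum>v\<in>-U. m)"
    by (intro sum_mono W vec.subspace_span) (simp add: card_span_insert[OF U])
  also have "\<dots> = (243 - card U) * m" by (simp add: card_compl)
  finally have "(\<Sum>v\<in>-U. total (vec.span (insert v U))) \<le> (243 - card U) * m" .
  moreover have "(\<Sum>v\<in>-U. total (vec.span (insert v U))) =
      (\<Sum>i<n. \<Sum>v\<in>-U. points (l i) (vec.span (insert v U)))"
    unfolding total_def by (rule sum.swap)
  moreover have "(\<Sum>i<n. \<Sum>v\<in>-U. points (l i) (vec.span (insert v U))) + 2 * card U * total U =
      (243 - card U) * total U + 8 * card U * n"
  proof -
    have "(\<Sum>i<n. (\<Sum>v\<in>-U. points (l i) (vec.span (insert v U))) + 2 * card U * points (l i) U) =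
        (\<Sum>i<n. (243 - card U) * points (l i) U + 2 * card U * 4)"
      using l U by (intro sum.cong sum_points_span) (auto simp: line_family_def)
    then show ?thesis
      by (simp add: sum.distrib sum_distrib_left[symmetric] total_def)
  qed
  ultimately show ?thesis by linarith
qed

lemma total_hyperplane:
  assumes "vec.subspace W" "card W = 81"
  shows "total W \<le> n + 3 * s"
proof -
  obtain h where h: "h \<noteq> 0" "W = ker h" using ker_of_card assms by blast
  have "total W = (\<Sum>i<n. 1 + 3 * of_bool (l i \<subseteq> ker h))"
    unfolding total_def h(2) using l by (intro sum.cong points_ker) (auto simp: line_family_def)
  also have "\<dots> = n + 3 * card ({..<n} \<inter> {i. l i \<subseteq> ker h})"
    by (simp only: sum.distrib sum_distrib_left[symmetric] sum_of_bool_eq finite_lessThan of_nat_id) simp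
  also have "{..<n} \<inter> {i. l i \<subseteq> ker h} = {i. i < n \<and> l i \<subseteq> ker h}" by auto
  finally show ?thesis using l h(1) by (auto simp: line_family_def)
qed

lemma subspace_of_card:
  assumes "k \<le> 5"
  obtains U :: "('q ^ 5) set" where "vec.subspace U" "card U = 3 ^ k"
proof -
  have "\<exists>U :: ('q ^ 5) set. vec.subspace U \<and> card U = 3 ^ k"
    using assms
  proof (induction k)
    case 0
    then show ?case by (intro exI[of _ "{0}"]) simp
  next
    case (Suc k)
    then obtain U :: "('q ^ 5) set" where U: "vec.subspace U" "card U = 3 ^ k"
      using Suc_leD by blast
    have "(3::nat) ^ k < 3 ^ 5" using Suc.prems by (intro power_strict_increasing) auto
    then have "card U < 3 ^ CARD(5)" using U(2) by simp
    then obtain T where "U \<subseteq> T" "vec.subspace T" "card T = 3 * card U"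
      by (rule subspace_extend[OF U(1)])
    then have "card T = 3 ^ Suc k" using U(2) by simp
    then show ?case using \<open>vec.subspace T\<close> by blast
  qed
  then show thesis using that by blast
qed

text \<open>The maximum over all subspaces of one dimension is an integer that serves as
  \<open>m\<close> in the next step; this is what allows rounding in
  \<open>griesmer_arith\<close>.\<close>

lemma max_total:
  assumes "k \<le> 5"
  shows "\<exists>U. vec.subspace U \<and> card U = 3 ^ k \<and> (\<forall>W. vec.subspace W \<longrightarrow> card W = 3 ^ k \<longrightarrow> total W \<le> total U)"
proof -
  let ?A = "{U :: ('q ^ 5) set. vec.subspace U \<and> card U = 3 ^ k}"
  have ne: "?A \<noteq> {}"
  proof -
    obtain U :: "('q ^ 5) set" where "vec.subspace U" "card U = 3 ^ k"
      by (rule subspace_of_card[OF assms])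
    then have "U \<in> ?A" by simp
    then show ?thesis by (metis empty_iff)
  qed
  have "Max (total ` ?A) \<in> total ` ?A" using ne by (intro Max_in) auto
  then obtain U where U: "Max (total ` ?A) = total U" "U \<in> ?A" by (rule imageE)
  have "total W \<le> total U" if "W \<in> ?A" for W
    using that unfolding U(1)[symmetric] by (intro Max_ge) auto
  then show ?thesis using U(2) by (intro exI[of _ U]) simp
qed

text \<open>\<open>m2\<close> and \<open>m1\<close> are the largest totals of a two- and of a
  one-dimensional subspace. In dimension 3 the bound \<open>4 * s\<close> is an integer anyway and
  is substituted directly.\<close>

lemma griesmer:
  "\<exists>m2 m1. 3 * m2 + n \<le> 13 * s \<and> 39 * m1 + 4 * n \<le> 40 * m2 \<and> 4 * n \<le> 121 * m1"
proof -
  have m3: "total U \<le> 4 * s" if "vec.subspace U" "card U = 27" for U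
    using total_step[of U "n + 3 * s"] total_hyperplane that by simp
  have "(2::nat) \<le> 5" by simp
  from max_total[OF this] obtain U2 where U2: "vec.subspace U2 \<and> card U2 = 3 ^ 2 \<and>
    (\<forall>W. vec.subspace W \<longrightarrow> card W = 3 ^ 2 \<longrightarrow> total W \<le> total U2)" ..
  have 2: "3 * total U2 + n \<le> 13 * s"
    using total_step[of U2 "4 * s"] m3 U2 by simp
  have "(1::nat) \<le> 5" by simp
  from max_total[OF this] obtain U1 where U1: "vec.subspace U1 \<and> card U1 = 3 ^ 1 \<and>
    (\<forall>W. vec.subspace W \<longrightarrow> card W = 3 ^ 1 \<longrightarrow> total W \<le> total U1)" ..
  have 1: "39 * total U1 + 4 * n \<le> 40 * total U2"
    using total_step[of U1 "total U2"] U2 U1 by simp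
  have "4 * n \<le> 121 * total U1"
  proof -
    have "points S {0} = 0" if "vec.subspace S" for S
      using that by (simp add: points_def vec.subspace_0 Int_insert_right)
    then have "total {0} = 0" using l by (simp add: total_def line_family_def)
    then show ?thesis using total_step[of "{0}" "total U1"] U1 by simp
  qed
  then show ?thesis using 1 2 by blast
qed

end

text \<open>One period raises \<open>s\<close> by 13, \<open>n\<close> by 121, \<open>m2\<close> by
  16 and \<open>m1\<close> by 4. With these multiples of \<open>t\<close> removed, rounding the
  first two inequalities to \<open>r2\<close> and \<open>r1\<close> leaves a numerical test that
  does not involve \<open>t\<close>.\<close>

lemma griesmer_arith:
  fixes t s n m1 m2 j c r1 r2 :: int
  assumes "3 * m2 + n \<le> 13 * s" "39 * m1 + 4 * n \<le> 40 * m2" "4 * n \<le> 121 * m1"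
    and s: "s = 13 * t - j"
    and r2: "r2 = (c - 1 - 13 * j) div 3" and r1: "r1 = (40 * r2 + 4 * c - 4) div 39"
    and c: "121 * r1 < 4 - 4 * c"
  shows "n \<le> 121 * t - c"
proof (rule ccontr)
  assume "\<not> n \<le> 121 * t - c"
  then have n: "n \<ge> 121 * t - c + 1" by linarith
  have "3 * m2 - 48 * t \<le> c - 1 - 13 * j"
    using assms(1) n s by simp
  then have "3 * (m2 - 16 * t) \<le> c - 1 - 13 * j" by simp
  from zdiv_mono1[OF this, of 3] have m2: "m2 - 16 * t \<le> r2" by (simp add: r2)
  have "39 * (m1 - 4 * t) \<le> 40 * r2 + 4 * c - 4"
    using assms(2) n m2 by simp
  from zdiv_mono1[OF this, of 39] have "m1 - 4 * t \<le> r1" by (simp add: r1)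
  then show False using assms(3) n c by simp
qed

end

section \<open>Thirteen lines, any three spanning the space\<close>

lemma even_card_symmetric:
  fixes F :: "'a::group_add set"
  assumes "finite F" "\<And>v. v \<in> F \<Longrightarrow> - v \<in> F \<and> v \<noteq> - v"
  shows "even (card F)"
  using assms
proof (induction "card F" arbitrary: F rule: less_induct)
  case less
  show ?case
  proof (cases "F = {}")
    case False
    then obtain v where v: "v \<in> F" by auto
    let ?G = "F - {v, - v}"
    have w: "- v \<in> F" "v \<noteq> - v" using less.prems(2)[OF v] by simp_all
    have "card {v, - v} = 2" using w(2) by simp
    then have c: "card F = card ?G + 2"
      using card_Diff_subset[of "{v, - v}" F] card_mono[of F "{v, - v}"] less.prems(1) v w(1) by simp
    have "- u \<in> ?G \<and> u \<noteq> - u" if "u \<in> ?G" for u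
    proof -
      have "- u \<in> F" "u \<noteq> - u" using less.prems(2)[of u] that by simp_all
      moreover have "- u \<noteq> v" "- u \<noteq> - v" using that by auto
      ultimately show ?thesis by simp
    qed
    note G = this
    have "even (card ?G)"
    proof (rule less.hyps)
      show "card ?G < card F" using c by simp
      show "finite ?G" using less.prems(1) by simp
    qed (rule G)
    then show ?thesis using c by simp
  qed simp
qed

section \<open>Intersections of subspaces by counting; annihilators\<close>

context ternary
begin

text \<open>The map sending \<open>(u, w)\<close> to \<open>u - w\<close> has too few values in
  \<open>X\<close> to be injective; two pairs with the same value give the common vector.\<close>

lemma pigeonhole_subspaces:
  fixes U W X :: "('q ^ 'n) set"
  assumes s: "vec.subspace U" "vec.subspace W" "vec.subspace X" "U \<subseteq> X" "W \<subseteq> X"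
    and c: "card X < card U * card W"
  obtains v where "v \<noteq> 0" "v \<in> U" "v \<in> W"
proof -
  let ?f = "\<lambda>(u, w). u - w"
  have "?f ` (U \<times> W) \<subseteq> X"
    using s by (auto intro!: vec.subspace_diff)
  then have "card (?f ` (U \<times> W)) \<le> card X" by (intro card_mono) auto
  then have "card (?f ` (U \<times> W)) \<noteq> card (U \<times> W)" using c by (simp add: card_cartesian_product)
  then have "\<not> inj_on ?f (U \<times> W)" using card_image[of ?f "U \<times> W"] by argo
  then obtain p p' where p: "p \<in> U \<times> W" "p' \<in> U \<times> W" "?f p = ?f p'" "p \<noteq> p'"
    unfolding inj_on_def by auto
  obtain u w where uw: "p = (u, w)" by (cases p)
  obtain u' w' where uw': "p' = (u', w')" by (cases p')
  have e: "u - u' = w - w'" using p(3) unfolding uw uw' by (simp add: algebra_simps)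
  have "u - u' \<in> U" using p s unfolding uw uw' by (auto intro!: vec.subspace_diff)
  moreover have "w - w' \<in> W" using p s unfolding uw uw' by (auto intro!: vec.subspace_diff)
  moreover have "u - u' \<noteq> 0" using p(4) e unfolding uw uw' by auto
  ultimately show thesis using that[of "u - u'"] e by simp
qed

lemma coordinate:
  fixes U W :: "('q ^ 'n) set"
  assumes "vec.subspace U" "vec.subspace W" "U \<subseteq> W" "card W = 3 * card U" "v \<in> W" "v \<notin> U" "w \<in> W"
  shows "\<exists>k. w - k *s v \<in> U"
proof -
  have "vec.span (insert v U) \<subseteq> W" using assms by (intro vec.span_minimal) auto
  then have "vec.span (insert v U) = W"
    using card_span_insert[OF assms(1,6)] assms(4) by (intro card_subset_eq) auto
  then have "w \<in> vec.span (insert v U)" using assms(7) by simp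
  moreover have "vec.span U = U" using assms(1) by (simp only: vec.span_eq_iff)
  ultimately show ?thesis by (simp only: vec.span_breakdown_eq)
qed

definition annihilator :: "('q ^ 'n) set \<Rightarrow> ('q ^ 'n) set" where
  "annihilator S = {h. S \<subseteq> ker h}"

lemma subspace_annihilator: "vec.subspace (annihilator S)"
  by (auto simp: vec.subspace_def annihilator_def mem_ker subset_iff)

lemma ker_subset_ker:
  fixes a b :: "'q ^ 'n"
  assumes "a \<noteq> 0" "ker a \<subseteq> ker b"
  obtains k where "b = k *s a"
proof -
  obtain i where i: "a $ i \<noteq> 0" using assms(1) by (auto simp: vec_eq_iff)
  define k where "k = b $ i / a $ i"
  have "b $ j = k * a $ j" for j
  proof -
    have "a $ i *s axis j 1 - a $ j *s axis i 1 \<in> ker a"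
      by (simp add: mem_ker dot_axis)
    then have "a $ i *s axis j 1 - a $ j *s axis i 1 \<in> ker b" using assms(2) by (rule subsetD[rotated])
    then show ?thesis using i by (simp add: mem_ker dot_axis field_simps k_def)
  qed
  then have "b = k *s a" by (simp add: vec_eq_iff)
  then show thesis by (rule that)
qed

text \<open>For a basis \<open>a\<close>, \<open>b\<close> of \<open>S\<close> the annihilator is
  \<open>ker a \<inter> ker b\<close>. The two hyperplanes differ, so it has 243 / 9
  elements.\<close>

lemma card_annihilator:
  fixes S :: "('q ^ 5) set"
  assumes S: "vec.subspace S" "card S = 9"
  shows "card (annihilator S) = 27"
proof -
  have "card (S - {0}) = 8" using S vec.subspace_0[OF S(1)] by (simp add: card_Diff_singleton)
  then have "S - {0} \<noteq> {}" by (intro notI) simp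
  then obtain a where "a \<in> S - {0}" by (metis ex_in_conv)
  then have a: "a \<in> S" "a \<noteq> 0" by simp_all
  let ?A = "vec.span (insert a {0})"
  have sA: "vec.subspace ?A" by (rule vec.subspace_span)
  have cA: "card ?A = 3" using card_span_insert[of "{0}" a] a(2) by simp
  have AS: "?A \<subseteq> S" using a vec.subspace_0[OF S(1)] S(1) by (intro vec.span_minimal) auto
  have "?A \<noteq> S" using cA S(2) by auto
  then obtain b where b: "b \<in> S" "b \<notin> ?A" using AS by blast
  have "vec.span (insert b ?A) \<subseteq> S" using AS b S(1) by (intro vec.span_minimal) auto
  then have eq: "vec.span (insert b ?A) = S"
    using card_span_insert[OF sA b(2)] cA S(2) by (intro card_subset_eq) auto
  have "annihilator S = ker a \<inter> ker b"
  proof (rule set_eqI)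
    fix h
    show "h \<in> annihilator S \<longleftrightarrow> h \<in> ker a \<inter> ker b"
    proof
      assume "h \<in> annihilator S"
      then show "h \<in> ker a \<inter> ker b"
        using a(1) b(1) by (auto simp: annihilator_def mem_ker dot_commute[of h])
    next
      assume "h \<in> ker a \<inter> ker b"
      then have h: "a \<in> ker h" "b \<in> ker h" by (simp_all add: mem_ker dot_commute[of h])
      have "0 \<in> ker h" by (simp add: mem_ker)
      then have "?A \<subseteq> ker h" using h(1) by (intro vec.span_minimal subspace_ker) auto
      then have "vec.span (insert b ?A) \<subseteq> ker h" using h(2) by (intro vec.span_minimal subspace_ker) auto
      then show "h \<in> annihilator S" by (simp add: eq annihilator_def)
    qed
  qed
  moreover have "\<not> ker a \<subseteq> ker b"
  proof
    assume "ker a \<subseteq> ker b"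
    then obtain k where "b = k *s a" by (rule ker_subset_ker[OF a(2)])
    moreover have "a \<in> ?A" by (intro vec.span_base) simp
    ultimately show False using b(2) vec.subspace_scale[OF sA] by metis
  qed
  moreover have "3 * card (ker a) = 243" using card_ker[OF a(2)] by simp
  ultimately show ?thesis using card_inter_ker[OF subspace_ker[of a], of b] by simp
qed

end

section \<open>The thirteen annihilators and the choice of \<open>x\<close>\<close>

locale thirteen_lines = ternary ty for ty :: "'q::{field,finite} itself" +
  fixes l :: "nat \<Rightarrow> ('q ^ 5) set"
  assumes l: "line_family 13 2 l"
begin

definition A :: "nat \<Rightarrow> ('q ^ 5) set" where
  "A i = annihilator (l i)"

lemma subspace_A [simp]: "vec.subspace (A i)"
  by (simp add: A_def subspace_annihilator)

lemma card_A: "i < 13 \<Longrightarrow> card (A i) = 27"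
  using l by (simp add: A_def card_annihilator line_family_def)

lemma zero_A [simp]: "0 \<in> A i"
  by (simp add: vec.subspace_0)

lemma uminus_A [simp]: "- v \<in> A i \<longleftrightarrow> v \<in> A i"
  by (rule subspace_uminus) simp

lemma card_A_mem: "v \<noteq> 0 \<Longrightarrow> card {i. i < 13 \<and> v \<in> A i} \<le> 2"
  using l by (simp add: A_def annihilator_def line_family_def)

text \<open>A nonzero \<open>v\<close> in \<open>A i\<close> is a normal of a hyperplane through
  \<open>l i\<close>, and a hyperplane contains at most two of the lines.\<close>

lemma A_triple:
  assumes "v \<in> A i" "v \<in> A j" "v \<in> A k" "i < 13" "j < 13" "k < 13" "i \<noteq> j" "i \<noteq> k" "j \<noteq> k"
  shows "v = 0"
proof (rule ccontr)
  assume "v \<noteq> 0"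
  then have "card {i. i < 13 \<and> v \<in> A i} \<le> 2" by (rule card_A_mem)
  moreover have "card {i, j, k} \<le> card {i. i < 13 \<and> v \<in> A i}"
    using assms by (intro card_mono) auto
  ultimately show False using assms by simp
qed

lemma A_inter_ge:
  assumes "i < 13" "j < 13"
  obtains v where "v \<noteq> 0" "v \<in> A i" "v \<in> A j"
proof -
  have "card (UNIV :: ('q ^ 5) set) < card (A i) * card (A j)"
    using assms by (simp add: card_A card_q)
  then show thesis
    using that pigeonhole_subspaces[of "A i" "A j" UNIV] by (metis subspace_A subset_UNIV vec.subspace_UNIV)
qed

definition tangents :: "nat \<Rightarrow> ('q ^ 5) set" where
  "tangents i = {v \<in> A i. v \<noteq> 0 \<and> (\<forall>j<13. j \<noteq> i \<longrightarrow> v \<notin> A j)}"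

lemma card_inter_power:
  assumes "i < 13" "j < 13"
  shows "card (A i \<inter> A j) = 3 \<or> 9 \<le> card (A i \<inter> A j)"
proof -
  obtain v where v: "v \<noteq> 0" "v \<in> A i" "v \<in> A j" by (rule A_inter_ge[OF assms])
  have c: "card (A i \<inter> A j) = 3 ^ vec.dim (A i \<inter> A j)"
    by (intro card_subspace vec.subspace_inter subspace_A)
  have "card {0, v} \<le> card (A i \<inter> A j)" using v by (intro card_mono) auto
  then have "2 \<le> card (A i \<inter> A j)" using v(1) by simp
  then have "1 < (3::nat) ^ vec.dim (A i \<inter> A j)" unfolding c by linarith
  then have "vec.dim (A i \<inter> A j) \<noteq> 0" by (intro notI) simp
  then have "vec.dim (A i \<inter> A j) = 1 \<or> 2 \<le> vec.dim (A i \<inter> A j)" by linarith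
  moreover have "(3::nat) ^ 2 \<le> 3 ^ vec.dim (A i \<inter> A j)" if "2 \<le> vec.dim (A i \<inter> A j)"
    using that by (intro power_increasing) auto
  ultimately show ?thesis using c by auto
qed

text \<open>Each of the other twelve takes at least 2 of the 26 nonzero vectors of
  \<open>A i\<close>, and no vector is taken twice. One that takes 8 would bring the sum to 30, so
  all take exactly 2, and 2 vectors remain.\<close>

lemma tangents_and_inter:
  assumes i: "i < 13"
  shows "card (tangents i) = 2" and "\<And>j. j < 13 \<Longrightarrow> j \<noteq> i \<Longrightarrow> card (A i \<inter> A j) = 3"
proof -
  let ?J = "{..<13} - {i}"
  let ?f = "\<lambda>j. card (A i \<inter> A j - {0})"
  have f: "?f j = card (A i \<inter> A j) - 1" for j by (simp add: card_Diff_singleton)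
  have "A i - {0} = tangents i \<union> (\<Union>j\<in>?J. A i \<inter> A j - {0})"
    by (auto simp: tangents_def)
  moreover have "tangents i \<inter> (\<Union>j\<in>?J. A i \<inter> A j - {0}) = {}"
    by (auto simp: tangents_def)
  ultimately have "card (A i - {0}) = card (tangents i) + card (\<Union>j\<in>?J. A i \<inter> A j - {0})"
    by (simp add: card_Un_disjoint)
  also have "card (\<Union>j\<in>?J. A i \<inter> A j - {0}) = sum ?f ?J"
  proof (rule card_UN_disjoint)
    show "\<forall>j\<in>?J. \<forall>k\<in>?J. j \<noteq> k \<longrightarrow> (A i \<inter> A j - {0}) \<inter> (A i \<inter> A k - {0}) = {}"
      using A_triple[of _ i] i by fastforce
  qed auto
  finally have eq: "26 = card (tangents i) + sum ?f ?J"
    using card_A[OF i] by (simp add: card_Diff_singleton)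
  have fcases: "?f j = 2 \<or> 8 \<le> ?f j" if "j \<in> ?J" for j
    using card_inter_power[OF i, of j] that f[of j] by auto
  have ge2: "2 \<le> ?f j" if "j \<in> ?J" for j
    using fcases[OF that] by linarith
  have all2: "?f j = 2" if j: "j \<in> ?J" for j
  proof (rule ccontr)
    assume "?f j \<noteq> 2"
    then have "8 \<le> ?f j" using fcases[OF j] by linarith
    moreover have "sum ?f ?J = ?f j + sum ?f (?J - {j})"
      using j by (intro sum.remove) auto
    moreover have "(\<Sum>k\<in>?J - {j}. 2) \<le> sum ?f (?J - {j})"
      using ge2 by (intro sum_mono) simp
    moreover have "card (?J - {j}) = 11" using i j by (simp add: card_Diff_subset)
    ultimately show False using eq by simp
  qed
  have "sum ?f ?J = (\<Sum>j\<in>?J. 2)" using all2 by (rule sum.cong[OF refl])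
  also have "\<dots> = 24" using i by (simp add: card_Diff_subset)
  finally show "card (tangents i) = 2" using eq by simp
  fix j assume "j < 13" "j \<noteq> i"
  then have "?f j = 2" using all2 by simp
  moreover have "0 < card (A i \<inter> A j)" by (metis IntI card_gt_0_iff empty_iff finite zero_A)
  ultimately show "card (A i \<inter> A j) = 3" using f[of j] by linarith
qed

lemma A_inter_eq:
  assumes "i < 13" "j < 13" "i \<noteq> j" "v \<in> A i" "v \<in> A j" "v \<noteq> 0"
  shows "A i \<inter> A j = {0, v, - v}"
proof -
  have "card {0, v, - v} = 3" using assms(6) neq_uminus[of v] by simp
  moreover have "{0, v, - v} \<subseteq> A i \<inter> A j" using assms by simp
  ultimately show ?thesis
    using tangents_and_inter(2)[of i j] assms by (intro card_subset_eq[symmetric]) auto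
qed

text \<open>For \<open>v\<close> outside \<open>A 0\<close> this is the number of affine lines
  through \<open>v\<close> in its coset of \<open>A 0\<close>.\<close>

definition c :: "'q ^ 5 \<Rightarrow> nat" where
  "c v = card {j \<in> {1..<13}. v \<in> A j}"

lemma c_le_2: "v \<noteq> 0 \<Longrightarrow> c v \<le> 2"
proof -
  assume "v \<noteq> 0"
  have "c v \<le> card {i. i < 13 \<and> v \<in> A i}" unfolding c_def by (intro card_mono) auto
  then show ?thesis using card_A_mem[OF \<open>v \<noteq> 0\<close>] by simp
qed

lemma c_uminus: "c (- v) = c v"
  by (simp add: c_def)

lemma c_eq_1:
  assumes "c v = 1"
  obtains j where "1 \<le> j" "j < 13" "v \<in> A j" "\<forall>k. 1 \<le> k \<longrightarrow> k < 13 \<longrightarrow> v \<in> A k \<longrightarrow> k = j"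
proof -
  obtain j where j: "{j \<in> {1..<13}. v \<in> A j} = {j}"
    using assms unfolding c_def by (rule card_1_singletonE)
  have "j \<in> {j \<in> {1..<13}. v \<in> A j}" unfolding j by simp
  moreover have "k = j" if "1 \<le> k" "k < 13" "v \<in> A k" for k
  proof -
    have "k \<in> {j \<in> {1..<13}. v \<in> A j}" using that by simp
    then show ?thesis unfolding j by simp
  qed
  ultimately show thesis using that[of j] by auto
qed

lemma c_ge_2:
  assumes "v \<in> A j" "1 \<le> j" "j < 13" "c v \<noteq> 1"
  obtains k where "1 \<le> k" "k < 13" "k \<noteq> j" "v \<in> A k"
proof -
  have "\<exists>k. 1 \<le> k \<and> k < 13 \<and> k \<noteq> j \<and> v \<in> A k"
  proof (rule ccontr)
    assume n: "\<not> ?thesis"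
    have "{j \<in> {1..<13}. v \<in> A j} = {j}" using n assms by auto
    then have "c v = 1" unfolding c_def by simp
    then show False using assms(4) by simp
  qed
  then show thesis using that by blast
qed

definition singles_of :: "'q ^ 5 \<Rightarrow> ('q ^ 5) set" where
  "singles_of x = {v \<in> ker x - A 0. c v = 1}"

lemma tangents_iff: "1 \<le> j \<Longrightarrow> j < 13 \<Longrightarrow> v \<in> tangents j \<longleftrightarrow> v \<in> A j \<and> v \<notin> A 0 \<and> c v = 1"
proof
  assume j: "1 \<le> j" "j < 13" and v: "v \<in> tangents j"
  then have "{k \<in> {1..<13}. v \<in> A k} = {j}" by (auto simp: tangents_def)
  then show "v \<in> A j \<and> v \<notin> A 0 \<and> c v = 1" using v j by (auto simp: tangents_def c_def)
next
  assume j: "1 \<le> j" "j < 13" and v: "v \<in> A j \<and> v \<notin> A 0 \<and> c v = 1"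
  then have "c v = 1" by simp
  then obtain i where "1 \<le> i" "i < 13" "v \<in> A i" and i: "\<forall>k. 1 \<le> k \<longrightarrow> k < 13 \<longrightarrow> v \<in> A k \<longrightarrow> k = i"
    by (rule c_eq_1)
  have "v \<notin> A k" if "k < 13" "k \<noteq> j" for k
    using i[rule_format, of j] i[rule_format, of k] j v that by (cases "k = 0") auto
  moreover have "v \<noteq> 0" using v zero_A by metis
  ultimately show "v \<in> tangents j" using v by (simp add: tangents_def)
qed

text \<open>The vectors outside \<open>A 0\<close> on exactly one other \<open>A j\<close> are the
  tangents of the twelve, so there are 24. None of them annihilates \<open>l 0\<close>, so each lies
  in \<open>ker x\<close> for exactly two nonzero \<open>x\<close> in \<open>l 0\<close>.\<close>

lemma choose_x:
  obtains x where "x \<in> l 0" "x \<noteq> 0" "card (singles_of x) \<le> 6"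
proof -
  let ?S = "{v \<in> - A 0. c v = 1}"
  have "?S = (\<Union>j\<in>{1..<13}. tangents j)"
  proof (rule set_eqI)
    fix v
    show "v \<in> ?S \<longleftrightarrow> v \<in> (\<Union>j\<in>{1..<13}. tangents j)"
    proof
      assume v: "v \<in> ?S"
      then have "c v = 1" by simp
      then obtain j where "1 \<le> j" "j < 13" "v \<in> A j" by (rule c_eq_1)
      then show "v \<in> (\<Union>j\<in>{1..<13}. tangents j)" using v tangents_iff[of j v] by auto
    next
      assume "v \<in> (\<Union>j\<in>{1..<13}. tangents j)"
      then show "v \<in> ?S" using tangents_iff by auto
    qed
  qed
  moreover have "card (\<Union>j\<in>{1..<13}. tangents j) = (\<Sum>j\<in>{1..<13}. card (tangents j))"
  proof (rule card_UN_disjoint)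
    show "\<forall>j\<in>{1..<13}. \<forall>k\<in>{1..<13}. j \<noteq> k \<longrightarrow> tangents j \<inter> tangents k = {}"
      by (auto simp: tangents_def)
  qed auto
  ultimately have S: "card ?S = 24" using tangents_and_inter(1) by simp
  have l0: "vec.subspace (l 0)" "card (l 0) = 9" using l by (auto simp: line_family_def)
  let ?R = "\<lambda>x v. v \<in> ker x"
  have "(\<Sum>x\<in>l 0 - {0}. card {v \<in> ?S. ?R x v}) = (\<Sum>v\<in>?S. card {x \<in> l 0 - {0}. ?R x v})"
    by (rule sum_multicount_gen) auto
  also have "\<dots> = (\<Sum>v\<in>?S. 2)"
  proof (rule sum.cong)
    fix v assume "v \<in> ?S"
    then have "\<not> l 0 \<subseteq> ker v" by (simp add: A_def annihilator_def)
    then have "card (l 0 \<inter> ker v) = 3" using card_inter_ker[OF l0(1), of v] l0(2) by simp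
    moreover have "{x \<in> l 0 - {0}. ?R x v} = l 0 \<inter> ker v - {0}"
      by (auto simp: mem_ker dot_commute)
    moreover have "0 \<in> l 0 \<inter> ker v" using l0 by (simp add: mem_ker vec.subspace_0)
    ultimately show "card {x \<in> l 0 - {0}. ?R x v} = 2" by (simp add: card_Diff_singleton)
  qed simp
  finally have 48: "(\<Sum>x\<in>l 0 - {0}. card {v \<in> ?S. ?R x v}) = 48" using S by simp
  have "\<exists>x \<in> l 0 - {0}. card {v \<in> ?S. ?R x v} \<le> 6"
  proof (rule ccontr)
    assume n: "\<not> ?thesis"
    have "7 \<le> card {v \<in> ?S. ?R x v}" if "x \<in> l 0 - {0}" for x
    proof -
      have "\<not> card {v \<in> ?S. ?R x v} \<le> 6" using n that by (metis (no_types, lifting))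
      then show ?thesis by linarith
    qed
    then have "(\<Sum>x\<in>l 0 - {0}. 7) \<le> (\<Sum>x\<in>l 0 - {0}. card {v \<in> ?S. ?R x v})"
      by (intro sum_mono)
    moreover have "card (l 0 - {0}) = 8" using l0 by (simp add: card_Diff_singleton vec.subspace_0)
    ultimately show False using 48 by simp
  qed
  then obtain x where "x \<in> l 0 - {0}" "card {v \<in> ?S. ?R x v} \<le> 6" by (rule bexE)
  moreover have "{v \<in> ?S. ?R x v} = singles_of x" for x by (auto simp: singles_of_def)
  ultimately show thesis using that[of x] by simp
qed

end

text \<open>
  Over the eight nonzero \<open>x \<in> l 0\<close>, the sets \<open>singles_of x\<close> have 48 elements in total, whence the bound 6.
\<close>

locale thirteen_lines_point = thirteen_lines ty l for ty :: "'q::{field,finite} itself" and l +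
  fixes x :: "'q ^ 5"
  assumes x: "x \<in> l 0" "x \<noteq> 0" and few: "card (singles_of x) \<le> 6"
begin

abbreviation X where "X \<equiv> ker x"

lemma card_X: "card X = 81"
  using card_ker[OF x(2)] by simp

lemma A0_X: "A 0 \<subseteq> X"
  using x(1) by (auto simp: A_def annihilator_def mem_ker dot_commute)

lemma A_not_X:
  assumes j: "1 \<le> j" "j < 13"
  shows "\<not> A j \<subseteq> X"
proof
  assume sub: "A j \<subseteq> X"
  obtain p where p: "p \<noteq> 0" "p \<in> A 0" "p \<in> A j" using A_inter_ge[of 0 j] j by auto
  \<comment> \<open>Cut \<open>A 0\<close> by a coordinate hyperplane that misses the common vector
    \<open>p\<close>. As 9 * 27 > 81, what remains would still meet \<open>A j\<close> inside
    \<open>X\<close>, but \<open>A 0 \<inter> A j\<close> contains only multiples of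
    \<open>p\<close>.\<close>
  obtain i where "p $ i \<noteq> 0" using p(1) by (auto simp: vec_eq_iff)
  then have pn: "p \<notin> ker (axis i 1)" by (simp add: mem_ker dot_commute[of "axis i 1"] dot_axis)
  then have "\<not> A 0 \<subseteq> ker (axis i 1)" using p(2) by auto
  then have "card (A 0 \<inter> ker (axis i 1)) = 9" using card_inter_ker[of "A 0"] card_A[of 0] by simp
  then have cc: "card X < card (A 0 \<inter> ker (axis i 1)) * card (A j)"
    using card_A[OF j(2)] by (simp add: card_X)
  have in_X: "A 0 \<inter> ker (axis i 1) \<subseteq> X" using A0_X by auto
  obtain v where v: "v \<noteq> 0" "v \<in> A 0 \<inter> ker (axis i 1)" "v \<in> A j"
    by (rule pigeonhole_subspaces[OF vec.subspace_inter[OF subspace_A subspace_ker] subspace_A subspace_ker in_X sub cc])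
  have "A 0 \<inter> A j = {0, p, - p}" using A_inter_eq[of 0 j p] j p by simp
  then have "v = p \<or> v = - p" using v by auto
  then show False using v(2) pn by (auto simp: subspace_uminus[OF subspace_ker])
qed

lemma card_A_inter_X: "1 \<le> j \<Longrightarrow> j < 13 \<Longrightarrow> card (A j \<inter> X) = 9"
  using card_inter_ker[OF subspace_A, of j x] A_not_X[of j] card_A[of j] by simp

lemma card_A_X_minus:
  assumes j: "1 \<le> j" "j < 13"
  shows "card (A j \<inter> (X - A 0)) = 6"
proof -
  have "A j \<inter> (X - A 0) = A j \<inter> X - A 0 \<inter> A j" by auto
  moreover have "card (A 0 \<inter> A j) = 3" using tangents_and_inter(2)[of 0 j] j by simp
  ultimately show ?thesis
    using card_A_inter_X[OF j] A0_X by (simp add: card_Diff_subset le_infI1 le_infI2)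
qed

lemma sum_c: "(\<Sum>v\<in>P. c v) = (\<Sum>j\<in>{1..<13}. card (A j \<inter> P))" for P :: "('q ^ 5) set"
proof -
  have "(\<Sum>v\<in>P. card {j \<in> {1..<13}. v \<in> A j}) = (\<Sum>j\<in>{1..<13}. card {v \<in> P. v \<in> A j})"
    by (rule sum_multicount_gen) auto
  moreover have "{v \<in> P. v \<in> A j} = A j \<inter> P" for j by auto
  ultimately show ?thesis by (simp add: c_def)
qed

text \<open>Each of the twelve \<open>A j\<close> has 6 vectors in \<open>X - A 0\<close>, so
  \<open>72 = 2 d + s\<close>. As \<open>v\<close> and \<open>- v\<close> behave alike,
  \<open>d\<close> is even; hence 4 divides \<open>s\<close>, and \<open>s \<le> 6\<close>.\<close>

lemma card_singles: "card (singles_of x) = 0 \<or> card (singles_of x) = 4"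
proof -
  have nz: "v \<noteq> 0" if "v \<in> X - A 0" for v using that zero_A[of 0] by auto
  let ?D = "{v \<in> X - A 0. c v = 2}"
  have "(\<Sum>v\<in>X - A 0. c v) = 72"
    using card_A_X_minus by (simp add: sum_c)
  then have sum: "72 = 2 * card ?D + card (singles_of x)"
    using sum_le_2[of "X - A 0" c] c_le_2 nz by (simp add: singles_of_def)
  have even: "even (card ?D)"
  proof (rule even_card_symmetric)
    show "- v \<in> ?D \<and> v \<noteq> - v" if "v \<in> ?D" for v
      using that nz[of v] neq_uminus[of v] by (simp add: c_uminus subspace_uminus[OF subspace_ker])
  qed simp
  have arith: "s = 0 \<or> s = 4" if "72 = 2 * d + s" "even d" "s \<le> 6" for d s :: nat
    using that by presburger
  show ?thesis by (rule arith[OF sum even few])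
qed

end

section \<open>A suitable origin for the first coset and a basis of \<open>A 0\<close>\<close>

context thirteen_lines_point
begin

lemma obtain_tangent:
  obtains t where "t \<in> A 0" "t \<noteq> 0" "\<forall>j. 1 \<le> j \<longrightarrow> j < 13 \<longrightarrow> t \<notin> A j" "tangents 0 = {t, - t}"
proof -
  have c2: "card (tangents 0) = 2" using tangents_and_inter(1)[of 0] by simp
  then have "tangents 0 \<noteq> {}" by (intro notI) simp
  then obtain t where t: "t \<in> tangents 0" by (metis ex_in_conv)
  then have t': "t \<in> A 0" "t \<noteq> 0" "\<forall>j. 1 \<le> j \<longrightarrow> j < 13 \<longrightarrow> t \<notin> A j"
    by (auto simp: tangents_def)
  have "{t, - t} \<subseteq> tangents 0" using t by (simp add: tangents_def)
  moreover have "card {t, - t} = 2" using neq_uminus[OF t'(2)] by simp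
  ultimately have "{t, - t} = tangents 0" using c2 by (intro card_subset_eq) auto
  then show thesis using that t' by simp
qed

lemma A_cover:
  assumes "v \<in> A 0" "v \<notin> tangents 0" "v \<noteq> 0"
  shows "\<exists>j. 1 \<le> j \<and> j < 13 \<and> v \<in> A j"
proof -
  have "\<exists>j<13. j \<noteq> 0 \<and> v \<in> A j" using assms by (auto simp: tangents_def)
  then show ?thesis by (metis less_one not_le)
qed

lemma A_unique:
  assumes "v \<in> A 0" "v \<noteq> 0" "1 \<le> j" "j < 13" "v \<in> A j" "1 \<le> k" "k < 13" "v \<in> A k"
  shows "j = k"
proof (rule ccontr)
  assume "j \<noteq> k"
  then have "v = 0" using assms by (intro A_triple[of v 0 j k]) auto
  then show False using assms(2) by simp
qed

text \<open>\<open>h1\<close> is a common point of two affine lines with directions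
  \<open>h3\<close> and \<open>h4\<close>, and \<open>t\<close> is meant to be the missing
  direction. The last two conditions then say that \<open>h4\<close> is not in the plane of
  \<open>h3\<close> and \<open>t\<close>, so the three form a basis of \<open>A 0\<close>.\<close>

definition nondegenerate :: "'q ^ 5 \<Rightarrow> nat \<Rightarrow> nat \<Rightarrow> 'q ^ 5 \<Rightarrow> 'q ^ 5 \<Rightarrow> 'q ^ 5 \<Rightarrow> bool" where
  "nondegenerate t j k h1 h3 h4 \<longleftrightarrow> 1 \<le> j \<and> j < 13 \<and> 1 \<le> k \<and> k < 13 \<and> j \<noteq> k \<and>
     h1 \<in> A j \<and> h1 \<in> A k \<and> h1 \<in> X \<and> h1 \<notin> A 0 \<and> h3 \<in> A 0 \<and> h3 \<in> A j \<and> h3 \<noteq> 0 \<and>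
     h4 \<in> A 0 \<and> h4 \<in> A k \<and> h4 \<noteq> 0 \<and> h3 + t \<notin> A k \<and> h3 - t \<notin> A k"

lemma nondegenerate_of_partner:
  assumes j: "1 \<le> j" "j < 13" and r: "r \<in> A j" "r \<in> X" "r \<notin> A 0" "c r \<noteq> 1"
    and h: "h \<in> A 0" "h \<in> A j" "h \<noteq> 0"
    and n: "\<And>k. 1 \<le> k \<Longrightarrow> k < 13 \<Longrightarrow> k \<noteq> j \<Longrightarrow> r \<in> A k \<Longrightarrow> h + t \<notin> A k \<and> h - t \<notin> A k"
  shows "\<exists>k h4. nondegenerate t j k r h h4"
proof -
  obtain k where k: "1 \<le> k" "k < 13" "k \<noteq> j" "r \<in> A k"
    using c_ge_2[OF r(1) j r(4)] by metis
  obtain h4 where "h4 \<noteq> 0" "h4 \<in> A 0" "h4 \<in> A k"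
    using A_inter_ge[of 0 k] k(2) by (metis zero_less_numeral)
  then have "nondegenerate t j k r h h4"
    using j r h k n[OF k] by (simp add: nondegenerate_def)
  then show ?thesis by metis
qed

lemma add_mem_A: "u \<in> A j \<Longrightarrow> v \<in> A j \<Longrightarrow> u + v \<in> A j"
  by (simp add: vec.subspace_add)

lemma diff_mem_A: "u \<in> A j \<Longrightarrow> v \<in> A j \<Longrightarrow> u - v \<in> A j"
  by (simp add: vec.subspace_diff)

lemma shift_mem:
  assumes "r \<in> A j" "r \<in> X" "r \<notin> A 0" "h \<in> A 0" "h \<in> A j"
  shows "r + h \<in> A j" "r + h \<in> X" "r + h \<notin> A 0" "r - h \<in> A j" "r - h \<in> X" "r - h \<notin> A 0"
proof -
  have "h \<in> X" using assms(4) A0_X by auto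
  then show "r + h \<in> A j" "r + h \<in> X" "r - h \<in> A j" "r - h \<in> X"
    using assms by (simp_all add: add_mem_A diff_mem_A mem_ker)
  show "r + h \<notin> A 0" using assms(3,4) diff_mem_A[of "r + h" 0 h] by auto
  show "r - h \<notin> A 0" using assms(3,4) add_mem_A[of "r - h" 0 h] by auto
qed

text \<open>The difference \<open>h\<close> would lie in \<open>A 0\<close>, \<open>A j\<close> and
  \<open>A k\<close>. So different points on a line of \<open>A j\<close> have different partners
  \<open>k\<close>.\<close>

lemma partner_unique:
  assumes "1 \<le> j" "j < 13" "1 \<le> k" "k < 13" "k \<noteq> j" "h \<in> A 0" "h \<in> A j" "h \<noteq> 0" "u \<in> A k" "u + h \<in> A k"
  shows False
proof -
  have "h \<in> A k" using diff_mem_A[OF assms(10,9)] by simp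
  then show False using A_unique[of h j k] assms by simp
qed

lemma tangent_shift:
  assumes t: "t \<in> A 0" "\<forall>j. 1 \<le> j \<longrightarrow> j < 13 \<longrightarrow> t \<notin> A j" and j: "1 \<le> j" "j < 13" and h: "h \<in> A j" "h \<in> A 0"
  shows "h + t \<in> A 0" "h - t \<in> A 0" "h + t \<notin> A j" "h - t \<notin> A j" "h + t \<noteq> 0" "h - t \<noteq> 0"
proof -
  show "h + t \<in> A 0" "h - t \<in> A 0" using h(2) t(1) by (simp_all add: add_mem_A diff_mem_A)
  show *: "h + t \<notin> A j" using diff_mem_A[of "h + t" j h] h(1) t(2) j by auto
  show **: "h - t \<notin> A j" using diff_mem_A[of h j "h - t"] h(1) t(2) j by auto
  show "h + t \<noteq> 0" "h - t \<noteq> 0" using * ** zero_A[of j] by auto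
qed

lemma double_not_self: "u + u = - u" for u :: "'q ^ 5"
  using triple_zero[of u] by (simp add: eq_neg_iff_add_eq_0)

text \<open>The points \<open>r\<close>, \<open>r + h\<close>, \<open>r - h\<close> on a line of
  \<open>A 1\<close> have pairwise different partners. If all choices were degenerate, each partner
  would contain \<open>h + t\<close> or \<open>h - t\<close>; but each of these two vectors lies in
  only one \<open>A k\<close>.\<close>

lemma nondegenerate_if_no_singles:
  assumes s: "singles_of x = {}" and t: "t \<in> A 0" "\<forall>j. 1 \<le> j \<longrightarrow> j < 13 \<longrightarrow> t \<notin> A j"
  shows "\<exists>j k h1 h3 h4. nondegenerate t j k h1 h3 h4"
proof (rule ccontr)
  assume no: "\<not> ?thesis"
  obtain h where h: "h \<noteq> 0" "h \<in> A 0" "h \<in> A 1" using A_inter_ge[of 0 1] by auto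
  have "A 1 \<inter> (X - A 0) \<noteq> {}" using card_A_X_minus[of 1] by (intro notI) simp
  then obtain r where r: "r \<in> A 1" "r \<in> X" "r \<notin> A 0" by auto
  note rh = shift_mem[OF r h(2,3)]
  have c1: "c u \<noteq> 1" if "u \<in> X" "u \<notin> A 0" for u
    using s that by (auto simp: singles_of_def)
  have bad: "\<exists>k. 1 \<le> k \<and> k < 13 \<and> k \<noteq> 1 \<and> u \<in> A k \<and> (h + t \<in> A k \<or> h - t \<in> A k)"
    if u: "u \<in> A 1" "u \<in> X" "u \<notin> A 0" for u
  proof (rule ccontr)
    assume n: "\<not> ?thesis"
    have "\<exists>k h4. nondegenerate t 1 k u h h4"
    proof (rule nondegenerate_of_partner[OF _ _ u c1[OF u(2,3)] h(2,3,1)])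
      show "h + t \<notin> A k \<and> h - t \<notin> A k" if "1 \<le> k" "k < 13" "k \<noteq> 1" "u \<in> A k" for k
        using n that by metis
    qed simp_all
    then show False using no by metis
  qed
  obtain k1 where k1: "1 \<le> k1" "k1 < 13" "k1 \<noteq> 1" "r \<in> A k1" "h + t \<in> A k1 \<or> h - t \<in> A k1"
    using bad[OF r] by auto
  obtain k2 where k2: "1 \<le> k2" "k2 < 13" "k2 \<noteq> 1" "r + h \<in> A k2" "h + t \<in> A k2 \<or> h - t \<in> A k2"
    using bad[OF rh(1-3)] by auto
  obtain k3 where k3: "1 \<le> k3" "k3 < 13" "k3 \<noteq> 1" "r - h \<in> A k3" "h + t \<in> A k3 \<or> h - t \<in> A k3"
    using bad[OF rh(4-6)] by auto
  have "k1 \<noteq> k2" using partner_unique[of 1 k1 h r] k1 k2 h by auto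
  moreover have "k1 \<noteq> k3" using partner_unique[of 1 k3 h "r - h"] k1 k3 h by auto
  moreover have "k2 \<noteq> k3"
  proof
    assume "k2 = k3"
    moreover have "r - h + - h = r + - (h + h)" by simp
    ultimately have "r - h \<in> A k2" "r - h + - h \<in> A k2"
      using k2(4) k3(4) by (simp_all only: double_not_self minus_minus)
    then show False using partner_unique[of 1 k2 "- h" "r - h"] k2 h by auto
  qed
  moreover have "h + t \<in> A 0" "h - t \<in> A 0" "h + t \<noteq> 0" "h - t \<noteq> 0"
    using tangent_shift[OF t _ _ h(3,2)] by simp_all
  ultimately show False
    using A_unique[of "h + t" k1 k2] A_unique[of "h + t" k1 k3] A_unique[of "h + t" k2 k3]
      A_unique[of "h - t" k1 k2] A_unique[of "h - t" k1 k3] A_unique[of "h - t" k2 k3]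
      k1 k2 k3 by metis
qed

text \<open>If every choice fails, the other points \<open>p + h\<close> and \<open>p - h\<close> on
  the line through a single \<open>p\<close> are singles or lie on one of the two,
  \<open>A a\<close> and \<open>A b\<close>, that contain \<open>h + t\<close> and
  \<open>h - t\<close>. Incidences in the affine plane \<open>P\<close> through \<open>p\<close>
  decide: 3 from \<open>A j\<close>, 0 or 3 from each of \<open>A a\<close> and \<open>A b\<close>,
  and 1 from each of the nine others, against 9 points of which one or two are singles.\<close>

lemma nondegenerate_if_singles:
  assumes s: "card (singles_of x) = 4"
    and t: "t \<in> A 0" "\<forall>j. 1 \<le> j \<longrightarrow> j < 13 \<longrightarrow> t \<notin> A j" "t \<noteq> 0" "tangents 0 = {t, - t}"
  shows "\<exists>j k h1 h3 h4. nondegenerate t j k h1 h3 h4 \<and> c (h1 + h3) = 1"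
proof (rule ccontr)
  assume no: "\<not> ?thesis"
  have "singles_of x \<noteq> {}" using s by (intro notI) simp
  then obtain p where p: "p \<in> X" "p \<notin> A 0" "c p = 1" by (auto simp: singles_of_def)
  obtain j where j: "1 \<le> j" "j < 13" "p \<in> A j" "\<forall>k. 1 \<le> k \<longrightarrow> k < 13 \<longrightarrow> p \<in> A k \<longrightarrow> k = j"
    using p(3) by (rule c_eq_1)
  have "(0::nat) < 13" by simp
  then obtain h where h: "h \<noteq> 0" "h \<in> A 0" "h \<in> A j" by (rule A_inter_ge[OF _ j(2)])
  note ts = tangent_shift[OF t(1,2) j(1,2) h(3,2)]
  note ph = shift_mem[OF j(3) p(1,2) h(2,3)]
  have ne: "h + t \<notin> tangents 0" "h - t \<notin> tangents 0"
  proof -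
    have tj: "t \<notin> A j" using t(2) j(1,2) by simp
    have "h \<noteq> t" "h \<noteq> - t" using tj h(3) by (auto simp only: uminus_A)
    have 1: "h + t \<noteq> t" using h(1) by simp
    have 2: "h - t \<noteq> - t" using h(1) by simp
    have 3: "h + t \<noteq> - t"
    proof
      assume "h + t = - t"
      then have "h = - t - t" by (simp only: eq_diff_eq)
      then have "h = t" using double_not_self[of "- t"] by simp
      then show False using tj h(3) by simp
    qed
    have 4: "h - t \<noteq> t"
    proof
      assume "h - t = t"
      then have "h = t + t" by (simp only: diff_eq_eq)
      then have "h = - t" by (simp only: double_not_self)
      then show False using tj h(3) by simp
    qed
    note 1 2 3 4
    then show "h + t \<notin> tangents 0" "h - t \<notin> tangents 0" by (simp_all add: t(4))
  qed
  obtain a where a: "1 \<le> a" "a < 13" "h + t \<in> A a" using A_cover[OF ts(1) ne(1) ts(5)] by auto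
  obtain b where b: "1 \<le> b" "b < 13" "h - t \<in> A b" using A_cover[OF ts(2) ne(2) ts(6)] by auto
  have aj: "a \<noteq> j" using a(3) ts(3) by auto
  have bj: "b \<noteq> j" using b(3) ts(4) by auto
  have ab: "a \<noteq> b"
  proof
    assume "a = b"
    then have "(h + t) + (h - t) \<in> A a" using add_mem_A[OF a(3), of "h - t"] b(3) by simp
    moreover have "(h + t) + (h - t) = h + h" by simp
    ultimately have "- h \<in> A a" by (simp only: double_not_self)
    then have "h \<in> A a" by simp
    with A_unique[OF h(2,1) j(1,2) h(3) a(1,2)] have "j = a" by simp
    then show False using aj by simp
  qed
  \<comment> \<open>The conclusion wants the single in the form \<open>h1 + h3\<close>; the roles of
    \<open>h1\<close> and \<open>h3\<close> are played by \<open>r = p - g\<close> and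
    \<open>g\<close>.\<close>
  have bad: "\<exists>k \<in> {a, b}. r \<in> A k"
    if r: "r \<in> A j" "r \<in> X" "r \<notin> A 0" "c r \<noteq> 1" and g: "g = h \<or> g = - h" "p = r + g" for r g
  proof (rule ccontr)
    assume n: "\<not> ?thesis"
    have "\<exists>k h4. nondegenerate t j k r g h4"
    proof (rule nondegenerate_of_partner[OF j(1,2) r])
      show "g \<in> A 0" "g \<in> A j" "g \<noteq> 0" using g h by auto
      fix k assume k: "1 \<le> k" "k < 13" "k \<noteq> j" "r \<in> A k"
      have "k \<noteq> a" "k \<noteq> b" using n k(4) by auto
      then have "h + t \<notin> A k" "h - t \<notin> A k"
        using A_unique[OF ts(1,5) k(1,2) _ a] A_unique[OF ts(2,6) k(1,2) _ b] by auto
      moreover have "- h + t \<in> A k \<longleftrightarrow> h - t \<in> A k" "- h - t \<in> A k \<longleftrightarrow> h + t \<in> A k"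
        using uminus_A[of "h - t" k] uminus_A[of "h + t" k] by (simp_all add: algebra_simps)
      ultimately show "g + t \<notin> A k \<and> g - t \<notin> A k" using g(1) by auto
    qed
    then show False using no p(3) g(2) by metis
  qed
  define U where "U = vec.span (insert h {0})"
  define E where "E = vec.span (insert t U)"
  have sU: "vec.subspace U" and sE: "vec.subspace E" unfolding U_def E_def by (rule vec.subspace_span)+
  have cU: "card U = 3" unfolding U_def using card_span_insert[of "{0}" h] h(1) by simp
  have U_sub: "U \<subseteq> A j" unfolding U_def using h by (intro vec.span_minimal) auto
  then have tU: "t \<notin> U" using t(2) j(1,2) by auto
  have cE: "card E = 9" unfolding E_def using card_span_insert[OF sU tU] cU by simp
  have hU: "h \<in> U" unfolding U_def by (intro vec.span_base) simp
  then have E_in: "h \<in> E" "t \<in> E" unfolding E_def by (auto intro!: vec.span_base)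
  have E_A0: "E \<subseteq> A 0"
  proof -
    have "U \<subseteq> A 0" unfolding U_def using h by (intro vec.span_minimal) auto
    then show ?thesis unfolding E_def using t(1) by (intro vec.span_minimal) auto
  qed
  have E_cases: "v = 0 \<or> v = h \<or> v = - h \<or> v = t \<or> v = - t \<or> v = h + t \<or> v = - (h + t) \<or> v = h - t \<or> v = - (h - t)"
    if "v \<in> E" for v
  proof -
    have sp: "vec.span U = U" using sU by (simp only: vec.span_eq_iff)
    have "\<exists>k. v - k *s t \<in> U" using \<open>v \<in> E\<close> unfolding E_def by (simp only: vec.span_breakdown_eq sp)
    then obtain k where "v - k *s t \<in> U" by auto
    then obtain m where "v - k *s t - m *s h \<in> vec.span {0}" unfolding U_def by (auto simp: vec.span_breakdown_eq)
    then have "v = m *s h + k *s t" by (simp add: algebra_simps)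
    then show ?thesis using cases_q[of m] cases_q[of k] by auto
  qed
  define P where "P = (\<lambda>e. p + e) ` E"
  have cP: "card P = 9" unfolding P_def using cE by (subst card_image) auto
  have P_X: "v \<in> X" "v \<notin> A 0" if vP: "v \<in> P" for v
  proof -
    obtain e where e: "v = p + e" "e \<in> E" using vP unfolding P_def by auto
    have "e \<in> A 0" "e \<in> X" using e(2) E_A0 A0_X by auto
    then show "v \<in> X" "v \<notin> A 0" using e(1) p diff_mem_A[of v 0 e] by (auto simp: mem_ker)
  qed
  have card_P: "card (A i \<inter> P) = card (A i \<inter> E)" if u: "u \<in> A i" "u \<in> P" for i u
  proof -
    obtain e where e: "u = p + e" "e \<in> E" using u(2) unfolding P_def by auto
    have "A i \<inter> P = (\<lambda>w. u + w) ` (A i \<inter> E)"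
    proof (rule set_eqI)
      fix v
      show "v \<in> A i \<inter> P \<longleftrightarrow> v \<in> (\<lambda>w. u + w) ` (A i \<inter> E)"
      proof
        assume v: "v \<in> A i \<inter> P"
        then obtain e' where e': "v = p + e'" "e' \<in> E" unfolding P_def by auto
        have "v - u \<in> A i" using v u by (simp add: diff_mem_A)
        moreover have "v - u \<in> E" using e e' sE by (simp add: vec.subspace_diff)
        ultimately show "v \<in> (\<lambda>w. u + w) ` (A i \<inter> E)" by (intro image_eqI[of _ _ "v - u"]) auto
      next
        assume "v \<in> (\<lambda>w. u + w) ` (A i \<inter> E)"
        then obtain w where w: "v = u + w" "w \<in> A i" "w \<in> E" by auto
        have "v \<in> A i" using w u by (simp add: add_mem_A)
        moreover have "v = p + (e + w)" "e + w \<in> E" using w e sE by (simp_all add: vec.subspace_add)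
        ultimately show "v \<in> A i \<inter> P" unfolding P_def by auto
      qed
    qed
    then show ?thesis by (simp add: card_image)
  qed
  have AE3: "card (A i \<inter> E) = 3" if i: "1 \<le> i" "i < 13" and e: "e \<in> A i" "e \<in> E" "e \<noteq> 0" for i e
  proof -
    have "A 0 \<inter> A i = {0, e, - e}" using A_inter_eq[of 0 i e] i e E_A0 by auto
    then have "A i \<inter> E = {0, e, - e}"
      using E_A0 e vec.subspace_0[OF sE] subspace_uminus[OF sE, of e] by auto
    then show ?thesis using e(3) neq_uminus[of e] by simp
  qed
  have hE: "h + t \<in> E" "h - t \<in> E" using E_in sE by (simp_all add: vec.subspace_add vec.subspace_diff)
  have f_j: "card (A j \<inter> P) = 3"
  proof -
    have "p \<in> P" unfolding P_def using vec.subspace_0[OF sE] by (intro image_eqI[of _ _ 0]) auto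
    then show ?thesis using card_P[OF j(3)] AE3[OF j(1,2) h(3) E_in(1) h(1)] by simp
  qed
  have f3: "card (A i \<inter> P) = 0 \<or> card (A i \<inter> P) = 3" if "i = a \<or> i = b" for i
  proof (cases "A i \<inter> P = {}")
    case False
    then obtain u where "u \<in> A i" "u \<in> P" by auto
    then show ?thesis using card_P AE3[OF a(1,2,3) hE(1) ts(5)] AE3[OF b(1,2,3) hE(2) ts(6)] that by auto
  qed simp
  have f1: "card (A i \<inter> P) = 1" if i: "1 \<le> i" "i < 13" "i \<noteq> j" "i \<noteq> a" "i \<noteq> b" for i
  proof -
    have "v = 0" if v: "v \<in> A i" "v \<in> E" for v
    proof (rule ccontr)
      assume nz: "v \<noteq> 0"
      have v0: "v \<in> A 0" using v(2) E_A0 by auto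
      have "v \<notin> A j" using A_unique[OF v0 nz i(1,2) v(1) j(1,2)] i by auto
      moreover have "v \<notin> A a" using A_unique[OF v0 nz i(1,2) v(1) a(1,2)] i by auto
      moreover have "v \<notin> A b" using A_unique[OF v0 nz i(1,2) v(1) b(1,2)] i by auto
      moreover have "v \<noteq> t" "v \<noteq> - t" using v(1) t(2) i by auto
      ultimately show False using E_cases[OF v(2)] nz a(3) b(3) h(3) uminus_A[of "h + t" a] uminus_A[of "h - t" b]
        by (elim disjE) simp_all
    qed
    \<comment> \<open>\<open>A i \<inter> X\<close> and \<open>E\<close> are complements in
      \<open>X\<close>, as 9 * 9 = 81; decomposing \<open>p\<close> gives a point of
      \<open>A i\<close> in \<open>P\<close>.\<close>
    then have int0: "A i \<inter> E = {0}" using vec.subspace_0[OF sE] by auto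
    have sAX: "vec.subspace (A i \<inter> X)" by (intro vec.subspace_inter subspace_A subspace_ker)
    let ?f = "\<lambda>(u, e). u + e"
    have "inj_on ?f ((A i \<inter> X) \<times> E)"
    proof (rule inj_onI)
      fix y z assume y: "y \<in> (A i \<inter> X) \<times> E" and z: "z \<in> (A i \<inter> X) \<times> E" and eq: "?f y = ?f z"
      obtain u e where ue: "y = (u, e)" by (cases y)
      obtain u' e' where ue': "z = (u', e')" by (cases z)
      have d: "u - u' = e' - e" using eq unfolding ue ue' by (simp add: algebra_simps)
      have "u - u' \<in> A i" using y z unfolding ue ue' by (simp add: diff_mem_A)
      moreover have "e' - e \<in> E" using y z sE unfolding ue ue' by (simp add: vec.subspace_diff)
      ultimately have "u - u' \<in> A i \<inter> E" using d by simp
      then have "u - u' = 0" unfolding int0 by simp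
      then show "y = z" using d unfolding ue ue' by simp
    qed
    then have "card (?f ` ((A i \<inter> X) \<times> E)) = 81"
      using card_A_inter_X[OF i(1,2)] cE by (simp add: card_image card_cartesian_product)
    moreover have "?f ` ((A i \<inter> X) \<times> E) \<subseteq> X"
      using E_A0 A0_X by (auto simp: mem_ker)
    ultimately have "?f ` ((A i \<inter> X) \<times> E) = X" using card_X by (intro card_subset_eq) auto
    then have "p \<in> ?f ` ((A i \<inter> X) \<times> E)" using p(1) by simp
    then obtain u e where ue: "p = u + e" "u \<in> A i" "e \<in> E" by auto
    have "u = p + (- e)" "- e \<in> E" using ue sE by (simp_all add: subspace_uminus)
    then have "u \<in> P" unfolding P_def by (rule image_eqI)
    then show ?thesis using card_P[OF ue(2)] int0 by simp
  qed
  have sum15: "(\<Sum>v\<in>P. c v) = 12 + card (A a \<inter> P) + card (A b \<inter> P)"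
  proof -
    let ?I = "{1..<13} - {j} - {a} - {b}"
    have "(\<Sum>i\<in>{1..<13}. card (A i \<inter> P)) = card (A j \<inter> P) + (\<Sum>i\<in>{1..<13} - {j}. card (A i \<inter> P))"
      using j(1,2) by (intro sum.remove) auto
    also have "(\<Sum>i\<in>{1..<13} - {j}. card (A i \<inter> P)) = card (A a \<inter> P) + (\<Sum>i\<in>{1..<13} - {j} - {a}. card (A i \<inter> P))"
      using a aj by (intro sum.remove) auto
    also have "(\<Sum>i\<in>{1..<13} - {j} - {a}. card (A i \<inter> P)) = card (A b \<inter> P) + (\<Sum>i\<in>?I. card (A i \<inter> P))"
      using b bj ab by (intro sum.remove) auto
    also have "(\<Sum>i\<in>?I. card (A i \<inter> P)) = (\<Sum>i\<in>?I. 1)"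
      using f1 by (intro sum.cong) auto
    also have "\<dots> = 9" using j(1,2) a(1,2) b(1,2) aj bj ab by (simp add: card_Diff_subset)
    finally show ?thesis using f_j by (simp add: sum_c)
  qed
  let ?S = "{v \<in> P. c v = 1}"
  let ?D = "{v \<in> P. c v = 2}"
  have sum: "(\<Sum>v\<in>P. c v) = 2 * card ?D + card ?S"
  proof (rule sum_le_2)
    show "c v \<le> 2" if "v \<in> P" for v
      using P_X(2)[OF that] zero_A[of 0] by (intro c_le_2) auto
  qed simp
  have DS: "card ?D + card ?S \<le> 9"
  proof -
    have "card (?D \<union> ?S) = card ?D + card ?S" by (intro card_Un_disjoint) auto
    moreover have "card (?D \<union> ?S) \<le> card P" by (intro card_mono) auto
    ultimately show ?thesis using cP by simp
  qed
  \<comment> \<open>The singles in \<open>P\<close> and their negatives are disjoint, and all of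
    them are among the four elements of \<open>singles_of x\<close>.\<close>
  have S2: "card ?S \<le> 2"
  proof -
    have "?S \<inter> uminus ` ?S = {}"
    proof (rule equals0I)
      fix v assume v: "v \<in> ?S \<inter> uminus ` ?S"
      then have "v \<in> P" "- v \<in> P" by auto
      then obtain e e' where e: "v = p + e" "- v = p + e'" "e \<in> E" "e' \<in> E" unfolding P_def by auto
      have "(p + p) + (e + e') = (p + e) + (p + e')" by (simp add: algebra_simps)
      also have "\<dots> = v + - v" using e(1,2) by simp
      finally have "- p + (e + e') = 0" by (simp only: double_not_self add.right_inverse)
      then have "e + e' = p" by (simp only: add_eq_0_iff minus_minus)
      then have "p \<in> A 0" using e(3,4) E_A0 add_mem_A[of e 0 e'] by auto
      then show False using p(2) by simp
    qed
    moreover have "?S \<union> uminus ` ?S \<subseteq> singles_of x"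
      using P_X by (auto simp: singles_of_def c_uminus subspace_uminus[OF subspace_ker])
    then have "card (?S \<union> uminus ` ?S) \<le> 4" using s card_mono[of "singles_of x" "?S \<union> uminus ` ?S"] by simp
    moreover have "card (uminus ` ?S) = card ?S" by (intro card_image) (auto simp: inj_on_def)
    ultimately show ?thesis by (simp add: card_Un_disjoint)
  qed
  have pP: "p \<in> P" "p + h \<in> P" "p - h \<in> P"
  proof -
    have "p = p + 0" "0 \<in> E" using vec.subspace_0[OF sE] by simp_all
    then show "p \<in> P" unfolding P_def by (rule image_eqI)
    show "p + h \<in> P" unfolding P_def using E_in(1) by (rule imageI)
    have "p - h = p + (- h)" "- h \<in> E" using E_in(1) sE by (simp_all add: subspace_uminus)
    then show "p - h \<in> P" unfolding P_def by (rule image_eqI)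
  qed
  have S1: "1 \<le> card ?S"
  proof -
    have "card {p} \<le> card ?S" using pP(1) p(3) by (intro card_mono) auto
    then show ?thesis by simp
  qed
  have bad1: "c (p + h) = 1 \<or> (\<exists>k\<in>{a, b}. p + h \<in> A k)"
    using bad[OF ph(1-3), of "- h"] by auto
  have bad2: "c (p - h) = 1 \<or> (\<exists>k\<in>{a, b}. p - h \<in> A k)"
    using bad[OF ph(4-6), of h] by auto
  have pos: "card (A k \<inter> P) \<noteq> 0" if "u \<in> A k" "u \<in> P" for u k
    using that by (auto simp: card_eq_0_iff)
  \<comment> \<open>The total is 18, 12 or 15. In turn, this leaves no single, makes
    \<open>p\<close>, \<open>p + h\<close> and \<open>p - h\<close> three singles, or leaves
    \<open>p\<close> as the only single, so that \<open>p + h\<close> and \<open>p - h\<close> share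
    a partner.\<close>
  consider (both) "card (A a \<inter> P) = 3" "card (A b \<inter> P) = 3"
    | (none) "card (A a \<inter> P) = 0" "card (A b \<inter> P) = 0"
    | (one) k k' where "{a, b} = {k, k'}" "card (A k \<inter> P) = 3" "card (A k' \<inter> P) = 0" "k \<noteq> j" "1 \<le> k" "k < 13"
    using f3[of a] f3[of b] a b aj bj by auto
  then show False
  proof cases
    case both
    then show False using sum15 sum DS S1 by linarith
  next
    case none
    then have "c (p + h) = 1" "c (p - h) = 1" using bad1 bad2 pos pP by auto
    then have "{p, p + h, p - h} \<subseteq> ?S" using pP p(3) by auto
    then have "card {p, p + h, p - h} \<le> card ?S" by (intro card_mono) auto
    moreover have "p + h \<noteq> p - h"
    proof
      assume "p + h = p - h"
      then have "h = - h" by simp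
      then show False using neq_uminus[OF h(1)] by simp
    qed
    ultimately show False using S2 h(1) by simp
  next
    case one
    then have "card (A a \<inter> P) + card (A b \<inter> P) = 3" using ab by (auto simp: doubleton_eq_iff)
    then have "15 = 2 * card ?D + card ?S" using sum15 sum by linarith
    moreover have "s = 1" if "15 = 2 * d + s" "1 \<le> s" "s \<le> 2" for d s :: nat
      using that by presburger
    ultimately have S: "card ?S = 1" using S1 S2 by simp
    have not1: "c u \<noteq> 1" if "u \<in> P" "u \<noteq> p" for u
    proof
      assume "c u = 1"
      then have "card {p, u} \<le> card ?S" using that pP p(3) by (intro card_mono) auto
      then show False using S that by simp
    qed
    have "p + h \<in> A k" using bad1 not1[OF pP(2)] h(1) one pos[of "p + h" k'] pP(2) by auto
    moreover have "p - h \<in> A k" using bad2 not1[OF pP(3)] h(1) one pos[of "p - h" k'] pP(3) by auto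
    moreover have "p - h + - h = p + - (h + h)" by simp
    ultimately have "p - h \<in> A k" "p - h + - h \<in> A k"
      by (simp_all only: double_not_self minus_minus)
    then show False using partner_unique[of j k "- h" "p - h"] one(4-6) j(1,2) h by simp
  qed
qed

end

section \<open>Coordinates of the cosets, and the contradiction with the search\<close>

primrec tval :: "trit \<Rightarrow> 'a::ring_1" where
  "tval T0 = 0" | "tval T1 = 1" | "tval T2 = -1"

context ternary
begin

lemma tval_tneg: "(tval (tneg x) :: 'q) = - tval x"
  by (cases x) simp_all

lemma tval_tadd: "(tval (tadd x y) :: 'q) = tval x + tval y"
proof -
  have "(1::'q) + 1 = -1" using two_eq by simp
  moreover have "(-1::'q) - 1 = 1" using calculation by (simp add: diff_eq_eq)
  ultimately show ?thesis by (cases x; cases y) simp_all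
qed

lemma tval_tmul: "(tval (tmul x y) :: 'q) = tval x * tval y"
  by (cases x) (simp_all add: tval_tneg)

lemma tval_inject: "(tval x :: 'q) = tval y \<longleftrightarrow> x = y"
  using one_neq_minus_one by (cases x; cases y) auto

lemma tval_surj: "\<exists>x. tval x = (k :: 'q)"
  using cases_q[of k] by (metis tval.simps)

end

text \<open>
  Coordinates of \<open>A 0\<close> are taken with respect to \<open>h3\<close>, \<open>h4\<close>, \<open>h5\<close>, where \<open>h5\<close> spans the only direction that
  lies on no other \<open>A i\<close>. The cosets of \<open>h1\<close> and \<open>h2\<close> are those of the two searches.
\<close>

locale frame = thirteen_lines_point ty l x for ty :: "'q::{field,finite} itself" and l x +
  fixes j k h1 h3 h4 h5
  assumes nd: "nondegenerate h5 j k h1 h3 h4"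
    and h5: "h5 \<in> A 0" "h5 \<noteq> 0" "\<forall>i. 1 \<le> i \<longrightarrow> i < 13 \<longrightarrow> h5 \<notin> A i" "tangents 0 = {h5, - h5}"
begin

lemma j: "1 \<le> j" "j < 13" and k: "1 \<le> k" "k < 13" and jk: "j \<noteq> k"
  and h1: "h1 \<in> A j" "h1 \<in> A k" "h1 \<in> X" "h1 \<notin> A 0"
  and h3: "h3 \<in> A 0" "h3 \<in> A j" "h3 \<noteq> 0"
  and h4: "h4 \<in> A 0" "h4 \<in> A k" "h4 \<noteq> 0"
  and h35: "h3 + h5 \<notin> A k" "h3 - h5 \<notin> A k"
  using nd by (simp_all add: nondegenerate_def)

lemma scale_mem_A: "v \<in> A i \<Longrightarrow> r *s v \<in> A i"
  by (simp add: vec.subspace_scale)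

definition comb :: "'q \<Rightarrow> 'q \<Rightarrow> 'q \<Rightarrow> 'q ^ 5" where
  "comb a b d = a *s h3 + b *s h4 + d *s h5"

lemma comb_A0: "comb a b d \<in> A 0"
  unfolding comb_def using h3(1) h4(1) h5(1) by (intro add_mem_A scale_mem_A)

lemma comb_add: "comb a b d + comb a' b' d' = comb (a + a') (b + b') (d + d')"
  by (simp add: comb_def vec.scale_left_distrib)

lemma comb_scale: "r *s comb a b d = comb (r * a) (r * b) (r * d)"
  by (simp add: comb_def vec.scale_right_distrib vec.scale_scale)

lemma comb_diff: "comb a b d - comb a' b' d' = comb (a - a') (b - b') (d - d')"
  by (simp add: comb_def vec.scale_left_diff_distrib)

text \<open>As \<open>h4\<close> is in \<open>A k\<close>, a relation puts
  \<open>a *s h3 + d *s h5\<close> into \<open>A k\<close>. Up to sign the nonzero combinations are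
  \<open>h3\<close>, \<open>h5\<close>, \<open>h3 + h5\<close> and \<open>h3 - h5\<close>, none of
  which is in \<open>A k\<close>.\<close>

lemma comb_eq_0:
  assumes "comb a b d = 0"
  shows "a = 0" "b = 0" "d = 0"
proof -
  have e: "a *s h3 + d *s h5 = - (b *s h4)"
    using assms by (simp add: comb_def eq_neg_iff_add_eq_0 algebra_simps)
  have m: "a *s h3 + d *s h5 \<in> A k"
    unfolding e using scale_mem_A[OF h4(2), of b] by simp
  have h5k: "h5 \<notin> A k" using h5(3) k by simp
  have h3k: "h3 \<notin> A k"
  proof
    assume "h3 \<in> A k"
    then have "j = k" by (rule A_unique[OF h3(1,3) j h3(2) k])
    then show False using jk by simp
  qed
  have n: "- h3 - h5 \<notin> A k" "- h3 + h5 \<notin> A k"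
    using h35 uminus_A[of "h3 + h5" k] uminus_A[of "h3 - h5" k] by simp_all
  have ad: "a = 0 \<and> d = 0"
    using cases_q[of a] cases_q[of d] m h5k h3k n h35 by (elim disjE) simp_all
  then have "b *s h4 = 0" using e by simp
  then show "a = 0" "b = 0" "d = 0" using ad h4(3) by simp_all
qed

lemma comb_inject: "comb a b d = comb a' b' d' \<longleftrightarrow> a = a' \<and> b = b' \<and> d = d'"
proof
  assume "comb a b d = comb a' b' d'"
  then have "comb (a - a') (b - b') (d - d') = 0" by (simp add: comb_diff[symmetric])
  then have "a - a' = 0" "b - b' = 0" "d - d' = 0" by (rule comb_eq_0)+
  then show "a = a' \<and> b = b' \<and> d = d'" by simp
qed simp

definition vec_of :: "point \<Rightarrow> 'q ^ 5" where
  "vec_of p = (case p of (a, b, d) \<Rightarrow> comb (tval a) (tval b) (tval d))"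

lemma vec_of_inject: "vec_of p = vec_of p' \<longleftrightarrow> p = p'"
  by (cases p; cases p') (simp add: vec_of_def comb_inject tval_inject)

lemma vec_of_A0: "vec_of p \<in> A 0"
  by (cases p) (simp add: vec_of_def comb_A0)

lemma range_vec_of: "range vec_of = A 0"
proof (rule card_subset_eq)
  show "range vec_of \<subseteq> A 0" using vec_of_A0 by auto
  have "inj vec_of" by (simp add: inj_def vec_of_inject)
  moreover have "card (UNIV :: point set) = 27"
    by (simp add: UNIV_Times_UNIV[symmetric] card_cartesian_product UNIV_trit del: UNIV_Times_UNIV)
  ultimately show "card (range vec_of) = card (A 0)" by (simp add: card_image card_A)
qed simp

lemma vec_of_surj: "v \<in> A 0 \<Longrightarrow> \<exists>p. v = vec_of p"
  unfolding range_vec_of[symmetric] by (erule rangeE) (rule exI)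

fun direction :: "dir \<Rightarrow> 'q ^ 5" where
  "direction (DA m n) = comb 1 (tval m) (tval n)"
| "direction (DB n) = comb 0 1 (tval n)"

fun base :: "dir \<Rightarrow> trit \<times> trit \<Rightarrow> 'q ^ 5" where
  "base (DA m n) (u, v) = comb 0 (tval u) (tval v)"
| "base (DB n) (u, v) = comb (tval u) 0 (tval v)"

lemma direction_A0: "direction d \<in> A 0"
  by (cases d) (simp_all add: comb_A0)

lemma base_A0: "base d lc \<in> A 0"
  by (cases "(d, lc)" rule: base.cases) (simp_all add: comb_A0)

lemma on_line_imp: "on_line d lc p \<Longrightarrow> \<exists>r. vec_of p = base d lc + r *s direction d"
proof -
  assume o: "on_line d lc p"
  obtain a b e where p: "p = (a, b, e)" by (cases p)
  obtain u v where lc: "lc = (u, v)" by (cases lc)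
  show ?thesis
  proof (cases d)
    case (DA m n)
    then have "vec_of p = base d lc + tval a *s direction d"
      using o by (simp add: p lc vec_of_def comb_scale comb_add comb_inject tval_tadd tval_tmul mult.commute)
    then show ?thesis by (rule exI)
  next
    case (DB n)
    then have "vec_of p = base d lc + tval b *s direction d"
      using o by (simp add: p lc vec_of_def comb_scale comb_add comb_inject tval_tadd tval_tmul mult.commute)
    then show ?thesis by (rule exI)
  qed
qed

lemma on_lineI:
  assumes e: "vec_of p = base d lc + r *s direction d"
  shows "on_line d lc p"
proof -
  obtain a b g where p: "p = (a, b, g)" by (cases p)
  obtain u v where lc: "lc = (u, v)" by (cases lc)
  show ?thesis
  proof (cases d)
    case (DA m n)
    have q: "tval a = r" "tval b = tval u + r * tval m" "tval g = tval v + r * tval n"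
      using e by (simp_all add: p lc DA vec_of_def comb_scale comb_add comb_inject)
    have "(tval b :: 'q) = tval (tadd u (tmul m a))" "(tval g :: 'q) = tval (tadd v (tmul n a))"
      unfolding tval_tadd tval_tmul q by (simp_all only: mult.commute)
    then show ?thesis by (simp add: p lc DA tval_inject)
  next
    case (DB n)
    have q: "tval a = (tval u :: 'q)" "tval b = r" "tval g = tval v + r * tval n"
      using e by (simp_all add: p lc DB vec_of_def comb_scale comb_add comb_inject)
    have "(tval g :: 'q) = tval (tadd v (tmul n b))"
      unfolding tval_tadd tval_tmul q by (simp_all only: mult.commute)
    then show ?thesis using q(1) by (simp add: p lc DB tval_inject)
  qed
qed

lemma base_inject: "base d lc = base d lc' + r *s direction d \<Longrightarrow> lc = lc'"
  by (cases "(d, lc)" rule: base.cases; cases lc')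
    (auto simp: comb_scale comb_add comb_inject tval_inject)

lemma direction_neq: "direction d \<noteq> 0" "direction d \<notin> tangents 0"
proof -
  have z: "0 = comb 0 0 0" "h5 = comb 0 0 1" "- h5 = comb 0 0 (-1)"
    by (simp_all add: comb_def)
  show "direction d \<noteq> 0" by (subst z(1), cases d) (simp_all add: comb_inject)
  have "direction d \<noteq> comb 0 0 1" "direction d \<noteq> comb 0 0 (-1)"
    by (cases d; simp add: comb_inject)+
  then show "direction d \<notin> tangents 0" unfolding h5(4) z(2,3)[symmetric] by simp
qed

lemma direction_inject:
  assumes "direction d = r *s direction d'"
  shows "d = d'"
proof -
  have "direction d = r *s direction d'" by (rule assms)
  then show ?thesis
    by (cases d; cases d') (auto simp: comb_scale comb_inject tval_inject)
qed

text \<open>A direction lies in exactly one \<open>A i\<close> with \<open>i\<close> positive; with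
  twelve directions and twelve indices this is a bijection, see \<open>range_index\<close>.\<close>

definition index :: "dir \<Rightarrow> nat" where
  "index d = (SOME i. 1 \<le> i \<and> i < 13 \<and> direction d \<in> A i)"

lemma index: "1 \<le> index d" "index d < 13" "direction d \<in> A (index d)"
  using someI_ex[OF A_cover[OF direction_A0 direction_neq(2,1), of d]] unfolding index_def by auto

lemma index_unique: "1 \<le> i \<Longrightarrow> i < 13 \<Longrightarrow> direction d \<in> A i \<Longrightarrow> index d = i"
  using A_unique[OF direction_A0 direction_neq(1) index] by auto

lemma A0_index:
  assumes "v \<in> A 0" "v \<in> A (index d)"
  obtains r where "v = r *s direction d"
proof -
  have i: "(0::nat) < 13" "0 \<noteq> index d" using index(1)[of d] by auto
  have "A 0 \<inter> A (index d) = {0, direction d, - direction d}"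
    by (rule A_inter_eq[OF i(1) index(2) i(2) direction_A0 index(3) direction_neq(1)])
  then have "v = 0 \<or> v = direction d \<or> v = - direction d" using assms by auto
  then have "v = 0 *s direction d \<or> v = 1 *s direction d \<or> v = (-1) *s direction d" by simp
  then show thesis by (elim disjE) (rule that, assumption)+
qed

lemma inj_index: "inj index"
proof (rule injI)
  fix d d' assume "index d = index d'"
  then have "direction d \<in> A (index d')" using index(3)[of d] by simp
  then obtain r where "direction d = r *s direction d'" by (rule A0_index[OF direction_A0])
  then show "d = d'" by (rule direction_inject)
qed

lemma range_index: "range index = {1..<13}"
proof (rule card_subset_eq)
  show "range index \<subseteq> {1..<13}" using index by auto
  show "card (range index) = card {1..<13::nat}" using inj_index by (simp add: card_image card_UNIV_dir)
qed simp

lemma mem_iff_on_line: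
  assumes g: "g + base d lc \<in> A (index d)"
  shows "g + vec_of p \<in> A (index d) \<longleftrightarrow> on_line d lc p"
proof
  assume "g + vec_of p \<in> A (index d)"
  then have "(g + vec_of p) - (g + base d lc) \<in> A (index d)" using g by (rule diff_mem_A)
  then have "vec_of p - base d lc \<in> A (index d)" by simp
  moreover have "vec_of p - base d lc \<in> A 0" by (intro diff_mem_A vec_of_A0 base_A0)
  ultimately obtain r where "vec_of p - base d lc = r *s direction d" using A0_index by metis
  then have "vec_of p = base d lc + r *s direction d" by (simp only: diff_eq_eq add.commute)
  then show "on_line d lc p" by (rule on_lineI)
next
  assume "on_line d lc p"
  then obtain r where r: "vec_of p = base d lc + r *s direction d" using on_line_imp by metis
  have "(g + base d lc) + r *s direction d \<in> A (index d)"
    by (intro add_mem_A g scale_mem_A index(3))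
  then show "g + vec_of p \<in> A (index d)" unfolding r by (simp only: add.assoc)
qed

lemma base_unique:
  assumes "g + base d lc \<in> A (index d)" "g + base d lc' \<in> A (index d)"
  shows "lc = lc'"
proof -
  have "(g + base d lc) - (g + base d lc') \<in> A (index d)" using assms by (rule diff_mem_A)
  then have "base d lc - base d lc' \<in> A (index d)" by simp
  moreover have "base d lc - base d lc' \<in> A 0" by (intro diff_mem_A base_A0)
  ultimately obtain r where "base d lc - base d lc' = r *s direction d" using A0_index by metis
  then have "base d lc = base d lc' + r *s direction d" by (simp only: diff_eq_eq add.commute)
  then show ?thesis by (rule base_inject)
qed

text \<open>Slide \<open>w\<close> along the line until its parameter is 0.\<close>

lemma base_exists:
  assumes "g + w \<in> A (index d)" "w \<in> A 0"
  shows "\<exists>lc. g + base d lc \<in> A (index d)"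
proof -
  obtain a b e where w: "w = comb (tval a) (tval b) (tval e)"
    using vec_of_surj[OF assms(2)] by (auto simp: vec_of_def split: prod.splits)
  have "\<exists>lc r. base d lc = w - r *s direction d"
  proof (cases d)
    case (DA m n)
    have "base d (tadd b (tneg (tmul m a)), tadd e (tneg (tmul n a))) = w - tval a *s direction d"
      by (simp add: DA w comb_scale comb_diff comb_inject tval_tadd tval_tneg tval_tmul mult.commute)
    then show ?thesis by (intro exI)
  next
    case (DB n)
    have "base d (a, tadd e (tneg (tmul n b))) = w - tval b *s direction d"
      by (simp add: DB w comb_scale comb_diff comb_inject tval_tadd tval_tneg tval_tmul mult.commute)
    then show ?thesis by (intro exI)
  qed
  then obtain lc r where lr: "base d lc = w - r *s direction d" by auto
  have "(g + w) - r *s direction d \<in> A (index d)"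
    by (intro diff_mem_A assms(1) scale_mem_A index(3))
  then have "g + base d lc \<in> A (index d)" unfolding lr by (simp only: add_diff_eq)
  then show ?thesis by (rule exI)
qed

text \<open>\<open>f d\<close> is the label of the affine line that \<open>A (index d)\<close> cuts
  out of \<open>g + A 0\<close>, translated into \<open>A 0\<close> by \<open>- g\<close>.\<close>

definition represents_coset :: "'q ^ 5 \<Rightarrow> (dir \<Rightarrow> trit \<times> trit) \<Rightarrow> bool" where
  "represents_coset g f \<longleftrightarrow> g \<notin> A 0 \<and> (\<forall>d. g + base d (f d) \<in> A (index d))"

lemma cover_eq_c:
  assumes "represents_coset g f"
  shows "cover f UNIV p = c (g + vec_of p)"
proof -
  have "on_line d (f d) p \<longleftrightarrow> g + vec_of p \<in> A (index d)" for d
    using mem_iff_on_line[of g d "f d" p] assms by (simp add: represents_coset_def)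
  then have "cover f UNIV p = card {d. g + vec_of p \<in> A (index d)}"
    by (simp add: cover_def)
  also have "\<dots> = card (index ` {d. g + vec_of p \<in> A (index d)})"
    by (rule card_image[symmetric]) (rule inj_on_subset[OF inj_index subset_UNIV])
  also have "index ` {d. g + vec_of p \<in> A (index d)} = {i \<in> range index. g + vec_of p \<in> A i}"
    by auto
  finally show ?thesis unfolding range_index c_def .
qed

lemma cover_le_2: "represents_coset g f \<Longrightarrow> cover f UNIV p \<le> 2"
proof -
  assume r: "represents_coset g f"
  have "g + vec_of p \<noteq> 0"
  proof
    assume "g + vec_of p = 0"
    then have "g = - vec_of p" by (simp only: eq_neg_iff_add_eq_0)
    then show False using r vec_of_A0[of p] by (simp add: represents_coset_def)
  qed
  then show ?thesis unfolding cover_eq_c[OF r] by (rule c_le_2)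
qed

lemma X_coordinate: "v \<in> X \<Longrightarrow> \<exists>r. v - r *s h1 \<in> A 0"
  using card_X card_A[of 0] by (intro coordinate[OF subspace_A subspace_ker A0_X _ h1(3,4)]) simp_all

text \<open>\<open>A (index d)\<close> has vectors in \<open>X - A 0\<close>, and scaling moves one
  of them into the coset of \<open>h1\<close>.\<close>

lemma h1_base_exists: "\<exists>lc. h1 + base d lc \<in> A (index d)"
proof -
  have "A (index d) \<inter> (X - A 0) \<noteq> {}" using card_A_X_minus[OF index(1,2), of d] by (intro notI) simp
  then obtain r where r: "r \<in> A (index d)" "r \<in> X" "r \<notin> A 0" by auto
  obtain s where s: "r - s *s h1 \<in> A 0" using X_coordinate[OF r(2)] by auto
  have "s \<noteq> 0" using s r(3) by auto
  then have "inverse s *s r = h1 + inverse s *s (r - s *s h1)"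
    by (simp add: vec.scale_right_diff_distrib vec.scale_scale)
  then have "h1 + inverse s *s (r - s *s h1) \<in> A (index d)" using scale_mem_A[OF r(1)] by metis
  then show ?thesis using scale_mem_A[OF s] by (rule base_exists)
qed

lemma full_coordinate:
  assumes "g \<notin> X"
  shows "\<exists>r. v - r *s g \<in> X"
proof -
  have "card (UNIV :: ('q ^ 5) set) = 3 * card X" by (simp add: card_X card_q)
  then show ?thesis
    by (intro coordinate[OF subspace_ker vec.subspace_UNIV subset_UNIV _ UNIV_I assms UNIV_I])
qed

text \<open>\<open>A (index d)\<close> is not contained in \<open>X\<close>, so after scaling it has
  a vector in \<open>g + X\<close>. Subtracting a multiple of its vector in \<open>h1 + A 0\<close>
  leads into \<open>g + A 0\<close>.\<close>

lemma base_exists_outside: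
  assumes g: "g \<notin> X"
  shows "\<exists>lc. g + base d lc \<in> A (index d)"
proof -
  obtain r where r: "r \<in> A (index d)" "r \<notin> X" using A_not_X[OF index(1,2), of d] by auto
  obtain s where s: "r - s *s g \<in> X" using full_coordinate[OF g] by metis
  have "s \<noteq> 0" using s r(2) by auto
  define y where "y = inverse s *s (r - s *s g)"
  have y: "y \<in> X" unfolding y_def using s by (rule vec.subspace_scale[OF subspace_ker])
  have "inverse s *s r = g + y"
    using \<open>s \<noteq> 0\<close> by (simp add: y_def vec.scale_right_diff_distrib vec.scale_scale)
  then have gy: "g + y \<in> A (index d)" using scale_mem_A[OF r(1)] by metis
  obtain u where u: "y - u *s h1 \<in> A 0" using X_coordinate[OF y] by metis
  obtain lc where lc: "h1 + base d lc \<in> A (index d)" using h1_base_exists by metis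
  have "(g + y) - u *s (h1 + base d lc) \<in> A (index d)"
    by (intro diff_mem_A gy scale_mem_A lc)
  moreover have "(g + y) - u *s (h1 + base d lc) = g + ((y - u *s h1) - u *s base d lc)"
    by (simp add: vec.scale_right_distrib)
  ultimately have "g + ((y - u *s h1) - u *s base d lc) \<in> A (index d)" by simp
  moreover have "(y - u *s h1) - u *s base d lc \<in> A 0"
    by (intro diff_mem_A u scale_mem_A base_A0)
  ultimately show ?thesis by (rule base_exists)
qed

lemma h1_coset: "\<exists>a. represents_coset h1 a"
  using h1_base_exists h1(4) unfolding represents_coset_def by metis

lemma index_h3: "index (DA T0 T0) = j"
  using j h3(2) by (intro index_unique) (simp_all add: comb_def)

lemma index_h4: "index (DB T0) = k"
  using k h4(2) by (intro index_unique) (simp_all add: comb_def)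

text \<open>Starting in \<open>A j\<close>, a multiple of \<open>h3\<close> clears the first entry
  of the label for \<open>DB T0\<close>, a sign makes the second entry 1, and for
  \<open>v = T1\<close> a multiple of \<open>h1\<close> clears the second entry for
  \<open>DA T1 T0\<close>. As \<open>h1\<close> lies in \<open>A j\<close> and in
  \<open>A k\<close>, the last step keeps what the others have achieved.\<close>

lemma choose_h2:
  assumes a: "h1 + base (DA T1 T0) (u, v) \<in> A (index (DA T1 T0))"
  obtains h2 w w' where "h2 \<in> A j" "h2 \<notin> X" "h2 + h5 \<in> A k"
    "h2 + base (DA T1 T0) (w, w') \<in> A (index (DA T1 T0))" "v = T1 \<longrightarrow> w' = T0"
proof -
  obtain g0 where g0: "g0 \<in> A j" "g0 \<notin> X" using A_not_X[OF j] by auto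
  obtain l0 where l0: "g0 + base (DB T0) l0 \<in> A k"
    using base_exists_outside[OF g0(2), of "DB T0"] unfolding index_h4 by metis
  obtain y z where yz: "l0 = (y, z)" by (cases l0)
  define g1 where "g1 = g0 + tval y *s h3"
  have "h3 \<in> X" using h3(1) A0_X by auto
  then have "tval y *s h3 \<in> X" by (rule vec.subspace_scale[OF subspace_ker])
  then have g1: "g1 \<in> A j" "g1 \<notin> X"
    using g0 add_mem_A[OF g0(1) scale_mem_A[OF h3(2)], of "tval y"]
    by (auto simp: g1_def mem_ker)
  have z: "g1 + tval z *s h5 \<in> A k"
    using l0 by (simp add: yz comb_def g1_def add.assoc)
  have "\<exists>g2. g2 \<in> A j \<and> g2 \<notin> X \<and> g2 + h5 \<in> A k"
  proof (cases z)
    case T0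
    \<comment> \<open>This case cannot occur: \<open>A j \<inter> A k\<close> consists of multiples
      of \<open>h1\<close> and lies in \<open>X\<close>.\<close>
    then have "g1 \<in> A k" using z by simp
    then have "g1 \<in> A j \<inter> A k" using g1 by simp
    moreover have "A j \<inter> A k = {0, h1, - h1}"
      using h1(4) zero_A[of 0] by (intro A_inter_eq[OF j(2) k(2) jk h1(1,2)]) auto
    ultimately have "g1 = 0 \<or> g1 = h1 \<or> g1 = - h1" by simp
    then have "g1 \<in> X" using h1(3) subspace_uminus[OF subspace_ker, of h1 x] vec.subspace_0[OF subspace_ker, of x] by auto
    then show ?thesis using g1(2) by simp
  next
    case T1
    then show ?thesis using g1 z by (intro exI[of _ g1]) simp
  next
    case T2
    have "- g1 \<in> A j" "- g1 \<notin> X" using g1 by (simp_all add: subspace_uminus[OF subspace_ker])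
    moreover have "- (g1 + tval z *s h5) = - g1 + h5" by (simp add: T2)
    then have "- g1 + h5 \<in> A k" using z uminus_A[of "g1 + tval z *s h5" k] by simp
    ultimately show ?thesis by (intro exI[of _ "- g1"]) simp
  qed
  then obtain g2 where g2: "g2 \<in> A j" "g2 \<notin> X" "g2 + h5 \<in> A k" by auto
  let ?d = "DA T1 T0"
  obtain l2 where l2: "g2 + base ?d l2 \<in> A (index ?d)" using base_exists_outside[OF g2(2)] by metis
  obtain w w' where w: "l2 = (w, w')" by (cases l2)
  show thesis
  proof (cases "v = T1")
    case False
    then show thesis using that[of g2 w w'] g2 l2 w by simp
  next
    case True
    let ?r = "tval w'"
    have "g2 - ?r *s h1 \<in> A j" by (intro diff_mem_A g2(1) scale_mem_A h1(1))
    moreover have "g2 - ?r *s h1 \<notin> X"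
    proof
      assume "g2 - ?r *s h1 \<in> X"
      then have "g2 - ?r *s h1 + ?r *s h1 \<in> X"
        using h1(3) by (intro vec.subspace_add[OF subspace_ker] vec.subspace_scale[OF subspace_ker])
      then show False using g2(2) by simp
    qed
    moreover have "(g2 + h5) - ?r *s h1 \<in> A k" by (intro diff_mem_A g2(3) scale_mem_A h1(2))
    then have "(g2 - ?r *s h1) + h5 \<in> A k" by (simp add: algebra_simps)
    moreover have "(g2 + base ?d l2) - ?r *s (h1 + base ?d (u, v)) \<in> A (index ?d)"
      by (intro diff_mem_A l2 scale_mem_A a)
    then have "(g2 - ?r *s h1) + (base ?d l2 - ?r *s base ?d (u, v)) \<in> A (index ?d)"
      by (simp add: vec.scale_right_distrib algebra_simps)
    moreover have "base ?d l2 - ?r *s base ?d (u, v) = base ?d (tadd w (tneg (tmul w' u)), T0)"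
      by (simp add: w True comb_scale comb_diff comb_inject tval_tadd tval_tneg tval_tmul)
    ultimately show thesis
      using that[of "g2 - ?r *s h1" "tadd w (tneg (tmul w' u))" T0] by simp
  qed
qed

text \<open>\<open>X - A 0\<close> consists of the cosets of \<open>h1\<close> and
  \<open>- h1\<close>, which negation exchanges, so four singles mean two in each. One of them is
  \<open>h1 + h3\<close>, the point \<open>(1, 0, 0)\<close>.\<close>

lemma singles_type_exists:
  assumes a: "represents_coset h1 a" and s: "singles_of x = {} \<or> card (singles_of x) = 4 \<and> c (h1 + h3) = 1"
  shows "\<exists>q. singles_type q a"
proof -
  let ?g = "\<lambda>p. h1 + vec_of p"
  have S: "singles a = {p. c (?g p) = 1}"
    by (simp add: singles_def cover_eq_c[OF a])
  have gX: "?g p \<in> X" "?g p \<notin> A 0" for p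
  proof -
    have "vec_of p \<in> X" by (rule subsetD[OF A0_X vec_of_A0])
    then show "?g p \<in> X" using h1(3) by (simp add: mem_ker)
    show "?g p \<notin> A 0" using h1(4) diff_mem_A[of "?g p" 0 "vec_of p"] vec_of_A0[of p] by auto
  qed
  show ?thesis
    using s
  proof
    assume "singles_of x = {}"
    then have "c (?g p) \<noteq> 1" for p using gX[of p] by (auto simp: singles_of_def)
    then have "singles_type None a" by (simp add: singles_type_def S)
    then show ?thesis by (rule exI)
  next
    assume 4: "card (singles_of x) = 4 \<and> c (h1 + h3) = 1"
    let ?F = "?g ` singles a"
    have inj: "inj ?g" by (simp add: inj_def vec_of_inject)
    have cF: "card ?F = card (singles a)" using inj by (intro card_image) (rule inj_on_subset[OF _ subset_UNIV])
    have cN: "card (uminus ` ?F) = card ?F" by (intro card_image) (simp add: inj_on_def)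
    have "singles_of x = ?F \<union> uminus ` ?F"
    proof (rule set_eqI)
      fix v
      show "v \<in> singles_of x \<longleftrightarrow> v \<in> ?F \<union> uminus ` ?F"
      proof
        assume v: "v \<in> singles_of x"
        then have v': "v \<in> X" "v \<notin> A 0" "c v = 1" by (simp_all add: singles_of_def)
        obtain r where r: "v - r *s h1 \<in> A 0" using X_coordinate[OF v'(1)] by metis
        have "r \<noteq> 0" using r v'(2) by auto
        then have "r = 1 \<or> r = -1" using cases_q[of r] by simp
        then show "v \<in> ?F \<union> uminus ` ?F"
        proof
          assume "r = 1"
          then obtain p where "v - h1 = vec_of p" using vec_of_surj[of "v - h1"] r by auto
          then have "v = ?g p" by (simp only: diff_eq_eq add.commute)
          then show ?thesis using v'(3) S by simp
        next
          assume "r = -1"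
          then have "- (v + h1) \<in> A 0" using r uminus_A[of "v + h1" 0] by simp
          then obtain p where p: "- (v + h1) = vec_of p" using vec_of_surj by metis
          have "- v = ?g p" unfolding p[symmetric] by simp
          moreover have "c (- v) = 1" using v'(3) by (simp add: c_uminus)
          ultimately have "p \<in> singles a" using S by simp
          moreover have "v = - ?g p" using \<open>- v = ?g p\<close> by (metis minus_minus)
          ultimately have "v \<in> uminus ` ?F" by (elim image_eqI) (rule imageI)
          then show ?thesis by (rule UnI2)
        qed
      next
        assume "v \<in> ?F \<union> uminus ` ?F"
        then obtain p where p: "p \<in> singles a" "v = ?g p \<or> v = - ?g p" by auto
        have "c (?g p) = 1" using p(1) S by simp
        moreover have "?g p \<in> singles_of x" using calculation gX[of p] by (simp add: singles_of_def)
        ultimately show "v \<in> singles_of x"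
          using p(2) by (auto simp: singles_of_def c_uminus subspace_uminus[OF subspace_ker]
              simp del: add_uminus_conv_diff minus_add_distrib)
      qed
    qed
    moreover have "?F \<inter> uminus ` ?F = {}"
    proof (rule equals0I)
      fix v assume "v \<in> ?F \<inter> uminus ` ?F"
      then obtain p p' where "?g p = - ?g p'" by auto
      then have "(h1 + h1) + (vec_of p + vec_of p') = 0"
        by (simp add: eq_neg_iff_add_eq_0 algebra_simps)
      then have "- h1 + (vec_of p + vec_of p') = 0" by (simp only: double_not_self)
      then have "vec_of p + vec_of p' = h1" by (simp only: add_eq_0_iff minus_minus)
      then show False using h1(4) add_mem_A[OF vec_of_A0[of p] vec_of_A0[of p']] by simp
    qed
    ultimately have "card (singles a) = 2" using 4 cF cN by (simp add: card_Un_disjoint)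
    then obtain y z where yz: "singles a = {y, z}" "y \<noteq> z" unfolding card_2_iff by (elim exE conjE)
    have m: "(T1, T0, T0) \<in> singles a"
      using 4 by (simp add: S vec_of_def comb_def)
    have "\<exists>p. singles a = {(T1, T0, T0), p} \<and> p \<noteq> (T1, T0, T0)"
    proof (cases "(T1, T0, T0) = y")
      case True
      then show ?thesis using yz by (intro exI[of _ z]) simp
    next
      case False
      then have "(T1, T0, T0) = z" using m unfolding yz(1) by simp
      then show ?thesis using yz by (intro exI[of _ y]) (simp add: insert_commute)
    qed
    then obtain p where p: "singles a = {(T1, T0, T0), p}" "p \<noteq> (T1, T0, T0)" by (elim exE conjE)
    obtain a1 b1 e1 where "p = (a1, b1, e1)" by (cases p)
    then have "singles_type (Some (a1, b1)) a" using p by (auto simp: singles_type_def)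
    then show ?thesis by (rule exI)
  qed
qed

lemma base_shift:
  "base d (shift (\<lambda>y. y) a b d) = base d (b d) + base d (a d)"
  "base d (shift tneg a b d) = base d (b d) - base d (a d)"
  by (cases d; cases "a d"; cases "b d"; simp add: shift_def comb_add comb_diff comb_inject tval_tadd tval_tneg)+

lemma frame_false:
  assumes a0: "h1 + base (DA T1 T0) (u, v) \<in> A (index (DA T1 T0))" "v \<noteq> T2"
    and s: "singles_of x = {} \<or> card (singles_of x) = 4 \<and> c (h1 + h3) = 1"
  shows False
proof -
  obtain a where a: "represents_coset h1 a" using h1_coset by metis
  obtain h2 w w' where h2: "h2 \<in> A j" "h2 \<notin> X" "h2 + h5 \<in> A k"
    "h2 + base (DA T1 T0) (w, w') \<in> A (index (DA T1 T0))" "v = T1 \<longrightarrow> w' = T0"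
    by (rule choose_h2[OF a0(1)])
  have h2A: "h2 \<notin> A 0" using h2(2) A0_X by auto
  have "\<forall>d. \<exists>lc. h2 + base d lc \<in> A (index d)" using base_exists_outside[OF h2(2)] by metis
  then obtain b where "\<forall>d. h2 + base d (b d) \<in> A (index d)" by metis
  then have b: "represents_coset h2 b" using h2A by (simp add: represents_coset_def)
  have ad: "h1 + base d (a d) \<in> A (index d)" and bd: "h2 + base d (b d) \<in> A (index d)" for d
    using a b by (simp_all add: represents_coset_def)
  have notX: "h2 + h1 \<notin> A 0" "h2 - h1 \<notin> A 0"
  proof -
    have "h2 + h1 \<notin> X" "h2 - h1 \<notin> X" using h2(2) h1(3) by (simp_all add: mem_ker)
    then show "h2 + h1 \<notin> A 0" "h2 - h1 \<notin> A 0" using A0_X by auto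
  qed
  have sum: "represents_coset (h2 + h1) (shift (\<lambda>y. y) a b)"
    unfolding represents_coset_def
  proof (intro conjI notX allI)
    fix d
    have "(h2 + base d (b d)) + (h1 + base d (a d)) \<in> A (index d)" by (intro add_mem_A ad bd)
    then show "h2 + h1 + base d (shift (\<lambda>y. y) a b d) \<in> A (index d)"
      by (simp add: base_shift algebra_simps)
  qed
  have diff: "represents_coset (h2 - h1) (shift tneg a b)"
    unfolding represents_coset_def
  proof (intro conjI notX allI)
    fix d
    have "(h2 + base d (b d)) - (h1 + base d (a d)) \<in> A (index d)" by (intro diff_mem_A ad bd)
    then show "h2 - h1 + base d (shift tneg a b d) \<in> A (index d)"
      by (simp add: base_shift algebra_simps)
  qed
  obtain q where q: "singles_type q a" using singles_type_exists[OF a s] by metis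
  have a1: "a (DA T0 T0) = (T0, T0)"
    using h1(1) index_h3 by (intro base_unique[OF ad, of "DA T0 T0"]) (simp add: comb_def)
  have a2: "a (DB T0) = (T0, T0)"
    using h1(2) index_h4 by (intro base_unique[OF ad, of "DB T0"]) (simp add: comb_def)
  have a3: "a (DA T1 T0) = (u, v)" by (rule base_unique[OF ad a0(1)])
  have b1: "b (DA T0 T0) = (T0, T0)"
    using h2(1) index_h3 by (intro base_unique[OF bd, of "DA T0 T0"]) (simp add: comb_def)
  have b2: "b (DB T0) = (T0, T1)"
    using h2(3) index_h4 by (intro base_unique[OF bd, of "DB T0"]) (simp add: comb_def)
  have b3: "b (DA T1 T0) = (w, w')" by (rule base_unique[OF bd h2(4)])
  have v: "v = T0 \<or> w' = T0" using a0(2) h2(5) by (cases v) auto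
  show False
    by (rule no_configuration[OF cover_le_2[OF a] cover_le_2[OF b] cover_le_2[OF sum] cover_le_2[OF diff]
          a1 a2 a3 a0(2) b1 b2 b3 v q])
qed

end

context thirteen_lines_point
begin

lemma nondegenerate_uminus: "nondegenerate t j k h1 h3 h4 \<Longrightarrow> nondegenerate (- t) j k h1 h3 h4"
  by (simp add: nondegenerate_def)

lemma impossible: False
proof -
  obtain t where t: "t \<in> A 0" "t \<noteq> 0" "\<forall>j. 1 \<le> j \<longrightarrow> j < 13 \<longrightarrow> t \<notin> A j" "tangents 0 = {t, - t}"
    by (rule obtain_tangent)
  have "\<exists>j k h1 h3 h4. nondegenerate t j k h1 h3 h4 \<and>
      (singles_of x = {} \<or> card (singles_of x) = 4 \<and> c (h1 + h3) = 1)"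
    using card_singles
  proof
    assume "card (singles_of x) = 0"
    then have "singles_of x = {}" by simp
    then show ?thesis using nondegenerate_if_no_singles[OF _ t(1,3)] by simp
  next
    assume 4: "card (singles_of x) = 4"
    obtain j k h1 h3 h4 where "nondegenerate t j k h1 h3 h4 \<and> c (h1 + h3) = 1"
      using nondegenerate_if_singles[OF 4 t(1,3,2,4)] by (elim exE)
    then have "nondegenerate t j k h1 h3 h4 \<and>
        (singles_of x = {} \<or> card (singles_of x) = 4 \<and> c (h1 + h3) = 1)"
      using 4 by simp
    then show ?thesis by (intro exI)
  qed
  then obtain j k h1 h3 h4 where nd: "nondegenerate t j k h1 h3 h4"
    and s: "singles_of x = {} \<or> card (singles_of x) = 4 \<and> c (h1 + h3) = 1"
    by (elim exE conjE)
  interpret F: frame ty l x j k h1 h3 h4 t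
    by unfold_locales (fact nd t)+
  have nt: "- t \<in> A 0" "- t \<noteq> 0" "\<forall>j. 1 \<le> j \<longrightarrow> j < 13 \<longrightarrow> - t \<notin> A j" "tangents 0 = {- t, - (- t)}"
    using t by (simp_all add: insert_commute)
  interpret G: frame ty l x j k h1 h3 h4 "- t"
    by unfold_locales (fact nondegenerate_uminus[OF nd] nt)+
  obtain lc where lc: "h1 + F.base (DA T1 T0) lc \<in> A (F.index (DA T1 T0))"
    using F.h1_base_exists by metis
  obtain u v where uv: "lc = (u, v)" by (cases lc)
  show False
  proof (cases "v = T2")
    case False
    then show False using F.frame_false[OF lc[unfolded uv] _ s] by simp
  next
    case True
    \<comment> \<open>The label \<open>(u, T2)\<close> stands for \<open>tval u *s h4 - t\<close>;
      with \<open>- t\<close> as last basis vector it becomes \<open>(u, T1)\<close>, while the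
      direction \<open>h3 + h4\<close> stays the same.\<close>
    have "F.direction (DA T1 T0) = G.direction (DA T1 T0)"
      by (simp add: F.comb_def G.comb_def)
    then have "F.index (DA T1 T0) = G.index (DA T1 T0)"
      by (simp only: F.index_def G.index_def)
    moreover have "F.base (DA T1 T0) (u, v) = G.base (DA T1 T0) (u, T1)"
      by (simp add: F.comb_def G.comb_def True)
    ultimately have "h1 + G.base (DA T1 T0) (u, T1) \<in> A (G.index (DA T1 T0))"
      using lc uv by simp
    then show False by (rule G.frame_false) (simp, rule s)
  qed
qed

end

theorem (in ternary) no_thirteen_lines: "\<not> line_family 13 2 l"
proof
  assume l: "line_family 13 2 l"
  interpret thirteen_lines ty l by unfold_locales (rule l)
  obtain x where x: "x \<in> l 0" "x \<noteq> 0" "card (singles_of x) \<le> 6" by (rule choose_x)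
  interpret thirteen_lines_point ty l x by unfold_locales (fact x)+
  show False by (rule impossible)
qed

section \<open>Explicit families of lines\<close>

type_synonym line = "trit list \<times> trit list"

text \<open>
  Lines are given by a basis and hyperplanes by a normal vector, in coordinates.
\<close>

fun tdot :: "trit list \<Rightarrow> trit list \<Rightarrow> trit" where
  "tdot (a # as) (b # bs) = tadd (tmul a b) (tdot as bs)"
| "tdot _ _ = T0"

primrec lines_in :: "trit list \<Rightarrow> line list \<Rightarrow> nat" where
  "lines_in h [] = 0"
| "lines_in h (l # ls) =
    (if tdot h (fst l) = T0 then if tdot h (snd l) = T0 then Suc (lines_in h ls) else lines_in h ls
     else lines_in h ls)"

definition all_normals :: "trit list list" where
  "all_normals = product_lists (replicate 5 [T0, T1, T2])"

definition at_most :: "nat \<Rightarrow> line list \<Rightarrow> bool" where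
  "at_most s ls \<longleftrightarrow> (\<forall>h\<in>set all_normals. h = replicate 5 T0 \<or> lines_in h ls \<le> s)"

text \<open>
  The lines \<open>{(u, v, u a + v \<theta> a)}\<close> for \<open>a \<in> F\<^sub>2\<^sub>7\<close>, where \<open>\<theta>\<^sup>3 = \<theta> - 1\<close>. They are disjoint from the
  plane \<open>E\<close> where the first two coordinates vanish.
\<close>

definition mrd :: "line list" where
  "mrd = [
    ([T1, T0, T0, T0, T0], [T0, T1, T0, T0, T0]),
    ([T1, T0, T0, T0, T1], [T0, T1, T2, T1, T0]),
    ([T1, T0, T0, T0, T2], [T0, T1, T1, T2, T0]),
    ([T1, T0, T0, T1, T0], [T0, T1, T0, T0, T1]),
    ([T1, T0, T0, T1, T1], [T0, T1, T2, T1, T1]),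
    ([T1, T0, T0, T1, T2], [T0, T1, T1, T2, T1]),
    ([T1, T0, T0, T2, T0], [T0, T1, T0, T0, T2]),
    ([T1, T0, T0, T2, T1], [T0, T1, T2, T1, T2]),
    ([T1, T0, T0, T2, T2], [T0, T1, T1, T2, T2]),
    ([T1, T0, T1, T0, T0], [T0, T1, T0, T1, T0]),
    ([T1, T0, T1, T0, T1], [T0, T1, T2, T2, T0]),
    ([T1, T0, T1, T0, T2], [T0, T1, T1, T0, T0]),
    ([T1, T0, T1, T1, T0], [T0, T1, T0, T1, T1]),
    ([T1, T0, T1, T1, T1], [T0, T1, T2, T2, T1]),
    ([T1, T0, T1, T1, T2], [T0, T1, T1, T0, T1]),
    ([T1, T0, T1, T2, T0], [T0, T1, T0, T1, T2]),
    ([T1, T0, T1, T2, T1], [T0, T1, T2, T2, T2]),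
    ([T1, T0, T1, T2, T2], [T0, T1, T1, T0, T2]),
    ([T1, T0, T2, T0, T0], [T0, T1, T0, T2, T0]),
    ([T1, T0, T2, T0, T1], [T0, T1, T2, T0, T0]),
    ([T1, T0, T2, T0, T2], [T0, T1, T1, T1, T0]),
    ([T1, T0, T2, T1, T0], [T0, T1, T0, T2, T1]),
    ([T1, T0, T2, T1, T1], [T0, T1, T2, T0, T1]),
    ([T1, T0, T2, T1, T2], [T0, T1, T1, T1, T1]),
    ([T1, T0, T2, T2, T0], [T0, T1, T0, T2, T2]),
    ([T1, T0, T2, T2, T1], [T0, T1, T2, T0, T2]),
    ([T1, T0, T2, T2, T2], [T0, T1, T1, T1, T2])]"

text \<open>
  The next three families were found by a computer search.
\<close>

definition twelve_lines :: "line list" where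
  "twelve_lines = [
    ([T1, T0, T0, T0, T0], [T0, T2, T0, T0, T1]),
    ([T0, T1, T0, T0, T0], [T0, T0, T2, T1, T0]),
    ([T1, T1, T0, T0, T0], [T2, T0, T0, T2, T1]),
    ([T0, T0, T1, T0, T0], [T1, T0, T0, T1, T1]),
    ([T0, T1, T1, T1, T0], [T2, T0, T2, T0, T1]),
    ([T0, T2, T1, T1, T0], [T0, T2, T1, T0, T1]),
    ([T1, T2, T1, T0, T0], [T2, T2, T0, T2, T1]),
    ([T1, T0, T2, T1, T0], [T1, T2, T1, T0, T1]),
    ([T1, T1, T1, T0, T0], [T0, T1, T0, T1, T1]),
    ([T0, T2, T1, T0, T0], [T1, T1, T0, T1, T0]),
    ([T2, T0, T1, T0, T0], [T2, T1, T0, T0, T1]),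
    ([T1, T1, T1, T1, T0], [T2, T1, T2, T0, T1])]"

definition thirty_four_lines :: "line list" where
  "thirty_four_lines = [
    ([T1, T0, T0, T0, T0], [T0, T2, T2, T1, T0]),
    ([T1, T2, T1, T0, T0], [T0, T0, T0, T1, T0]),
    ([T0, T0, T2, T1, T0], [T2, T0, T2, T0, T1]),
    ([T1, T1, T1, T1, T0], [T2, T2, T0, T0, T1]),
    ([T1, T1, T0, T0, T0], [T0, T0, T1, T0, T0]),
    ([T2, T1, T0, T0, T0], [T2, T0, T1, T0, T1]),
    ([T2, T2, T1, T0, T0], [T1, T0, T0, T2, T1]),
    ([T2, T0, T0, T1, T0], [T2, T0, T1, T0, T1]),
    ([T0, T1, T0, T1, T0], [T1, T1, T2, T0, T1]),
    ([T2, T0, T2, T1, T0], [T0, T2, T2, T0, T1]),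
    ([T0, T2, T0, T1, T0], [T0, T1, T0, T0, T1]),
    ([T2, T0, T2, T1, T0], [T0, T0, T1, T0, T1]),
    ([T1, T1, T2, T1, T0], [T1, T1, T2, T0, T1]),
    ([T2, T1, T1, T0, T0], [T2, T1, T0, T0, T1]),
    ([T1, T2, T0, T1, T0], [T1, T0, T0, T0, T1]),
    ([T0, T1, T2, T1, T0], [T0, T2, T0, T0, T1]),
    ([T0, T1, T1, T1, T0], [T2, T0, T0, T0, T1]),
    ([T1, T0, T0, T0, T0], [T0, T0, T1, T1, T0]),
    ([T0, T0, T0, T1, T0], [T1, T1, T0, T0, T1]),
    ([T0, T0, T2, T1, T0], [T0, T1, T1, T0, T1]),
    ([T1, T0, T0, T1, T0], [T2, T1, T2, T0, T1]),
    ([T2, T1, T1, T1, T0], [T1, T2, T2, T0, T1]),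
    ([T2, T1, T0, T0, T0], [T0, T0, T0, T0, T1]),
    ([T0, T1, T1, T0, T0], [T0, T1, T0, T2, T1]),
    ([T2, T1, T0, T1, T0], [T2, T2, T1, T0, T1]),
    ([T1, T1, T1, T0, T0], [T1, T0, T0, T1, T1]),
    ([T0, T1, T0, T0, T0], [T2, T0, T2, T1, T1]),
    ([T2, T0, T1, T0, T0], [T1, T2, T0, T1, T1]),
    ([T0, T2, T1, T1, T0], [T1, T0, T2, T0, T1]),
    ([T0, T2, T1, T1, T0], [T2, T1, T1, T0, T1]),
    ([T0, T2, T1, T0, T0], [T1, T1, T0, T2, T1]),
    ([T1, T1, T0, T1, T0], [T0, T1, T1, T0, T1]),
    ([T2, T2, T0, T1, T0], [T2, T1, T2, T0, T1]),
    ([T1, T0, T1, T1, T0], [T2, T2, T2, T0, T1])]"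

definition forty_four_lines :: "line list" where
  "forty_four_lines = [
    ([T0, T0, T1, T0, T0], [T0, T1, T0, T0, T1]),
    ([T0, T1, T2, T1, T0], [T1, T2, T0, T0, T1]),
    ([T0, T2, T1, T1, T0], [T0, T1, T2, T0, T1]),
    ([T2, T2, T1, T0, T0], [T2, T0, T0, T1, T0]),
    ([T2, T0, T1, T1, T0], [T2, T2, T2, T0, T1]),
    ([T0, T2, T1, T0, T0], [T1, T0, T0, T1, T0]),
    ([T1, T2, T2, T1, T0], [T2, T2, T2, T0, T1]),
    ([T1, T0, T1, T0, T0], [T2, T1, T0, T1, T0]),
    ([T1, T0, T1, T1, T0], [T2, T1, T0, T0, T1]),
    ([T1, T0, T1, T0, T0], [T0, T1, T0, T0, T1]),
    ([T1, T0, T1, T1, T0], [T1, T2, T0, T0, T1]),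
    ([T1, T0, T0, T0, T0], [T0, T2, T1, T0, T1]),
    ([T1, T2, T0, T1, T0], [T0, T0, T1, T0, T1]),
    ([T0, T2, T0, T1, T0], [T0, T0, T2, T0, T1]),
    ([T1, T0, T2, T1, T0], [T2, T2, T1, T0, T1]),
    ([T0, T1, T0, T0, T0], [T2, T0, T1, T2, T1]),
    ([T2, T2, T1, T1, T0], [T1, T0, T1, T0, T1]),
    ([T1, T0, T2, T1, T0], [T1, T1, T0, T0, T1]),
    ([T2, T1, T1, T0, T0], [T0, T1, T0, T2, T1]),
    ([T2, T1, T1, T1, T0], [T1, T2, T1, T0, T1]),
    ([T1, T2, T0, T1, T0], [T1, T2, T2, T0, T1]),
    ([T2, T1, T0, T0, T0], [T1, T0, T2, T2, T1]),
    ([T1, T1, T0, T0, T0], [T2, T0, T2, T1, T1]),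
    ([T0, T0, T2, T1, T0], [T2, T0, T1, T0, T1]),
    ([T1, T1, T0, T1, T0], [T2, T1, T1, T0, T1]),
    ([T2, T2, T0, T1, T0], [T0, T0, T0, T0, T1]),
    ([T0, T2, T2, T1, T0], [T1, T1, T2, T0, T1]),
    ([T2, T0, T1, T0, T0], [T0, T1, T0, T1, T1]),
    ([T2, T0, T2, T1, T0], [T1, T0, T2, T0, T1]),
    ([T2, T1, T2, T1, T0], [T2, T0, T2, T0, T1]),
    ([T0, T1, T0, T1, T0], [T2, T0, T0, T0, T1]),
    ([T1, T1, T1, T0, T0], [T0, T0, T0, T1, T0]),
    ([T1, T2, T1, T0, T0], [T0, T0, T0, T2, T1]),
    ([T1, T0, T0, T0, T0], [T0, T0, T1, T1, T1]),
    ([T2, T0, T1, T0, T0], [T1, T0, T0, T0, T1]),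
    ([T0, T2, T0, T1, T0], [T2, T2, T0, T0, T1]),
    ([T0, T0, T0, T1, T0], [T0, T2, T0, T0, T1]),
    ([T0, T1, T1, T0, T0], [T2, T2, T0, T2, T1]),
    ([T1, T1, T0, T0, T0], [T0, T0, T1, T1, T0]),
    ([T1, T2, T1, T0, T0], [T1, T1, T0, T0, T1]),
    ([T2, T1, T1, T0, T0], [T1, T1, T0, T1, T1]),
    ([T0, T0, T2, T1, T0], [T0, T0, T0, T0, T1]),
    ([T1, T1, T0, T1, T0], [T1, T1, T2, T0, T1]),
    ([T2, T1, T0, T0, T0], [T1, T0, T0, T1, T1])]"

text \<open>
  Line spreads of the four hyperplanes containing \<open>E\<close>.
\<close>

definition spread1 :: "line list" where
  "spread1 = [
    ([T1, T0, T0, T0, T0], [T0, T0, T1, T0, T0]),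
    ([T1, T0, T0, T0, T1], [T0, T0, T1, T2, T0]),
    ([T1, T0, T0, T0, T2], [T0, T0, T1, T1, T0]),
    ([T1, T0, T0, T1, T0], [T0, T0, T1, T0, T1]),
    ([T1, T0, T0, T1, T1], [T0, T0, T1, T2, T1]),
    ([T1, T0, T0, T1, T2], [T0, T0, T1, T1, T1]),
    ([T1, T0, T0, T2, T0], [T0, T0, T1, T0, T2]),
    ([T1, T0, T0, T2, T1], [T0, T0, T1, T2, T2]),
    ([T1, T0, T0, T2, T2], [T0, T0, T1, T1, T2]),
    ([T0, T0, T0, T1, T0], [T0, T0, T0, T0, T1])]"

definition spread2 :: "line list" where
  "spread2 = [
    ([T0, T1, T0, T0, T0], [T0, T0, T1, T0, T0]),
    ([T0, T1, T0, T0, T1], [T0, T0, T1, T2, T0]),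
    ([T0, T1, T0, T0, T2], [T0, T0, T1, T1, T0]),
    ([T0, T1, T0, T1, T0], [T0, T0, T1, T0, T1]),
    ([T0, T1, T0, T1, T1], [T0, T0, T1, T2, T1]),
    ([T0, T1, T0, T1, T2], [T0, T0, T1, T1, T1]),
    ([T0, T1, T0, T2, T0], [T0, T0, T1, T0, T2]),
    ([T0, T1, T0, T2, T1], [T0, T0, T1, T2, T2]),
    ([T0, T1, T0, T2, T2], [T0, T0, T1, T1, T2]),
    ([T0, T0, T0, T1, T0], [T0, T0, T0, T0, T1])]"

definition spread3 :: "line list" where
  "spread3 = [
    ([T1, T1, T0, T0, T0], [T0, T0, T1, T0, T0]),
    ([T1, T1, T0, T0, T1], [T0, T0, T1, T2, T0]),
    ([T1, T1, T0, T0, T2], [T0, T0, T1, T1, T0]),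
    ([T1, T1, T0, T1, T0], [T0, T0, T1, T0, T1]),
    ([T1, T1, T0, T1, T1], [T0, T0, T1, T2, T1]),
    ([T1, T1, T0, T1, T2], [T0, T0, T1, T1, T1]),
    ([T1, T1, T0, T2, T0], [T0, T0, T1, T0, T2]),
    ([T1, T1, T0, T2, T1], [T0, T0, T1, T2, T2]),
    ([T1, T1, T0, T2, T2], [T0, T0, T1, T1, T2]),
    ([T0, T0, T0, T1, T0], [T0, T0, T0, T0, T1])]"

definition spread4 :: "line list" where
  "spread4 = [
    ([T1, T2, T0, T0, T0], [T0, T0, T1, T0, T0]),
    ([T1, T2, T0, T0, T1], [T0, T0, T1, T2, T0]),
    ([T1, T2, T0, T0, T2], [T0, T0, T1, T1, T0]),
    ([T1, T2, T0, T1, T0], [T0, T0, T1, T0, T1]),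
    ([T1, T2, T0, T1, T1], [T0, T0, T1, T2, T1]),
    ([T1, T2, T0, T1, T2], [T0, T0, T1, T1, T1]),
    ([T1, T2, T0, T2, T0], [T0, T0, T1, T0, T2]),
    ([T1, T2, T0, T2, T1], [T0, T0, T1, T2, T2]),
    ([T1, T2, T0, T2, T2], [T0, T0, T1, T1, T2]),
    ([T0, T0, T0, T1, T0], [T0, T0, T0, T0, T1])]"

lemma twelve_lines: "at_most 2 twelve_lines"
  by code_simp

text \<open>If the normal does not vanish on \<open>E\<close>, containment prescribes \<phi>(a) and
  \<phi>(\<theta> a) for a nonzero functional \<phi>. As 1 and \<theta> are independent, so are the
  two conditions, and three \<open>a\<close> remain. A hyperplane through \<open>E\<close> contains
  none of the lines, since inside it a line would meet \<open>E\<close>.\<close>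

lemma mrd: "at_most 3 mrd"
  by code_simp

lemma thirty_four_lines: "at_most 4 thirty_four_lines"
  by code_simp

lemma forty_four_lines: "at_most 5 forty_four_lines"
  by code_simp

text \<open>Three copies of \<open>mrd\<close> with one to four spreads, in one evaluation. A
  hyperplane not through \<open>E\<close> contains at most 9 lines from the copies and one of each
  spread, as it meets the hyperplane of the spread in a plane. A hyperplane through \<open>E\<close>
  contains no line of \<open>mrd\<close>, the 10 lines of its own spread, and from any other spread
  only the line in \<open>E\<close>. With \<open>i\<close> spreads this is at most
  \<open>9 + i\<close>.\<close>

definition combined :: "trit list \<Rightarrow> bool" where
  "combined h \<longleftrightarrow> h = replicate 5 T0 \<or>
    (let m = 3 * lines_in h mrd; a = m + lines_in h spread1; b = a + lines_in h spread2;
       c = b + lines_in h spread3; d = c + lines_in h spread4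
     in a \<le> 10 \<and> b \<le> 11 \<and> c \<le> 12 \<and> d \<le> 13)"

lemma combined: "\<forall>h\<in>set all_normals. combined h"
  by code_simp

section \<open>Values of the maximum\<close>

lemma lines_in_append: "lines_in h (xs @ ys) = lines_in h xs + lines_in h ys"
  by (induction xs) simp_all

lemmas line_list_defs = mrd_def twelve_lines_def thirty_four_lines_def forty_four_lines_def
  spread1_def spread2_def spread3_def spread4_def

definition proper :: "line list \<Rightarrow> bool" where
  "proper ls \<longleftrightarrow> (\<forall>l\<in>set ls. length (fst l) = 5 \<and> length (snd l) = 5)"

lemma proper_append: "proper (xs @ ys) \<longleftrightarrow> proper xs \<and> proper ys"
  by (auto simp: proper_def)

lemma proper_lists: "proper mrd" "proper twelve_lines" "proper thirty_four_lines" "proper forty_four_lines"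
  "proper spread1" "proper spread2" "proper spread3" "proper spread4"
  unfolding proper_def line_list_defs by simp_all

lemma length_lists: "length mrd = 27" "length twelve_lines = 12" "length thirty_four_lines = 34"
  "length forty_four_lines = 44" "length spread1 = 10" "length spread2 = 10" "length spread3 = 10"
  "length spread4 = 10"
  unfolding line_list_defs by simp_all

lemma in_all_normals: "length h = 5 \<Longrightarrow> h \<in> set all_normals"
proof -
  assume "length h = 5"
  moreover have "x \<in> {T0, T1, T2}" for x by (cases x) simp_all
  ultimately show ?thesis
    by (simp add: all_normals_def product_lists_set list_all2_conv_all_nth)
qed

lemma combined_at_most:
  "at_most 10 (mrd @ mrd @ mrd @ spread1)"
  "at_most 11 (mrd @ mrd @ mrd @ spread1 @ spread2)"
  "at_most 12 (mrd @ mrd @ mrd @ spread1 @ spread2 @ spread3)"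
  "at_most 13 (mrd @ mrd @ mrd @ spread1 @ spread2 @ spread3 @ spread4)"
  unfolding at_most_def
  by (intro ballI; drule bspec[OF combined]; unfold combined_def Let_def lines_in_append; elim disjE; simp)+

section \<open>From lists of coordinates to subspaces, and attainable sizes\<close>

context ternary
begin

definition idx :: "5 \<Rightarrow> nat" where
  "idx = (SOME f. bij_betw f UNIV {..<5})"

lemma idx: "bij_betw idx UNIV {..<5}"
proof -
  have "\<exists>f. bij_betw f (UNIV :: 5 set) {..<5::nat}"
    by (rule finite_same_card_bij) simp_all
  then show ?thesis unfolding idx_def by (rule someI_ex)
qed

definition coords :: "trit list \<Rightarrow> 'q ^ 5" where
  "coords xs = (\<chi> i. tval (xs ! idx i))"

lemma tval_tdot:
  "length xs = length ys \<Longrightarrow> (tval (tdot xs ys) :: 'q) = (\<Sum>i<length xs. tval (xs ! i) * tval (ys ! i))"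
  by (induction xs ys rule: list_induct2)
    (simp_all add: tval_tadd tval_tmul sum.lessThan_Suc_shift del: sum.lessThan_Suc)

lemma dot_coords:
  assumes "length xs = 5" "length ys = 5"
  shows "dot (coords xs) (coords ys) = tval (tdot xs ys)"
proof -
  have "dot (coords xs) (coords ys) = (\<Sum>i\<in>UNIV. (\<lambda>j. tval (xs ! j) * tval (ys ! j)) (idx i))"
    by (simp add: dot_def coords_def)
  also have "\<dots> = (\<Sum>j<5. tval (xs ! j) * tval (ys ! j))"
    by (rule sum.reindex_bij_betw[OF idx])
  finally show ?thesis using tval_tdot[of xs ys] assms by simp
qed

lemma coords_surj: "\<exists>xs. length xs = 5 \<and> coords xs = h"
proof -
  obtain f where f: "\<And>k::'q. tval (f k) = k" using tval_surj by metis
  have inj: "inj idx" using idx by (rule bij_betw_imp_inj_on)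
  define xs where "xs = map (\<lambda>j. f (h $ inv idx j)) [0..<5]"
  have "idx i < 5" for i using bij_betwE[OF idx] by simp
  then have "coords xs = h"
    by (simp add: vec_eq_iff coords_def xs_def f inv_f_f[OF inj])
  then show ?thesis by (intro exI[of _ xs]) (simp add: xs_def)
qed

lemma coords_zero: "coords (replicate 5 T0) = 0"
proof -
  have "idx i < 5" for i using bij_betwE[OF idx] by simp
  then show ?thesis by (simp add: vec_eq_iff coords_def)
qed

definition line_span :: "line \<Rightarrow> ('q ^ 5) set" where
  "line_span l = vec.span {coords (fst l), coords (snd l)}"

lemma line_span_in_ker:
  assumes "length h = 5" "length (fst l) = 5" "length (snd l) = 5"
  shows "line_span l \<subseteq> ker (coords h) \<longleftrightarrow> tdot h (fst l) = T0 \<and> tdot h (snd l) = T0"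
proof -
  have "line_span l \<subseteq> ker (coords h) \<longleftrightarrow> {coords (fst l), coords (snd l)} \<subseteq> ker (coords h)"
    unfolding line_span_def
  proof
    assume "vec.span {coords (fst l), coords (snd l)} \<subseteq> ker (coords h)"
    with vec.span_superset show "{coords (fst l), coords (snd l)} \<subseteq> ker (coords h)" by (rule order_trans)
  qed (rule vec.span_minimal[OF _ subspace_ker])
  also have "\<dots> \<longleftrightarrow> tval (tdot h (fst l)) = (tval T0 :: 'q) \<and> tval (tdot h (snd l)) = (tval T0 :: 'q)"
    by (simp add: mem_ker dot_coords assms)
  finally show ?thesis unfolding tval_inject .
qed

lemma num_contained_lines:
  assumes "length h = 5" "proper ls"
  shows "num_contained (mset (map line_span ls)) (ker (coords h)) = lines_in h ls"
  using assms(2)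
proof (induction ls)
  case (Cons l ls)
  then show ?case
    using line_span_in_ker[OF assms(1), of l]
    by (simp add: num_contained_def proper_def)
qed (simp add: num_contained_def)

text \<open>Unlike in \<open>projective_system\<close>, the bound \<open>s\<close> need not be
  reached, so that sums of families can be formed; \<open>n_max_eqI\<close> recovers
  equality.\<close>

definition attains :: "nat \<Rightarrow> nat \<Rightarrow> bool" where
  "attains n s \<longleftrightarrow> (\<exists>\<S> :: ('q ^ 5) set multiset. size \<S> = n \<and>
     (\<forall>S\<in>#\<S>. vec.subspace S \<and> vec.dim S \<le> 2) \<and> (\<forall>H. hyperplane H \<longrightarrow> num_contained \<S> H \<le> s))"

lemma attains_lines:
  assumes "at_most s ls" "proper ls" "length ls = n"
  shows "attains n s"
proof -
  let ?S = "mset (map line_span ls)"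
  have d: "vec.subspace (line_span l) \<and> vec.dim (line_span l) \<le> 2" for l
  proof -
    have "vec.dim (line_span l) \<le> card {coords (fst l), coords (snd l)}"
      unfolding line_span_def by (rule dim_span_le) simp
    also have "\<dots> \<le> 2" by (simp add: card_insert_if)
    finally show ?thesis by (simp add: line_span_def)
  qed
  have "num_contained ?S H \<le> s" if hyp: "hyperplane H" for H
  proof -
    obtain h where h: "h \<noteq> 0" "H = ker h" using hyp unfolding hyperplane_iff by (elim exE conjE)
    obtain xs where xs: "length xs = 5" "coords xs = h" using coords_surj by metis
    have "xs \<noteq> replicate 5 T0" using h(1) xs(2) coords_zero by metis
    then have "lines_in xs ls \<le> s"
      using assms(1) in_all_normals[OF xs(1)] unfolding at_most_def by metis
    then show ?thesis using num_contained_lines[OF xs(1) assms(2)] by (simp add: h(2) xs(2))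
  qed
  then show ?thesis unfolding attains_def using d assms(3) by (intro exI[of _ ?S]) auto
qed

lemma attains_add:
  assumes "attains n s" "attains n' s'"
  shows "attains (n + n') (s + s')"
proof -
  obtain S :: "('q ^ 5) set multiset" where S: "size S = n"
    "\<forall>X\<in>#S. vec.subspace X \<and> vec.dim X \<le> 2" "\<forall>H. hyperplane H \<longrightarrow> num_contained S H \<le> s"
    using assms(1) unfolding attains_def by (elim exE conjE)
  obtain S' :: "('q ^ 5) set multiset" where S': "size S' = n'"
    "\<forall>X\<in>#S'. vec.subspace X \<and> vec.dim X \<le> 2" "\<forall>H. hyperplane H \<longrightarrow> num_contained S' H \<le> s'"
    using assms(2) unfolding attains_def by (elim exE conjE)
  have "num_contained (S + S') H \<le> s + s'" if "hyperplane H" for H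
    using S(3)[rule_format, OF that] S'(3)[rule_format, OF that] by (simp add: num_contained_def)
  moreover have "\<forall>X\<in>#S + S'. vec.subspace X \<and> vec.dim X \<le> 2" using S(2) S'(2) by auto
  ultimately show ?thesis unfolding attains_def using S(1) S'(1) by (intro exI[of _ "S + S'"]) simp
qed

lemma attains_mult: "attains n s \<Longrightarrow> attains (k * n) (k * s)"
proof (induction k)
  case 0
  show ?case unfolding attains_def
    by (intro exI[of _ "{#}"]) (simp add: num_contained_def)
next
  case (Suc k)
  then show ?case using attains_add[of n s] by simp
qed

lemma attains_1: "attains 1 1"
proof -
  have "num_contained {#{0 :: 'q ^ 5}#} H \<le> 1" for H
    by (simp add: num_contained_def)
  then show ?thesis unfolding attains_def by (intro exI[of _ "{#{0}#}"]) simp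
qed

lemmas lists_ok = proper_append proper_lists length_lists

lemma attains_27: "attains 27 3" and attains_34: "attains 34 4" and attains_44: "attains 44 5"
  and attains_12: "attains 12 2"
  by (rule attains_lines, rule mrd thirty_four_lines forty_four_lines twelve_lines; simp add: lists_ok)+

lemma attains_91_to_121: "attains 91 10" "attains 101 11" "attains 111 12" "attains 121 13"
  by (rule attains_lines, rule combined_at_most; simp add: lists_ok)+

text \<open>Adds \<open>t - u\<close> copies of the family of 121 lines with bound 13.\<close>

lemma attains_shift:
  assumes "attains n s" "n + c = 121 * u" "s + j = 13 * u" "u \<le> t"
  shows "attains (121 * t - c) (13 * t - j)"
proof -
  obtain k where t: "t = u + k" using assms(4) by (metis le_iff_add)
  have "attains (n + k * 121) (s + k * 13)"
    by (rule attains_add[OF assms(1) attains_mult[OF attains_91_to_121(4)]])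
  moreover have "n + k * 121 = 121 * t - c" "s + k * 13 = 13 * t - j"
    using assms(2,3) unfolding t by simp_all
  ultimately show ?thesis by simp
qed

lemma attains_line_family:
  assumes "attains n s"
  obtains l where "line_family n s l"
proof -
  obtain S :: "('q ^ 5) set multiset" where S: "size S = n"
    "\<forall>X\<in>#S. vec.subspace X \<and> vec.dim X \<le> 2" "\<forall>H. hyperplane H \<longrightarrow> num_contained S H \<le> s"
    using assms(1) unfolding attains_def by (elim exE conjE)
  show thesis
    by (rule line_family_of_system[OF S(1) S(2)[rule_format] S(3)[rule_format]]) (assumption, assumption, rule that)
qed

text \<open>An entry \<open>(j, c)\<close> stands for the bound \<open>121 * t - c\<close> at
  \<open>s = 13 * t - j\<close>. The last one, which is \<open>(0, 0)\<close> one period earlier,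
  serves for \<open>s - 1\<close> when \<open>j = 12\<close>.\<close>

definition bounds :: "(int \<times> int) set" where
  "bounds = {(0, 0), (1, 10), (2, 20), (3, 30), (4, 40), (5, 50), (6, 60), (7, 67), (8, 77),
    (9, 87), (10, 94), (11, 104), (12, 114), (13, 121)}"

lemma attains_le:
  assumes "attains n s" "(j, c) \<in> bounds" "int s = 13 * t - j"
  shows "int n \<le> 121 * t - c"
proof -
  obtain l where l: "line_family n s l" by (rule attains_line_family[OF assms(1)])
  obtain m2 m1 where m: "3 * m2 + n \<le> 13 * s" "39 * m1 + 4 * n \<le> 40 * m2" "4 * n \<le> 121 * m1"
    using griesmer[OF l] by (elim exE conjE)
  have i: "3 * int m2 + int n \<le> 13 * int s" "39 * int m1 + 4 * int n \<le> 40 * int m2"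
    "4 * int n \<le> 121 * int m1" using m by linarith+
  have "121 * ((40 * ((c - 1 - 13 * j) div 3) + 4 * c - 4) div 39) < 4 - 4 * c"
    using assms(2) unfolding bounds_def by auto
  then show ?thesis by (rule griesmer_arith[OF i assms(3) refl refl])
qed

text \<open>If a family with bound \<open>s\<close> did not reach it, then it would attain
  \<open>n\<close> for \<open>s - 1\<close>, which the last assumption excludes.\<close>

lemma n_max_eqI:
  assumes "attains n s" "0 < s" "\<And>m. attains m s \<Longrightarrow> m \<le> n" "\<And>m. attains m (s - 1) \<Longrightarrow> m < n"
  shows "n_max TYPE('q ^ 5) 2 s = n"
proof -
  let ?N = "{n. \<exists>\<S> :: ('q ^ 5) set multiset. projective_system 2 n s \<S>}"
  have le: "m \<le> n" if m: "m \<in> ?N" for m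
  proof -
    obtain S :: "('q ^ 5) set multiset" where "projective_system 2 m s S" using m by auto
    then have "attains m s" unfolding attains_def projective_system_def by (intro exI[of _ S]) simp
    then show ?thesis by (rule assms(3))
  qed
  have "n \<in> ?N"
  proof -
    obtain S :: "('q ^ 5) set multiset" where S: "size S = n"
      "\<forall>X\<in>#S. vec.subspace X \<and> vec.dim X \<le> 2" "\<forall>H. hyperplane H \<longrightarrow> num_contained S H \<le> s"
      using assms(1) unfolding attains_def by (elim exE conjE)
    have "\<exists>H. hyperplane H \<and> num_contained S H = s"
    proof (rule ccontr)
      assume no: "\<nexists>H. hyperplane H \<and> num_contained S H = s"
      have "num_contained S H \<le> s - 1" if "hyperplane H" for H
      proof -
        have "num_contained S H \<noteq> s" using no that by metis
        then show ?thesis using S(3)[rule_format, OF that] by linarith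
      qed
      then have "attains n (s - 1)" unfolding attains_def using S(1,2) by (intro exI[of _ S]) simp
      then show False using assms(4) by blast
    qed
    then have "projective_system 2 n s S" using S by (simp add: projective_system_def)
    then show ?thesis by (intro CollectI exI)
  qed
  moreover have "finite ?N" using le by (intro finite_subset[of ?N "{..n}"]) (auto simp del: mem_Collect_eq)
  ultimately show ?thesis unfolding n_max_def using le by (intro Max_eqI)
qed

lemma n_max_value:
  assumes "attains n s" "n + c = 121 * u" "s + j = 13 * u" "u \<le> t" "0 < s"
    and "(int j, int c) \<in> bounds" "(int j + 1, int c') \<in> bounds" "c < c'"
  shows "n_max TYPE('q ^ 5) 2 (13 * t - j) = 121 * t - c"
proof -
  have ge: "j < 13 * t" "c \<le> 121 * t" using assms(2-5) by linarith+
  show ?thesis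
  proof (rule n_max_eqI)
    show "attains (121 * t - c) (13 * t - j)" by (rule attains_shift[OF assms(1-4)])
    show "0 < 13 * t - j" using ge(1) by simp
    show "m \<le> 121 * t - c" if "attains m (13 * t - j)" for m
      using attains_le[OF that assms(6), of "int t"] ge by (simp add: of_nat_diff)
    show "m < 121 * t - c" if "attains m (13 * t - j - 1)" for m
      using attains_le[OF that assms(7), of "int t"] ge assms(8) by (simp add: of_nat_diff)
  qed
qed

text \<open>Any two lines lie in a common hyperplane: their annihilators share a nonzero vector, as
  27 * 27 > 243.\<close>

lemma attains_1_le: "attains n 1 \<Longrightarrow> n \<le> 1"
proof (rule ccontr)
  assume "attains n 1" "\<not> n \<le> 1"
  then have n: "1 < n" by simp
  obtain l where l: "line_family n 1 l" by (rule attains_line_family[OF \<open>attains n 1\<close>])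
  have s: "vec.subspace (l i)" "card (l i) = 9" if "i < n" for i
    using l that by (simp_all add: line_family_def)
  obtain h where h: "h \<noteq> 0" "h \<in> annihilator (l 0)" "h \<in> annihilator (l 1)"
  proof (rule pigeonhole_subspaces[of "annihilator (l 0)" "annihilator (l 1)" UNIV])
    show "card (UNIV :: ('q ^ 5) set) < card (annihilator (l 0)) * card (annihilator (l 1))"
      using n by (simp add: card_annihilator s card_q)
  qed (simp_all add: subspace_annihilator)
  have "{0, 1} \<subseteq> {i. i < n \<and> l i \<subseteq> ker h}" using h n by (simp add: annihilator_def)
  then have "card {0::nat, 1} \<le> card {i. i < n \<and> l i \<subseteq> ker h}" by (intro card_mono) simp_all
  also have "\<dots> \<le> 1" using l h(1) by (simp add: line_family_def)
  finally show False by simp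
qed

lemma attains_2_le: "attains n 2 \<Longrightarrow> n \<le> 12"
proof (rule ccontr)
  assume "attains n 2" "\<not> n \<le> 12"
  then have n: "13 \<le> n" by simp
  obtain l where l: "line_family n 2 l" by (rule attains_line_family[OF \<open>attains n 2\<close>])
  have "card {i. i < 13 \<and> l i \<subseteq> ker h} \<le> 2" if "h \<noteq> 0" for h
  proof -
    have "card {i. i < 13 \<and> l i \<subseteq> ker h} \<le> card {i. i < n \<and> l i \<subseteq> ker h}"
      using n by (intro card_mono) auto
    also have "\<dots> \<le> 2" using l that by (simp add: line_family_def)
    finally show ?thesis .
  qed
  then have "line_family 13 2 l" using l n by (simp add: line_family_def)
  then show False using no_thirteen_lines by simp
qed

lemma n_max_1: "n_max TYPE('q ^ 5) 2 1 = 1"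
proof (rule n_max_eqI[OF attains_1 _ attains_1_le])
  \<comment> \<open>Here \<open>s - 1 = 0\<close>, and the entry \<open>(0, 0)\<close> with
    \<open>t = 0\<close> gives \<open>m \<le> 0\<close>.\<close>
  show "m < 1" if "attains m (1 - 1)" for m
    using attains_le[OF that, of 0 0 0] by (simp add: bounds_def)
qed simp

lemma n_max_2: "n_max TYPE('q ^ 5) 2 2 = 12"
proof (rule n_max_eqI[OF attains_12 _ attains_2_le])
  show "m < 12" if "attains m (2 - 1)" for m
    using attains_1_le[of m] that by simp
qed simp

end

theorem theorem5:
  assumes "CARD('q::{field,finite}) = 3"
  shows
    "(\<forall>t::nat. t \<ge> 1 \<longrightarrow> n_max TYPE('q ^ 5) 2 (13 * t) = 121 * t) \<and>
     (\<forall>t::nat. t \<ge> 1 \<longrightarrow> n_max TYPE('q ^ 5) 2 (13 * t - 1) = 121 * t - 10) \<and>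
     (\<forall>t::nat. t \<ge> 1 \<longrightarrow> n_max TYPE('q ^ 5) 2 (13 * t - 2) = 121 * t - 20) \<and>
     (\<forall>t::nat. t \<ge> 1 \<longrightarrow> n_max TYPE('q ^ 5) 2 (13 * t - 3) = 121 * t - 30) \<and>
     (\<forall>t::nat. t \<ge> 1 \<longrightarrow> n_max TYPE('q ^ 5) 2 (13 * t - 4) = 121 * t - 40) \<and>
     (\<forall>t::nat. t \<ge> 1 \<longrightarrow> n_max TYPE('q ^ 5) 2 (13 * t - 5) = 121 * t - 50) \<and>
     (\<forall>t::nat. t \<ge> 1 \<longrightarrow> n_max TYPE('q ^ 5) 2 (13 * t - 6) = 121 * t - 60) \<and>
     (\<forall>t::nat. t \<ge> 1 \<longrightarrow> n_max TYPE('q ^ 5) 2 (13 * t - 7) = 121 * t - 67) \<and>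
     (\<forall>t::nat. t \<ge> 1 \<longrightarrow> n_max TYPE('q ^ 5) 2 (13 * t - 8) = 121 * t - 77) \<and>
     (\<forall>t::nat. t \<ge> 1 \<longrightarrow> n_max TYPE('q ^ 5) 2 (13 * t - 9) = 121 * t - 87) \<and>
     (\<forall>t::nat. t \<ge> 1 \<longrightarrow> n_max TYPE('q ^ 5) 2 (13 * t - 10) = 121 * t - 94) \<and>
     (\<forall>t::nat. t \<ge> 2 \<longrightarrow> n_max TYPE('q ^ 5) 2 (13 * t - 11) = 121 * t - 104) \<and>
     n_max TYPE('q ^ 5) 2 2 = 12 \<and>
     (\<forall>t::nat. t \<ge> 2 \<longrightarrow> n_max TYPE('q ^ 5) 2 (13 * t - 12) = 121 * t - 114) \<and>
     n_max TYPE('q ^ 5) 2 1 = 1"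
proof -
  interpret ternary "TYPE('q)" by unfold_locales (rule assms)
  have 81: "attains 81 9" using attains_mult[OF attains_27, of 3] by simp
  have 71: "attains 71 8" using attains_add[OF attains_44 attains_27] by simp
  have 61: "attains 61 7" using attains_add[OF attains_34 attains_27] by simp
  have 54: "attains 54 6" using attains_mult[OF attains_27, of 2] by simp
  \<comment> \<open>For \<open>j = 11\<close> and \<open>j = 12\<close> the value at
    \<open>t = 1\<close> is below the formula, so these families start at \<open>t = 2\<close>, with
    242 - 104 and 242 - 114 lines.\<close>
  have 138: "attains 138 15" using attains_add[OF attains_27 attains_91_to_121(3)] by simp
  have 128: "attains 128 14" using attains_add[OF attains_27 attains_91_to_121(2)] by simp
  show ?thesis
    using n_max_value[OF attains_91_to_121(4), of 0 1 0 _ 10] n_max_value[OF attains_91_to_121(3), of 10 1 1 _ 20]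
      n_max_value[OF attains_91_to_121(2), of 20 1 2 _ 30] n_max_value[OF attains_91_to_121(1), of 30 1 3 _ 40]
      n_max_value[OF 81, of 40 1 4 _ 50] n_max_value[OF 71, of 50 1 5 _ 60]
      n_max_value[OF 61, of 60 1 6 _ 67] n_max_value[OF 54, of 67 1 7 _ 77]
      n_max_value[OF attains_44, of 77 1 8 _ 87] n_max_value[OF attains_34, of 87 1 9 _ 94]
      n_max_value[OF attains_27, of 94 1 10 _ 104] n_max_value[OF 138, of 104 2 11 _ 114]
      n_max_value[OF 128, of 114 2 12 _ 121] n_max_1 n_max_2
    by (simp add: bounds_def)
qed

end
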